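(* Let $H:[0,\infty)\to[\mu,\nu]\subset(0,1)$ be an arbitrary measurable function and let $\{B^{H(t)}(t),\,t\in[0,1]\}$ be the multifractional Brownian motion with Hurst function $H$ given by the moving average representation $$B^{H(t)}(t)=\frac{1}{\Gamma(H(t)+1/2)}\left(\int_{-\infty}^{0}\big[(t-u)^{H(t)-1/2}-(-u)^{H(t)-1/2}\big]\,W(du)+\int_0^t (t-u)^{H(t)-1/2}\,W(du)\right).$$ Let $L(t,x)$ be its local time and define $H_{0,1}=\sup_{s\in[0,1]}H(s)$. Then for all $x\in\mathbb{R}$ there exists $C_3>0$ such that $$\limsup_{\substack{|t-s|\searrow 0^+\\ t,s\in[0,1]}}\frac{|L(t,x)-L(s,x)|}{|t-s|^{1-H_{0,1}}\,(\log(1/|t-s|))^{H_{0,1}}}\le C_3\quad\text{a.s.}$$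
   Context: $W$ is a standard Brownian motion on $(-\infty,+\infty)$. The limsup means $\lim_{\eta\to0^+}\sup\{\cdot : s,t\in[0,1],\,0<|t-s|\le\eta\}$; $C_3$ is deterministic and finite. Local time: for a real-valued separable process $X$ with Borel sample functions and a Borel set $A\subset\mathbb{R}^+$, the occupation measure is $\mu_A(D)=\lambda\{s\in A: X(s)\in D\}$, $D\in\mathcal{B}(\mathbb{R})$, with $\lambda$ Lebesgue measure. If $\mu_A$ is absolutely continuous with respect to Lebesgue measure, its density is the local time $L(A,\cdot)$, taken in a measurable modification satisfying the occupation density formula $\int_A f(X(t))\,dt=\int_{\mathbb{R}}f(x)L(A,x)\,dx$ for all Borel $A$ and measurable $f\ge0$. Write $L(t,x)=L([0,t],x)$. Since the statement concerns fixed levels $x$, it is understood for a suitable such modification of the local time. *)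

theory Defs
  imports "HOL-Probability.Probability"
begin

locale two_sided_brownian_motion = prob_space M for M :: "'w measure" +
  fixes W :: "real \<Rightarrow> 'w \<Rightarrow> real"
  assumes measurable_W [measurable]: "\<And>t. W t \<in> borel_measurable M"
    and W_0: "AE \<omega> in M. W 0 \<omega> = 0"
    and normal_increments: "\<And>s t. s < t \<Longrightarrow>
      distributed M lborel (\<lambda>\<omega>. W t \<omega> - W s \<omega>) (normal_density 0 (sqrt (t - s)))"
    and indep_increments: "\<And>(\<tau> :: nat \<Rightarrow> real) n. strict_mono \<tau> \<Longrightarrow>
      indep_vars (\<lambda>_. borel) (\<lambda>i \<omega>. W (\<tau> (Suc i)) \<omega> - W (\<tau> i) \<omega>) {..<n}"
    and continuous_paths: "AE \<omega> in M. continuous_on UNIV (\<lambda>t. W t \<omega>)"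

text \<open>The list entry \<open>(c, a, b)\<close> with \<open>a \<le> b\<close> stands for \<open>c\<close> times the indicator of \<open>(a, b]\<close>.\<close>

definition step_rep :: "(real \<times> real \<times> real) list \<Rightarrow> bool" where
  "step_rep cs \<longleftrightarrow> (\<forall>(c, a, b) \<in> set cs. a \<le> b)"

definition step_fun :: "(real \<times> real \<times> real) list \<Rightarrow> real \<Rightarrow> real" where
  "step_fun cs u = (\<Sum>(c, a, b)\<leftarrow>cs. c * indicator {a<..b} u)"

definition step_integral ::
    "(real \<Rightarrow> 'w \<Rightarrow> real) \<Rightarrow> (real \<times> real \<times> real) list \<Rightarrow> 'w \<Rightarrow> real" where
  "step_integral W cs \<omega> = (\<Sum>(c, a, b)\<leftarrow>cs. c * (W b \<omega> - W a \<omega>))"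

text \<open>The Wiener integral is the \<open>L\<^sup>2\<close> extension of the integral of step functions. It is only
  determined up to almost sure equality, hence a relation. Existence of the approximating sequence
  forces \<open>f\<close> to be square integrable.\<close>

definition has_wiener_integral ::
    "'w measure \<Rightarrow> (real \<Rightarrow> 'w \<Rightarrow> real) \<Rightarrow> (real \<Rightarrow> real) \<Rightarrow> ('w \<Rightarrow> real) \<Rightarrow> bool" where
  "has_wiener_integral M W f Y \<longleftrightarrow>
     f \<in> borel_measurable borel \<and> Y \<in> borel_measurable M \<and>
     (\<exists>\<phi> :: nat \<Rightarrow> (real \<times> real \<times> real) list.
        (\<forall>n. step_rep (\<phi> n)) \<and>
        (\<lambda>n. \<integral>\<^sup>+u. ennreal ((step_fun (\<phi> n) u - f u)\<^sup>2) \<partial>lborel) \<longlonglongrightarrow> 0 \<and>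
        (\<lambda>n. \<integral>\<^sup>+\<omega>. ennreal ((step_integral W (\<phi> n) \<omega> - Y \<omega>)\<^sup>2) \<partial>M) \<longlonglongrightarrow> 0)"

definition has_wiener_integral_on ::
    "'w measure \<Rightarrow> (real \<Rightarrow> 'w \<Rightarrow> real) \<Rightarrow> real set \<Rightarrow> (real \<Rightarrow> real) \<Rightarrow> ('w \<Rightarrow> real) \<Rightarrow> bool" where
  "has_wiener_integral_on M W S f Y \<longleftrightarrow> has_wiener_integral M W (\<lambda>u. indicator S u * f u) Y"

text \<open>The moving average representation fixes each \<open>X t\<close> only almost surely. Joint measurability
  is what makes the sample functions Borel and the occupation measures random. Separability of the
  version is not imposed.\<close>

definition multifractional_brownian_motion ::
    "'w measure \<Rightarrow> (real \<Rightarrow> 'w \<Rightarrow> real) \<Rightarrow> (real \<Rightarrow> real) \<Rightarrow> (real \<Rightarrow> 'w \<Rightarrow> real) \<Rightarrow> bool" where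
  "multifractional_brownian_motion M W H X \<longleftrightarrow>
     (\<lambda>(t, \<omega>). X t \<omega>) \<in> borel_measurable (restrict_space borel {0..1} \<Otimes>\<^sub>M M) \<and>
     (\<forall>t\<in>{0..1}. \<exists>Y Z.
        has_wiener_integral_on M W {..<0}
          (\<lambda>u. (t - u) powr (H t - 1 / 2) - (- u) powr (H t - 1 / 2)) Y \<and>
        has_wiener_integral_on M W {0..<t} (\<lambda>u. (t - u) powr (H t - 1 / 2)) Z \<and>
        (AE \<omega> in M. X t \<omega> = 1 / Gamma (H t + 1 / 2) * (Y \<omega> + Z \<omega>)))"

definition occupation_measure :: "(real \<Rightarrow> real) \<Rightarrow> real set \<Rightarrow> real measure" where
  "occupation_measure x A = distr (restrict_space lborel A) borel x"

text \<open>\<open>L A x \<omega>\<close> is the local time at level \<open>x\<close> over the Borel set \<open>A\<close> of times in \<open>[0, 1]\<close>. The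
  exceptional null set depends neither on \<open>A\<close> nor on the test function.\<close>

definition local_time ::
    "'w measure \<Rightarrow> (real \<Rightarrow> 'w \<Rightarrow> real) \<Rightarrow> (real set \<Rightarrow> real \<Rightarrow> 'w \<Rightarrow> real) \<Rightarrow> bool" where
  "local_time M X L \<longleftrightarrow>
     (\<forall>A\<in>sets borel. A \<subseteq> {0..1} \<longrightarrow>
        (\<lambda>(x, \<omega>). L A x \<omega>) \<in> borel_measurable (borel \<Otimes>\<^sub>M M) \<and> (\<forall>x \<omega>. 0 \<le> L A x \<omega>)) \<and>
     (AE \<omega> in M. \<forall>A\<in>sets borel. A \<subseteq> {0..1} \<longrightarrow>
        absolutely_continuous lborel (occupation_measure (\<lambda>t. X t \<omega>) A) \<and>
        occupation_measure (\<lambda>t. X t \<omega>) A = density lborel (\<lambda>x. ennreal (L A x \<omega>)) \<and>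
        (\<forall>f :: real \<Rightarrow> ennreal. f \<in> borel_measurable borel \<longrightarrow>
           (\<integral>\<^sup>+t\<in>A. f (X t \<omega>) \<partial>lborel) = (\<integral>\<^sup>+x. f x * ennreal (L A x \<omega>) \<partial>lborel)))"

definition increment_limsup :: "(real \<Rightarrow> real \<Rightarrow> real) \<Rightarrow> ereal" where
  "increment_limsup q =
     Lim (at_right (0::real))
       (\<lambda>\<eta>. SUP (s, t) \<in> {(s, t). s \<in> {0..1} \<and> t \<in> {0..1} \<and> 0 < \<bar>t - s\<bar> \<and> \<bar>t - s\<bar> \<le> \<eta>}.
              ereal (q s t))"

end

theory Submission
  imports Defs
begin

text \<open>
  The argument rests on local nondeterminism. Given the Brownian path up to time \<open>s\<close>, the process at time
  \<open>t > s\<close> still contains the independent Gaussian integral of the kernel over \<open>(s, t]\<close>, whose standard deviation is at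
  least a constant times \<open>(t - s) powr H01\<close>, whatever the values of \<open>H\<close> at other times. Conditioning successively from the latest time
  backwards, the probability that the process is in an interval of length \<open>r\<close> at times \<open>t 1 < \<dots> < t m\<close>, all
  after \<open>t 0\<close>, is at most the product of the factors \<open>C * r * (t (i + 1) - t i) powr (- H01)\<close>
  (\<open>mbm_small_ball\<close>). The conditioning is carried out for integrals of step functions, where it only
  involves finitely many independent increments, and survives the passage to the \<open>L\<^sup>2\<close> limit
  (\<open>step_integrals_small_ball\<close>, \<open>wiener_integrals_small_ball\<close>).

  Integrated over ordered times, these products bound the \<open>m\<close>-th moment of the normalised time spent in a small
  window of levels during a time interval of length \<open>d\<close> by the \<open>m\<close>-th power of \<open>K * m powr H01 * d powr (1 - H01)\<close>,
  uniformly in the window (\<open>moment_le_of_powr_chain\<close>). The case \<open>m = 2\<close> makes the occupation measure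
  absolutely continuous (\<open>absolutely_continuous_occ\<close>). The local time at a fixed level is then defined as the
  limit of the normalised occupation times of shrinking windows, on the event that these limits exist for all
  dyadic time intervals, and as zero elsewhere; Lebesgue's differentiation theorem identifies it with the
  density of the occupation measure (\<open>local_time_level_local_time\<close>), and Fatou's lemma transfers the moment
  bounds to it at every level.

  For dyadic time intervals of length \<open>1 / 2 ^ p\<close>, the bound for the moment of order \<open>p\<close>, Markov's inequality
  and the Borel-Cantelli lemma show that almost surely, for all large \<open>p\<close>, the local time over each of them is at
  most a constant times \<open>p powr H01 * (1 / 2 ^ p) powr (1 - H01)\<close>. An arbitrary short interval is covered by two
  dyadic intervals of comparable length (\<open>level_local_time_modulus\<close>).
\<close>

section \<open>Small ball probabilities for Wiener integrals\<close>

text \<open>Conditionally on \<open>V\<close>, the sum is a Gaussian variable centred at \<open>g V\<close>, and a Gaussian density with standard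
  deviation at least \<open>\<kappa>\<close> is at most \<open>1 / \<kappa>\<close> whatever its centre. The second variable is written as a function \<open>h\<close> of
  some \<open>U\<close> because \<^const>\<open>prob_space.indep_var\<close> relates two variables with values in the same type.\<close>

lemma (in prob_space) emeasure_shifted_normal_le:
  assumes indep: "indep_var N V N' U" and h [measurable]: "h \<in> borel_measurable N'"
    and normal: "distributed M lborel (\<lambda>\<omega>. h (U \<omega>)) (normal_density 0 \<sigma>)"
    and \<kappa>: "0 < \<kappa>" "\<kappa> \<le> \<sigma>" and D [measurable]: "D \<in> sets N"
    and g [measurable]: "g \<in> borel_measurable N" and ab: "a \<le> b"
  shows "emeasure M {\<omega> \<in> space M. V \<omega> \<in> D \<and> g (V \<omega>) + h (U \<omega>) \<in> {a<..<b}}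
    \<le> emeasure M {\<omega> \<in> space M. V \<omega> \<in> D} * ennreal ((b - a) / \<kappa>)"
proof -
  have [measurable]: "V \<in> measurable M N" "U \<in> measurable M N'"
    using indep indep_var_rv1 indep_var_rv2 by auto
  have eq: "distr M N V \<Otimes>\<^sub>M distr M N' U = distr M (N \<Otimes>\<^sub>M N') (\<lambda>x. (V x, U x))"
    using indep by (simp add: indep_var_distribution_eq)
  interpret V: prob_space "distr M N V" by (rule prob_space_distr) measurable
  interpret U: prob_space "distr M N' U" by (rule prob_space_distr) measurable
  interpret P: pair_sigma_finite "distr M N V" "distr M N' U" by standard
  have interval: "emeasure (distr M borel (\<lambda>\<omega>. h (U \<omega>))) {l<..<r} \<le> ennreal ((r - l) / \<kappa>)" if "l \<le> r" for l r
  proof -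
    have nd: "normal_density 0 \<sigma> x \<le> 1 / \<kappa>" for x
    proof -
      have "\<sigma> > 0" using \<kappa> by simp
      have "sqrt (2 * pi * \<sigma>\<^sup>2) \<ge> sqrt (\<sigma>\<^sup>2)"
      proof (rule real_sqrt_le_mono)
        have "1 * \<sigma>\<^sup>2 \<le> (2 * pi) * \<sigma>\<^sup>2" using pi_ge_two by (intro mult_right_mono) auto
        then show "\<sigma>\<^sup>2 \<le> 2 * pi * \<sigma>\<^sup>2" by simp
      qed
      then have "\<kappa> \<le> sqrt (2 * pi * \<sigma>\<^sup>2)" using \<kappa> by simp
      then have "normal_density 0 \<sigma> x \<le> 1 / sqrt (2 * pi * \<sigma>\<^sup>2) * 1"
        unfolding normal_density_def by (intro mult_left_mono) auto
      also have "\<dots> \<le> 1 / \<kappa>" using \<open>\<kappa> \<le> sqrt (2 * pi * \<sigma>\<^sup>2)\<close> \<kappa> by (simp add: frac_le)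
      finally show ?thesis .
    qed
    have "emeasure (distr M borel (\<lambda>\<omega>. h (U \<omega>))) {l<..<r} = emeasure (distr M lborel (\<lambda>\<omega>. h (U \<omega>))) {l<..<r}"
      by (simp cong: distr_cong)
    also have "\<dots> = (\<integral>\<^sup>+x. ennreal (normal_density 0 \<sigma> x) * indicator {l<..<r} x \<partial>lborel)"
      using normal by (simp add: distributed_def emeasure_density)
    also have "\<dots> \<le> (\<integral>\<^sup>+x. ennreal (1 / \<kappa>) * indicator {l<..<r} x \<partial>lborel)"
      by (intro nn_integral_mono mult_right_mono ennreal_leI nd) auto
    also have "\<dots> = ennreal ((r - l) / \<kappa>)"
      using that \<kappa> by (simp add: nn_integral_cmult ennreal_mult'[symmetric])
    finally show ?thesis .
  qed
  define F where "F = (\<lambda>(v, y). indicator D v * indicator {a<..<b} (g v + h y) :: ennreal)"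
  have F [measurable]: "F \<in> borel_measurable (N \<Otimes>\<^sub>M N')"
    unfolding F_def by measurable
  have "emeasure M {\<omega> \<in> space M. V \<omega> \<in> D \<and> g (V \<omega>) + h (U \<omega>) \<in> {a<..<b}}
      = (\<integral>\<^sup>+\<omega>. indicator {\<omega> \<in> space M. V \<omega> \<in> D \<and> g (V \<omega>) + h (U \<omega>) \<in> {a<..<b}} \<omega> \<partial>M)"
    by (subst nn_integral_indicator) measurable
  also have "\<dots> = (\<integral>\<^sup>+\<omega>. F (V \<omega>, U \<omega>) \<partial>M)"
    by (auto intro!: nn_integral_cong simp: F_def indicator_def)
  also have "\<dots> = (\<integral>\<^sup>+z. F z \<partial>(distr M N V \<Otimes>\<^sub>M distr M N' U))"
    unfolding eq by (subst nn_integral_distr) auto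
  also have "\<dots> = (\<integral>\<^sup>+v. (\<integral>\<^sup>+y. F (v, y) \<partial>distr M N' U) \<partial>distr M N V)"
    by (subst U.nn_integral_fst[symmetric]) (auto cong: measurable_cong_sets)
  also have "\<dots> \<le> (\<integral>\<^sup>+v. indicator D v * ennreal ((b - a) / \<kappa>) \<partial>distr M N V)"
  proof (rule nn_integral_mono)
    fix v
    have "(\<integral>\<^sup>+y. F (v, y) \<partial>distr M N' U)
        = indicator D v * (\<integral>\<^sup>+y. indicator {a - g v<..<b - g v} (h y) \<partial>distr M N' U)"
      unfolding F_def by (subst nn_integral_cmult[symmetric]) (auto intro!: nn_integral_cong simp: indicator_def)
    also have "(\<integral>\<^sup>+y. indicator {a - g v<..<b - g v} (h y) \<partial>distr M N' U)
        = (\<integral>\<^sup>+y. indicator {a - g v<..<b - g v} y \<partial>distr M borel (\<lambda>\<omega>. h (U \<omega>)))"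
      by (simp add: nn_integral_distr del: nn_integral_indicator)
    also have "indicator D v * \<dots> \<le> indicator D v * ennreal ((b - a) / \<kappa>)"
      using interval[of "a - g v" "b - g v"] ab by (intro mult_left_mono) (auto simp: less_imp_le)
    finally show "(\<integral>\<^sup>+y. F (v, y) \<partial>distr M N' U) \<le> indicator D v * ennreal ((b - a) / \<kappa>)" .
  qed
  also have "\<dots> = (\<integral>\<^sup>+v. indicator D v \<partial>distr M N V) * ennreal ((b - a) / \<kappa>)"
    by (rule nn_integral_multc) auto
  also have "(\<integral>\<^sup>+v. indicator D v \<partial>distr M N V) = emeasure M {\<omega> \<in> space M. V \<omega> \<in> D}"
    by (simp add: emeasure_distr vimage_def Int_def conj_commute)
  finally show ?thesis .
qed

text \<open>Brownian increments are independent along an infinite increasing sequence of times; this extends a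
  finite set of times to such a sequence.\<close>

lemma finite_set_strict_mono_enum:
  fixes S :: "real set"
  assumes "finite S"
  obtains \<tau> :: "nat \<Rightarrow> real" and n where "strict_mono \<tau>" "S = \<tau> ` {..<n}"
proof -
  have "\<exists>(\<tau> :: nat \<Rightarrow> real) n. strict_mono \<tau> \<and> S = \<tau> ` {..<n}"
    using assms
  proof (induction rule: finite_linorder_max_induct)
    case empty
    have "strict_mono real" by (simp add: strict_mono_def)
    then show ?case by (intro exI[of _ real] exI[of _ 0]) simp
  next
    case (insert x S)
    then obtain \<tau> :: "nat \<Rightarrow> real" and n where \<tau>: "strict_mono \<tau>" "S = \<tau> ` {..<n}" by blast
    define \<tau>' where "\<tau>' i = (if i < n then \<tau> i else x + real (i - n))" for i
    have "strict_mono \<tau>'"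
      unfolding strict_mono_Suc_iff
    proof
      fix i
      consider "Suc i < n" | "Suc i = n" | "i \<ge> n" by linarith
      then show "\<tau>' i < \<tau>' (Suc i)"
        using insert \<tau> by cases (auto simp: \<tau>'_def strict_mono_Suc_iff)
    qed
    moreover have "insert x S = \<tau>' ` {..<Suc n}"
      unfolding lessThan_Suc image_insert using \<tau>(2) by (auto simp: \<tau>'_def)
    ultimately show ?case by blast
  qed
  then show ?thesis using that by blast
qed

definition step_points :: "(real \<times> real \<times> real) list \<Rightarrow> real set" where
  "step_points cs = (\<Union>(c, a, b)\<in>set cs. {a, b})"

lemma finite_step_points [simp]: "finite (step_points cs)"
  by (auto simp: step_points_def)

lemma step_points_Cons [simp]: "step_points ((c, a, b) # cs) = {a, b} \<union> step_points cs"
  by (auto simp: step_points_def)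

lemma step_rep_Cons [simp]: "step_rep ((c, a, b) # cs) \<longleftrightarrow> a \<le> b \<and> step_rep cs"
  by (auto simp: step_rep_def)

lemma step_fun_Nil [simp]: "step_fun [] u = 0"
  and step_fun_Cons [simp]: "step_fun ((c, a, b) # cs) u = c * indicator {a<..b} u + step_fun cs u"
  by (simp_all add: step_fun_def)

lemma step_integral_Nil [simp]: "step_integral W [] \<omega> = 0"
  and step_integral_Cons [simp]:
    "step_integral W ((c, a, b) # cs) \<omega> = c * (W b \<omega> - W a \<omega>) + step_integral W cs \<omega>"
  by (simp_all add: step_integral_def)

lemma borel_measurable_step_fun [measurable]: "step_fun cs \<in> borel_measurable borel"
proof (induction cs)
  case Nil
  show ?case by (simp add: step_fun_Nil[abs_def])
next
  case (Cons x cs)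
  obtain c a b where x: "x = (c, a, b)" by (cases x)
  note Cons[measurable]
  show ?case unfolding x step_fun_Cons[abs_def] by measurable
qed

lemma step_fun_grid_constant:
  assumes \<tau>: "strict_mono \<tau>" and pts: "step_points cs \<subseteq> \<tau> ` {..<n}" and u: "\<tau> i < u" "u \<le> \<tau> (Suc i)"
  shows "step_fun cs u = step_fun cs (\<tau> (Suc i))"
  using pts
proof (induction cs)
  case (Cons x cs)
  obtain c a b where x: "x = (c, a, b)" by (cases x)
  from Cons(2) obtain p q where pq: "a = \<tau> p" "b = \<tau> q" by (auto simp: x)
  have "\<tau> r < u \<longleftrightarrow> \<tau> r < \<tau> (Suc i)" for r
  proof -
    have "\<tau> r < \<tau> (Suc i) \<Longrightarrow> \<tau> r \<le> \<tau> i"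
      using \<tau> by (simp add: strict_mono_less strict_mono_less_eq)
    then show ?thesis using u by linarith
  qed
  then have "indicator {a<..b} u = (indicator {a<..b} (\<tau> (Suc i)) :: real)"
    by (metis (full_types) pq greaterThanAtMost_iff indicator_simps not_le \<tau> strict_mono_less
        strict_mono_less_eq u(1) u(2) less_Suc_eq_le order.strict_trans2 order.trans)
  with Cons show ?case by (simp add: x)
qed simp

text \<open>Increments over long intervals telescope into grid increments, which is what brings the joint independence of
  finitely many Brownian increments to bear on several step integrals at once.\<close>

lemma step_integral_grid:
  assumes \<tau>: "strict_mono \<tau>" and pts: "step_points cs \<subseteq> \<tau> ` {..<n}" and rep: "step_rep cs"
  shows "step_integral W cs \<omega> = (\<Sum>i<n. step_fun cs (\<tau> (Suc i)) * (W (\<tau> (Suc i)) \<omega> - W (\<tau> i) \<omega>))"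
  using pts rep
proof (induction cs)
  case (Cons x cs)
  obtain c a b where x: "x = (c, a, b)" by (cases x)
  from Cons.prems obtain p q where pq: "a = \<tau> p" "b = \<tau> q" "p < n" "q < n" by (auto simp: x)
  have "p \<le> q" using Cons.prems \<tau> by (auto simp: x pq strict_mono_less_eq)
  have "c * (W b \<omega> - W a \<omega>) = c * (\<Sum>i\<in>{p..<q}. W (\<tau> (Suc i)) \<omega> - W (\<tau> i) \<omega>)"
    using sum_Suc_diff'[OF \<open>p \<le> q\<close>, of "\<lambda>i. W (\<tau> i) \<omega>"] by (simp add: pq)
  also have "\<dots> = (\<Sum>i<n. c * indicator {a<..b} (\<tau> (Suc i)) * (W (\<tau> (Suc i)) \<omega> - W (\<tau> i) \<omega>))"
    unfolding sum_distrib_left using \<tau> pq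
    by (intro sum.mono_neutral_cong_left) (auto simp: indicator_def strict_mono_less strict_mono_less_eq)
  finally show ?case using Cons by (simp add: x distrib_right sum.distrib)
qed simp

lemma nn_integral_step_fun_grid:
  assumes \<tau>: "strict_mono \<tau>" and pts: "step_points cs \<subseteq> \<tau> ` {..<n}" and pq: "p \<le> q"
  shows "(\<integral>\<^sup>+u\<in>{\<tau> p<..\<tau> q}. ennreal ((step_fun cs u)\<^sup>2) \<partial>lborel)
    = ennreal (\<Sum>i\<in>{p..<q}. (step_fun cs (\<tau> (Suc i)))\<^sup>2 * (\<tau> (Suc i) - \<tau> i))"
  using pq
proof (induction rule: dec_induct)
  case base
  show ?case by simp
next
  case (step q)
  have le: "\<tau> p \<le> \<tau> q" "\<tau> q \<le> \<tau> (Suc q)"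
    using \<tau> step by (auto simp: strict_mono_less_eq)
  have "(\<integral>\<^sup>+u\<in>{\<tau> p<..\<tau> (Suc q)}. ennreal ((step_fun cs u)\<^sup>2) \<partial>lborel)
     = (\<integral>\<^sup>+u. ennreal ((step_fun cs u)\<^sup>2) * indicator {\<tau> p<..\<tau> q} u
          + ennreal ((step_fun cs (\<tau> (Suc q)))\<^sup>2) * indicator {\<tau> q<..\<tau> (Suc q)} u \<partial>lborel)"
    using le step_fun_grid_constant[OF \<tau> pts]
    by (intro nn_integral_cong) (auto simp: indicator_def)
  also have "\<dots> = (\<integral>\<^sup>+u\<in>{\<tau> p<..\<tau> q}. ennreal ((step_fun cs u)\<^sup>2) \<partial>lborel)
      + ennreal ((step_fun cs (\<tau> (Suc q)))\<^sup>2) * emeasure lborel {\<tau> q<..\<tau> (Suc q)}"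
    by (subst nn_integral_add) (auto simp: nn_integral_cmult)
  also have "\<dots> = ennreal (\<Sum>i\<in>{p..<q}. (step_fun cs (\<tau> (Suc i)))\<^sup>2 * (\<tau> (Suc i) - \<tau> i))
      + ennreal ((step_fun cs (\<tau> (Suc q)))\<^sup>2 * (\<tau> (Suc q) - \<tau> q))"
    using step le by (simp add: ennreal_mult)
  also have "\<dots> = ennreal ((\<Sum>i\<in>{p..<q}. (step_fun cs (\<tau> (Suc i)))\<^sup>2 * (\<tau> (Suc i) - \<tau> i))
      + (step_fun cs (\<tau> (Suc q)))\<^sup>2 * (\<tau> (Suc q) - \<tau> q))"
    using \<tau> by (intro ennreal_plus[symmetric] sum_nonneg mult_nonneg_nonneg)
      (auto simp: strict_mono_less_eq)
  finally show ?case using step by simp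
qed

context two_sided_brownian_motion
begin

lemma measurable_step_integral [measurable]: "step_integral W cs \<in> borel_measurable M"
proof (induction cs)
  case Nil
  show ?case by (simp add: step_integral_Nil[abs_def])
next
  case (Cons x cs)
  obtain c a b where x: "x = (c, a, b)" by (cases x)
  note Cons[measurable]
  show ?case unfolding x step_integral_Cons[abs_def] by measurable
qed

text \<open>Only the cells with nonzero coefficient are summed as independent Gaussians, since a normal density of
  variance \<open>0\<close> does not exist.\<close>

lemma grid_sum_normal:
  assumes \<tau>: "strict_mono \<tau>"
    and v: "v = (\<Sum>i\<in>{p..<q}. (c i)\<^sup>2 * (\<tau> (Suc i) - \<tau> i))" "v > 0"
  shows "distributed M lborel (\<lambda>\<omega>. \<Sum>i\<in>{p..<q}. c i * (W (\<tau> (Suc i)) \<omega> - W (\<tau> i) \<omega>))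
    (normal_density 0 (sqrt v))"
proof -
  let ?L = "{i\<in>{p..<q}. c i \<noteq> 0}"
  let ?\<sigma> = "\<lambda>i. \<bar>c i\<bar> * sqrt (\<tau> (Suc i) - \<tau> i)"
  have pos: "\<tau> (Suc i) - \<tau> i > 0" for i using \<tau> by (simp add: strict_mono_less)
  have vL: "v = (\<Sum>i\<in>?L. (?\<sigma> i)\<^sup>2)"
    unfolding v(1) using pos
    by (intro sum.mono_neutral_cong_right) (auto simp: power_mult_distrib less_imp_le)
  have "distributed M lborel (\<lambda>\<omega>. \<Sum>i\<in>?L. c i * (W (\<tau> (Suc i)) \<omega> - W (\<tau> i) \<omega>))
    (normal_density (\<Sum>i\<in>?L. 0) (sqrt (\<Sum>i\<in>?L. (?\<sigma> i)\<^sup>2)))"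
  proof (rule sum_indep_normal)
    show "?L \<noteq> {}" using v(2) vL by (metis (no_types, lifting) less_irrefl sum.empty)
    have "indep_vars (\<lambda>_. borel) (\<lambda>i \<omega>. W (\<tau> (Suc i)) \<omega> - W (\<tau> i) \<omega>) ?L"
      by (rule indep_vars_subset[OF indep_increments[OF \<tau>, of q]]) auto
    then show "indep_vars (\<lambda>_. borel) (\<lambda>i \<omega>. c i * (W (\<tau> (Suc i)) \<omega> - W (\<tau> i) \<omega>)) ?L"
      by (rule indep_vars_compose2) auto
    fix i assume i: "i \<in> ?L"
    show "0 < ?\<sigma> i" using i pos by simp
    have "distributed M lborel (\<lambda>\<omega>. 0 + c i * (W (\<tau> (Suc i)) \<omega> - W (\<tau> i) \<omega>))
       (normal_density (0 + c i * 0) (?\<sigma> i))"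
      using i pos[of i] by (intro normal_density_affine normal_increments) auto
    then show "distributed M lborel (\<lambda>\<omega>. c i * (W (\<tau> (Suc i)) \<omega> - W (\<tau> i) \<omega>)) (normal_density 0 (?\<sigma> i))"
      by simp
  qed simp
  also have "(\<lambda>\<omega>. \<Sum>i\<in>?L. c i * (W (\<tau> (Suc i)) \<omega> - W (\<tau> i) \<omega>))
     = (\<lambda>\<omega>. \<Sum>i\<in>{p..<q}. c i * (W (\<tau> (Suc i)) \<omega> - W (\<tau> i) \<omega>))"
    by (intro ext sum.mono_neutral_cong_left) auto
  finally show ?thesis by (simp add: vL)
qed

lemma step_integral_isometry:
  assumes rep: "step_rep cs"
  shows "(\<integral>\<^sup>+\<omega>. ennreal ((step_integral W cs \<omega>)\<^sup>2) \<partial>M) = (\<integral>\<^sup>+u. ennreal ((step_fun cs u)\<^sup>2) \<partial>lborel)"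
proof -
  obtain \<tau> :: "nat \<Rightarrow> real" and n where \<tau>: "strict_mono \<tau>" and pts: "step_points cs = \<tau> ` {..<n}"
    using finite_set_strict_mono_enum[OF finite_step_points] by metis
  have pts': "step_points cs \<subseteq> \<tau> ` {..<n}" using pts by simp
  let ?v = "\<Sum>i\<in>{0..<n}. (step_fun cs (\<tau> (Suc i)))\<^sup>2 * (\<tau> (Suc i) - \<tau> i)"
  have nonneg: "(step_fun cs (\<tau> (Suc i)))\<^sup>2 * (\<tau> (Suc i) - \<tau> i) \<ge> 0" for i
    using \<tau> by (simp add: strict_mono_less_eq)
  have "(\<integral>\<^sup>+u. ennreal ((step_fun cs u)\<^sup>2) \<partial>lborel)
    = (\<integral>\<^sup>+u\<in>{\<tau> 0<..\<tau> n}. ennreal ((step_fun cs u)\<^sup>2) \<partial>lborel)"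
  proof (rule nn_integral_cong)
    fix u
    have "step_fun cs u = 0" if "u \<notin> {\<tau> 0<..\<tau> n}"
      using pts'
    proof (induction cs)
      case (Cons x cs)
      obtain c a b where x: "x = (c, a, b)" by (cases x)
      from Cons.prems obtain p q where pq: "a = \<tau> p" "b = \<tau> q" "p < n" "q < n" by (auto simp: x)
      have "\<tau> 0 \<le> \<tau> p" "\<tau> q \<le> \<tau> n" using \<tau> pq by (auto simp: strict_mono_less_eq)
      then show ?case using that Cons by (auto simp: x pq indicator_def)
    qed simp
    then show "ennreal ((step_fun cs u)\<^sup>2) = ennreal ((step_fun cs u)\<^sup>2) * indicator {\<tau> 0<..\<tau> n} u"
      by (auto simp: indicator_def)
  qed
  also have "\<dots> = ennreal ?v"
    by (rule nn_integral_step_fun_grid[OF \<tau> pts']) simp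
  finally have rhs: "(\<integral>\<^sup>+u. ennreal ((step_fun cs u)\<^sup>2) \<partial>lborel) = ennreal ?v" .
  have grid: "step_integral W cs = (\<lambda>\<omega>. \<Sum>i\<in>{0..<n}. step_fun cs (\<tau> (Suc i)) * (W (\<tau> (Suc i)) \<omega> - W (\<tau> i) \<omega>))"
    by (intro ext) (simp add: step_integral_grid[OF \<tau> pts' rep] atLeast0LessThan)
  have "(\<integral>\<^sup>+\<omega>. ennreal ((step_integral W cs \<omega>)\<^sup>2) \<partial>M) = ennreal ?v"
  proof (cases "?v = 0")
    case True
    then have "\<forall>i\<in>{0..<n}. (step_fun cs (\<tau> (Suc i)))\<^sup>2 * (\<tau> (Suc i) - \<tau> i) = 0"
      by (subst (asm) sum_nonneg_eq_0_iff) (auto simp: nonneg)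
    moreover have "\<tau> (Suc i) - \<tau> i \<noteq> 0" for i using \<tau> strict_mono_less[OF \<tau>, of i "Suc i"] by simp
    ultimately have "step_fun cs (\<tau> (Suc i)) = 0" if "i < n" for i using that by auto
    then have "step_integral W cs \<omega> = 0" for \<omega> by (simp add: grid)
    then show ?thesis using True by simp
  next
    case False
    moreover have "?v \<ge> 0" by (intro sum_nonneg nonneg)
    ultimately have "?v > 0" by simp
    have dist: "distributed M lborel (step_integral W cs) (normal_density 0 (sqrt ?v))"
      unfolding grid by (rule grid_sum_normal[OF \<tau> refl \<open>?v > 0\<close>])
    have "(\<integral>\<^sup>+\<omega>. ennreal ((step_integral W cs \<omega>)\<^sup>2) \<partial>M)
       = (\<integral>\<^sup>+x. ennreal (normal_density 0 (sqrt ?v) x) * ennreal (x\<^sup>2) \<partial>lborel)"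
      by (rule distributed_nn_integral[OF dist, symmetric]) auto
    also have "\<dots> = (\<integral>\<^sup>+x. ennreal (normal_density 0 (sqrt ?v) x * (x - 0) ^ (2 * 1)) \<partial>lborel)"
      by (auto intro!: nn_integral_cong simp: ennreal_mult'[symmetric])
    also have "\<dots> = ennreal ?v"
    proof -
      have "has_bochner_integral lborel (\<lambda>x. normal_density 0 (sqrt ?v) x * (x - 0) ^ (2 * 1))
         (fact (2 * 1) / ((2 / (sqrt ?v)\<^sup>2) ^ 1 * fact 1))"
        using \<open>?v > 0\<close> by (intro normal_moment_even) simp
      then have "has_bochner_integral lborel (\<lambda>x. normal_density 0 (sqrt ?v) x * (x - 0) ^ (2 * 1)) ?v"
        using \<open>?v > 0\<close> by simp
      then show ?thesis
        by (subst nn_integral_eq_integral) (auto simp: has_bochner_integral_iff)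
    qed
    finally show ?thesis .
  qed
  then show ?thesis using rhs by simp
qed

end

lemma ennreal_square_add_le:
  fixes x y :: real
  shows "ennreal ((x + y)\<^sup>2) \<le> 2 * ennreal (x\<^sup>2) + 2 * ennreal (y\<^sup>2)"
proof -
  have "0 \<le> (x - y)\<^sup>2" by simp
  then have "(x + y)\<^sup>2 \<le> 2 * x\<^sup>2 + 2 * y\<^sup>2" by (simp add: power2_eq_square algebra_simps)
  then have "ennreal ((x + y)\<^sup>2) \<le> ennreal (2 * x\<^sup>2 + 2 * y\<^sup>2)" by (rule ennreal_leI)
  then show ?thesis by (simp add: ennreal_mult)
qed

lemma nn_integral_square_add_le:
  fixes f g :: "'a \<Rightarrow> real"
  assumes [measurable]: "f \<in> borel_measurable M" "g \<in> borel_measurable M"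
  shows "(\<integral>\<^sup>+x. ennreal ((f x + g x)\<^sup>2) \<partial>M)
    \<le> 2 * (\<integral>\<^sup>+x. ennreal ((f x)\<^sup>2) \<partial>M) + 2 * (\<integral>\<^sup>+x. ennreal ((g x)\<^sup>2) \<partial>M)"
proof -
  have "(\<integral>\<^sup>+x. ennreal ((f x + g x)\<^sup>2) \<partial>M) \<le> (\<integral>\<^sup>+x. 2 * ennreal ((f x)\<^sup>2) + 2 * ennreal ((g x)\<^sup>2) \<partial>M)"
    by (intro nn_integral_mono ennreal_square_add_le)
  also have "\<dots> = 2 * (\<integral>\<^sup>+x. ennreal ((f x)\<^sup>2) \<partial>M) + 2 * (\<integral>\<^sup>+x. ennreal ((g x)\<^sup>2) \<partial>M)"
    by (subst nn_integral_add) (auto simp: nn_integral_cmult)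
  finally show ?thesis .
qed

lemma tendsto_zero_two_mult_add:
  fixes u v :: "nat \<Rightarrow> ennreal"
  assumes "u \<longlonglongrightarrow> 0" "v \<longlonglongrightarrow> 0" "\<And>n. w n \<le> 2 * u n + 2 * v n"
  shows "w \<longlonglongrightarrow> 0"
proof (rule tendsto_sandwich[of "\<lambda>_. 0" w _ "\<lambda>n. 2 * u n + 2 * v n"])
  have "(\<lambda>n. 2 * u n + 2 * v n) \<longlonglongrightarrow> 2 * 0 + 2 * 0"
    by (intro tendsto_add ennreal_tendsto_cmult assms) auto
  then show "(\<lambda>n. 2 * u n + 2 * v n) \<longlonglongrightarrow> 0" by simp
qed (use assms(3) in auto)

lemma step_rep_append [simp]: "step_rep (cs @ ds) \<longleftrightarrow> step_rep cs \<and> step_rep ds"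
  by (simp add: step_rep_def ball_Un)

lemma step_fun_append [simp]: "step_fun (cs @ ds) u = step_fun cs u + step_fun ds u"
  by (simp add: step_fun_def)

lemma step_integral_append [simp]: "step_integral W (cs @ ds) \<omega> = step_integral W cs \<omega> + step_integral W ds \<omega>"
  by (simp add: step_integral_def)

definition step_scale :: "real \<Rightarrow> (real \<times> real \<times> real) list \<Rightarrow> (real \<times> real \<times> real) list" where
  "step_scale k = map (\<lambda>(c, a, b). (k * c, a, b))"

lemma step_rep_scale [simp]: "step_rep (step_scale k cs) \<longleftrightarrow> step_rep cs"
  by (auto simp: step_rep_def step_scale_def split_beta)

lemma step_fun_scale [simp]: "step_fun (step_scale k cs) u = k * step_fun cs u"
  by (induction cs) (auto simp: step_scale_def algebra_simps)

lemma step_integral_scale [simp]: "step_integral W (step_scale k cs) \<omega> = k * step_integral W cs \<omega>"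
  by (induction cs) (auto simp: step_scale_def algebra_simps)

definition step_clip :: "real \<Rightarrow> (real \<times> real \<times> real) list \<Rightarrow> (real \<times> real \<times> real) list" where
  "step_clip t = map (\<lambda>(c, a, b). (c, min a t, min b t))"

lemma step_rep_clip: "step_rep cs \<Longrightarrow> step_rep (step_clip t cs)"
  by (auto simp: step_rep_def step_clip_def min_def split_beta)

lemma step_points_clip: "step_points (step_clip t cs) \<subseteq> {..t}"
  by (auto simp: step_points_def step_clip_def)

lemma step_fun_clip: "step_fun (step_clip t cs) u = step_fun cs u * indicator {..t} u"
  by (induction cs) (auto simp: step_clip_def algebra_simps indicator_def min_def)

text \<open>If the integrand vanishes after time \<open>t\<close>, the approximating steps may be cut off at \<open>t\<close>. The part cut off is
  itself an approximation of zero in \<open>L\<^sup>2\<close>, so by the isometry its integral is negligible. The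
  clipped integrals only involve the Brownian path up to time \<open>t\<close>.\<close>

lemma (in two_sided_brownian_motion) has_wiener_integral_clipped:
  assumes f: "has_wiener_integral M W f Y" and supp: "\<And>u. u > t \<Longrightarrow> f u = 0"
  obtains \<phi> where "\<And>n. step_rep (\<phi> n)" "\<And>n. step_points (\<phi> n) \<subseteq> {..t}"
    "(\<lambda>n. \<integral>\<^sup>+u. ennreal ((step_fun (\<phi> n) u - f u)\<^sup>2) \<partial>lborel) \<longlonglongrightarrow> 0"
    "(\<lambda>n. \<integral>\<^sup>+\<omega>. ennreal ((step_integral W (\<phi> n) \<omega> - Y \<omega>)\<^sup>2) \<partial>M) \<longlonglongrightarrow> 0"
proof -
  have [measurable]: "f \<in> borel_measurable borel" "Y \<in> borel_measurable M"
    using f by (auto simp: has_wiener_integral_def)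
  obtain \<phi> where rep: "\<And>n. step_rep (\<phi> n)"
    and lim1: "(\<lambda>n. \<integral>\<^sup>+u. ennreal ((step_fun (\<phi> n) u - f u)\<^sup>2) \<partial>lborel) \<longlonglongrightarrow> 0"
    and lim2: "(\<lambda>n. \<integral>\<^sup>+\<omega>. ennreal ((step_integral W (\<phi> n) \<omega> - Y \<omega>)\<^sup>2) \<partial>M) \<longlonglongrightarrow> 0"
    using f unfolding has_wiener_integral_def by blast
  let ?c = "\<lambda>n. step_clip t (\<phi> n)"
  have diff: "(\<integral>\<^sup>+\<omega>. ennreal ((step_integral W (?c n) \<omega> - step_integral W (\<phi> n) \<omega>)\<^sup>2) \<partial>M)
      \<le> (\<integral>\<^sup>+u. ennreal ((step_fun (\<phi> n) u - f u)\<^sup>2) \<partial>lborel)" for n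
  proof -
    have "(\<integral>\<^sup>+\<omega>. ennreal ((step_integral W (?c n) \<omega> - step_integral W (\<phi> n) \<omega>)\<^sup>2) \<partial>M)
      = (\<integral>\<^sup>+\<omega>. ennreal ((step_integral W (?c n @ step_scale (-1) (\<phi> n)) \<omega>)\<^sup>2) \<partial>M)" by simp
    also have "\<dots> = (\<integral>\<^sup>+u. ennreal ((step_fun (?c n @ step_scale (-1) (\<phi> n)) u)\<^sup>2) \<partial>lborel)"
      by (rule step_integral_isometry) (simp add: rep step_rep_clip)
    also have "\<dots> \<le> (\<integral>\<^sup>+u. ennreal ((step_fun (\<phi> n) u - f u)\<^sup>2) \<partial>lborel)"
      by (intro nn_integral_mono ennreal_leI) (auto simp: step_fun_clip indicator_def supp)
    finally show ?thesis .
  qed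
  show ?thesis
  proof (rule that[of ?c])
    show "step_rep (?c n)" "step_points (?c n) \<subseteq> {..t}" for n
      using rep by (auto intro!: step_rep_clip step_points_clip)
    show "(\<lambda>n. \<integral>\<^sup>+u. ennreal ((step_fun (?c n) u - f u)\<^sup>2) \<partial>lborel) \<longlonglongrightarrow> 0"
    proof (rule tendsto_sandwich[OF _ _ tendsto_const lim1])
      show "\<forall>\<^sub>F n in sequentially. (\<integral>\<^sup>+u. ennreal ((step_fun (?c n) u - f u)\<^sup>2) \<partial>lborel)
        \<le> (\<integral>\<^sup>+u. ennreal ((step_fun (\<phi> n) u - f u)\<^sup>2) \<partial>lborel)"
        by (intro always_eventually allI nn_integral_mono ennreal_leI)
           (auto simp: step_fun_clip indicator_def supp)
    qed auto
    show "(\<lambda>n. \<integral>\<^sup>+\<omega>. ennreal ((step_integral W (?c n) \<omega> - Y \<omega>)\<^sup>2) \<partial>M) \<longlonglongrightarrow> 0"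
    proof (rule tendsto_zero_two_mult_add[OF lim1 lim2])
      fix n
      have "(\<integral>\<^sup>+\<omega>. ennreal ((step_integral W (?c n) \<omega> - Y \<omega>)\<^sup>2) \<partial>M)
        = (\<integral>\<^sup>+\<omega>. ennreal (((step_integral W (?c n) \<omega> - step_integral W (\<phi> n) \<omega>) + (step_integral W (\<phi> n) \<omega> - Y \<omega>))\<^sup>2) \<partial>M)"
        by simp
      also have "\<dots> \<le> 2 * (\<integral>\<^sup>+\<omega>. ennreal ((step_integral W (?c n) \<omega> - step_integral W (\<phi> n) \<omega>)\<^sup>2) \<partial>M)
         + 2 * (\<integral>\<^sup>+\<omega>. ennreal ((step_integral W (\<phi> n) \<omega> - Y \<omega>)\<^sup>2) \<partial>M)"
        by (rule nn_integral_square_add_le) measurable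
      also have "\<dots> \<le> 2 * (\<integral>\<^sup>+u. ennreal ((step_fun (\<phi> n) u - f u)\<^sup>2) \<partial>lborel)
         + 2 * (\<integral>\<^sup>+\<omega>. ennreal ((step_integral W (\<phi> n) \<omega> - Y \<omega>)\<^sup>2) \<partial>M)"
        by (intro add_right_mono mult_left_mono diff) simp
      finally show "(\<integral>\<^sup>+\<omega>. ennreal ((step_integral W (?c n) \<omega> - Y \<omega>)\<^sup>2) \<partial>M)
        \<le> 2 * (\<integral>\<^sup>+u. ennreal ((step_fun (\<phi> n) u - f u)\<^sup>2) \<partial>lborel)
         + 2 * (\<integral>\<^sup>+\<omega>. ennreal ((step_integral W (\<phi> n) \<omega> - Y \<omega>)\<^sup>2) \<partial>M)" .
    qed
  qed
qed

lemma (in two_sided_brownian_motion) has_wiener_integral_add: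
  assumes f: "has_wiener_integral M W f Y" and g: "has_wiener_integral M W g Z"
  shows "has_wiener_integral M W (\<lambda>u. f u + g u) (\<lambda>\<omega>. Y \<omega> + Z \<omega>)"
proof -
  have [measurable]: "f \<in> borel_measurable borel" "Y \<in> borel_measurable M"
     "g \<in> borel_measurable borel" "Z \<in> borel_measurable M"
    using f g by (auto simp: has_wiener_integral_def)
  obtain \<phi> where \<phi>: "\<And>n. step_rep (\<phi> n)"
    "(\<lambda>n. \<integral>\<^sup>+u. ennreal ((step_fun (\<phi> n) u - f u)\<^sup>2) \<partial>lborel) \<longlonglongrightarrow> 0"
    "(\<lambda>n. \<integral>\<^sup>+\<omega>. ennreal ((step_integral W (\<phi> n) \<omega> - Y \<omega>)\<^sup>2) \<partial>M) \<longlonglongrightarrow> 0"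
    using f unfolding has_wiener_integral_def by blast
  obtain \<psi> where \<psi>: "\<And>n. step_rep (\<psi> n)"
    "(\<lambda>n. \<integral>\<^sup>+u. ennreal ((step_fun (\<psi> n) u - g u)\<^sup>2) \<partial>lborel) \<longlonglongrightarrow> 0"
    "(\<lambda>n. \<integral>\<^sup>+\<omega>. ennreal ((step_integral W (\<psi> n) \<omega> - Z \<omega>)\<^sup>2) \<partial>M) \<longlonglongrightarrow> 0"
    using g unfolding has_wiener_integral_def by blast
  have "(\<lambda>n. \<integral>\<^sup>+u. ennreal ((step_fun (\<phi> n @ \<psi> n) u - (f u + g u))\<^sup>2) \<partial>lborel) \<longlonglongrightarrow> 0"
  proof (rule tendsto_zero_two_mult_add[OF \<phi>(2) \<psi>(2)])
    fix n
    have "(\<lambda>u. step_fun (\<phi> n @ \<psi> n) u - (f u + g u)) = (\<lambda>u. (step_fun (\<phi> n) u - f u) + (step_fun (\<psi> n) u - g u))"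
      by auto
    then show "(\<integral>\<^sup>+u. ennreal ((step_fun (\<phi> n @ \<psi> n) u - (f u + g u))\<^sup>2) \<partial>lborel)
      \<le> 2 * (\<integral>\<^sup>+u. ennreal ((step_fun (\<phi> n) u - f u)\<^sup>2) \<partial>lborel) + 2 * (\<integral>\<^sup>+u. ennreal ((step_fun (\<psi> n) u - g u)\<^sup>2) \<partial>lborel)"
      using nn_integral_square_add_le[of "\<lambda>u. step_fun (\<phi> n) u - f u" lborel "\<lambda>u. step_fun (\<psi> n) u - g u"]
      by (simp add: algebra_simps)
  qed
  moreover have "(\<lambda>n. \<integral>\<^sup>+\<omega>. ennreal ((step_integral W (\<phi> n @ \<psi> n) \<omega> - (Y \<omega> + Z \<omega>))\<^sup>2) \<partial>M) \<longlonglongrightarrow> 0"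
  proof (rule tendsto_zero_two_mult_add[OF \<phi>(3) \<psi>(3)])
    fix n
    show "(\<integral>\<^sup>+u. ennreal ((step_integral W (\<phi> n @ \<psi> n) u - (Y u + Z u))\<^sup>2) \<partial>M)
      \<le> 2 * (\<integral>\<^sup>+u. ennreal ((step_integral W (\<phi> n) u - Y u)\<^sup>2) \<partial>M) + 2 * (\<integral>\<^sup>+u. ennreal ((step_integral W (\<psi> n) u - Z u)\<^sup>2) \<partial>M)"
      using nn_integral_square_add_le[of "\<lambda>u. step_integral W (\<phi> n) u - Y u" M "\<lambda>u. step_integral W (\<psi> n) u - Z u"]
      by (simp add: algebra_simps)
  qed
  ultimately show ?thesis
    unfolding has_wiener_integral_def using \<phi>(1) \<psi>(1)
    by (intro conjI exI[of _ "\<lambda>n. \<phi> n @ \<psi> n"]) auto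
qed

lemma (in two_sided_brownian_motion) has_wiener_integral_scale:
  assumes f: "has_wiener_integral M W f Y"
  shows "has_wiener_integral M W (\<lambda>u. k * f u) (\<lambda>\<omega>. k * Y \<omega>)"
proof -
  have [measurable]: "f \<in> borel_measurable borel" "Y \<in> borel_measurable M"
    using f by (auto simp: has_wiener_integral_def)
  obtain \<phi> where \<phi>: "\<And>n. step_rep (\<phi> n)"
    "(\<lambda>n. \<integral>\<^sup>+u. ennreal ((step_fun (\<phi> n) u - f u)\<^sup>2) \<partial>lborel) \<longlonglongrightarrow> 0"
    "(\<lambda>n. \<integral>\<^sup>+\<omega>. ennreal ((step_integral W (\<phi> n) \<omega> - Y \<omega>)\<^sup>2) \<partial>M) \<longlonglongrightarrow> 0"
    using f unfolding has_wiener_integral_def by blast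
  have sq: "ennreal ((k * a - k * b)\<^sup>2) = ennreal (k\<^sup>2) * ennreal ((a - b)\<^sup>2)" for a b :: real
    by (simp add: ennreal_mult'[symmetric] power_mult_distrib[symmetric] right_diff_distrib)
  have *: "(\<lambda>n. ennreal (k\<^sup>2) * u n) \<longlonglongrightarrow> 0" if "u \<longlonglongrightarrow> 0" for u :: "nat \<Rightarrow> ennreal"
    using ennreal_tendsto_cmult[OF _ that, of "ennreal (k\<^sup>2)"] by simp
  show ?thesis
    unfolding has_wiener_integral_def using \<phi>(1) *[OF \<phi>(2)] *[OF \<phi>(3)]
    by (intro conjI exI[of _ "\<lambda>n. step_scale k (\<phi> n)"]) (auto simp: sq nn_integral_cmult)
qed

lemma (in two_sided_brownian_motion) has_wiener_integral_cong_AE: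
  assumes f: "has_wiener_integral M W f Y" and eq: "AE \<omega> in M. Z \<omega> = Y \<omega>" and Z: "Z \<in> borel_measurable M"
  shows "has_wiener_integral M W f Z"
proof -
  have "(\<integral>\<^sup>+\<omega>. ennreal ((step_integral W cs \<omega> - Z \<omega>)\<^sup>2) \<partial>M) = (\<integral>\<^sup>+\<omega>. ennreal ((step_integral W cs \<omega> - Y \<omega>)\<^sup>2) \<partial>M)" for cs
    using eq by (intro nn_integral_cong_AE) auto
  then show ?thesis using f Z unfolding has_wiener_integral_def by auto
qed

lemma step_fun_eq_0:
  assumes "step_points cs \<subseteq> {..T}" "u > T"
  shows "step_fun cs u = 0"
  using assms
proof (induction cs)
  case (Cons x cs)
  then show ?case by (cases x) (auto simp: indicator_def)
qed simp

lemma step_integral_grid_upto: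
  assumes \<tau>: "strict_mono \<tau>" and pts: "step_points cs \<subseteq> \<tau> ` {..<n}" and rep: "step_rep cs"
    and sub: "step_points cs \<subseteq> {..\<tau> K}" "K \<le> n"
  shows "step_integral W cs \<omega> = (\<Sum>i<K. step_fun cs (\<tau> (Suc i)) * (W (\<tau> (Suc i)) \<omega> - W (\<tau> i) \<omega>))"
  unfolding step_integral_grid[OF \<tau> pts rep]
proof (rule sum.mono_neutral_right)
  show "\<forall>i\<in>{..<n} - {..<K}. step_fun cs (\<tau> (Suc i)) * (W (\<tau> (Suc i)) \<omega> - W (\<tau> i) \<omega>) = 0"
  proof
    fix i assume "i \<in> {..<n} - {..<K}"
    then have "\<tau> K < \<tau> (Suc i)" using \<tau> by (simp add: strict_mono_less)
    then show "step_fun cs (\<tau> (Suc i)) * (W (\<tau> (Suc i)) \<omega> - W (\<tau> i) \<omega>) = 0"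
      using step_fun_eq_0[OF sub(1)] by simp
  qed
qed (use sub in auto)

text \<open>The integral \<open>\<phi> i\<close> looks at the past of \<open>t (Suc i)\<close>. Its part over \<open>(t i, t (Suc i)]\<close> is Gaussian with standard
  deviation at least \<open>\<kappa> i\<close> and independent of everything that happens before \<open>t i\<close>, in particular of the
  integrals with smaller index. Removing the latest integral therefore costs one factor, and induction gives
  the product.\<close>

lemma (in two_sided_brownian_motion) step_integrals_small_ball:
  fixes t \<kappa> :: "nat \<Rightarrow> real"
  assumes rep: "\<And>i. i < j \<Longrightarrow> step_rep (\<phi> i)"
    and past: "\<And>i. i < j \<Longrightarrow> step_points (\<phi> i) \<subseteq> {..t (Suc i)}"
    and t: "\<And>i. i < j \<Longrightarrow> t i < t (Suc i)"
    and \<kappa>: "\<And>i. i < j \<Longrightarrow> \<kappa> i > 0"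
    and var: "\<And>i. i < j \<Longrightarrow>
      ennreal ((\<kappa> i)\<^sup>2) \<le> (\<integral>\<^sup>+u\<in>{t i<..t (Suc i)}. ennreal ((step_fun (\<phi> i) u)\<^sup>2) \<partial>lborel)"
    and ab: "a \<le> b"
  shows "emeasure M {\<omega> \<in> space M. \<forall>i<j. step_integral W (\<phi> i) \<omega> \<in> {a<..<b}}
    \<le> (\<Prod>i<j. ennreal ((b - a) / \<kappa> i))"
proof -
  define S where "S = (\<Union>i<j. step_points (\<phi> i)) \<union> t ` {..j}"
  have "finite S" by (simp add: S_def)
  then obtain \<tau> :: "nat \<Rightarrow> real" and n where \<tau>: "strict_mono \<tau>" and S: "S = \<tau> ` {..<n}"
    using finite_set_strict_mono_enum by metis
  have pts: "step_points (\<phi> i) \<subseteq> \<tau> ` {..<n}" if "i < j" for i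
    using that S by (auto simp: S_def)
  have "\<forall>i\<in>{..j}. \<exists>k<n. t i = \<tau> k" using S by (auto simp: S_def)
  then obtain k where k: "\<And>i. i \<le> j \<Longrightarrow> k i < n" "\<And>i. i \<le> j \<Longrightarrow> t i = \<tau> (k i)"
    by (metis atMost_iff)
  have t_mono: "t i \<le> t m" if "i \<le> m" "m \<le> j" for i m
    using that
  proof (induction rule: dec_induct)
    case (step m)
    then show ?case using t[of m] by simp
  qed simp
  define D where "D l \<omega> = W (\<tau> (Suc l)) \<omega> - W (\<tau> l) \<omega>" for l \<omega>
  define c where "c i l = step_fun (\<phi> i) (\<tau> (Suc l))" for i l
  have expand: "step_integral W (\<phi> i) \<omega> = (\<Sum>l<k m. c i l * D l \<omega>)" if "i < m" "m \<le> j" for i m \<omega>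
    unfolding c_def D_def using that past[of i] t_mono[of "Suc i" m] k[of m]
    by (intro step_integral_grid_upto[OF \<tau> pts rep]) auto
  have "emeasure M {\<omega> \<in> space M. \<forall>i<m. step_integral W (\<phi> i) \<omega> \<in> {a<..<b}}
    \<le> (\<Prod>i<m. ennreal ((b - a) / \<kappa> i))" if "m \<le> j" for m
    using that
  proof (induction m)
    case 0
    then show ?case by (simp add: emeasure_space_1)
  next
    case (Suc m)
    then have "m < j" by simp
    have klt: "k m < k (Suc m)"
      using t[OF \<open>m < j\<close>] k[of m] k[of "Suc m"] \<open>m < j\<close> \<tau> by (simp add: strict_mono_less)
    \<comment> \<open>\<open>V\<close> collects the grid increments before \<open>t m\<close> and \<open>U\<close> those in \<open>(t m, t (Suc m)]\<close>; the event for the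
      smaller indices is a condition \<open>E\<close> on \<open>V\<close>.\<close>
    define N where "N = PiM {..<k m} (\<lambda>_. borel :: real measure)"
    define V where "V \<omega> = restrict (\<lambda>l. D l \<omega>) {..<k m}" for \<omega>
    define N' where "N' = PiM {k m..<k (Suc m)} (\<lambda>_. borel :: real measure)"
    define U where "U \<omega> = restrict (\<lambda>l. D l \<omega>) {k m..<k (Suc m)}" for \<omega>
    define h where "h v = (\<Sum>l\<in>{k m..<k (Suc m)}. c m l * v l)" for v :: "nat \<Rightarrow> real"
    define g where "g v = (\<Sum>l<k m. c m l * v l)" for v :: "nat \<Rightarrow> real"
    define E where "E = {v \<in> space N. \<forall>i<m. (\<Sum>l<k m. c i l * v l) \<in> {a<..<b}}"
    have comp: "(\<lambda>v. v l) \<in> borel_measurable N" if "l < k m" for l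
      unfolding N_def using that by (intro measurable_component_singleton) auto
    have lin: "(\<lambda>v. \<Sum>l<k m. c i l * v l) \<in> borel_measurable N" for i
      by (intro borel_measurable_sum borel_measurable_times borel_measurable_const comp) simp
    have E: "E \<in> sets N"
      unfolding E_def using lin by measurable
    have ind: "indep_vars (\<lambda>_. borel) D {..<k (Suc m)}"
      unfolding D_def by (rule indep_increments[OF \<tau>])
    have indep: "indep_var N V N' U"
      unfolding N_def N'_def V_def U_def using klt by (intro indep_var_restrict[OF ind]) auto
    define v where "v = (\<Sum>l\<in>{k m..<k (Suc m)}. (c m l)\<^sup>2 * (\<tau> (Suc l) - \<tau> l))"
    have v_nonneg: "v \<ge> 0" unfolding v_def using \<tau>
      by (intro sum_nonneg mult_nonneg_nonneg) (auto simp: strict_mono_less_eq)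
    have "ennreal ((\<kappa> m)\<^sup>2) \<le> ennreal v"
      using var[OF \<open>m < j\<close>] nn_integral_step_fun_grid[OF \<tau> pts[OF \<open>m < j\<close>] less_imp_le[OF klt]]
        k(2)[of m] k(2)[of "Suc m"] \<open>m < j\<close> by (simp add: v_def c_def)
    then have kv: "(\<kappa> m)\<^sup>2 \<le> v" using v_nonneg by simp
    then have "v > 0" using \<kappa>[OF \<open>m < j\<close>] by (smt (verit) zero_less_power)
    have hU: "h (U \<omega>) = (\<Sum>l\<in>{k m..<k (Suc m)}. c m l * D l \<omega>)" for \<omega>
      by (simp add: h_def U_def)
    have normal: "distributed M lborel (\<lambda>\<omega>. h (U \<omega>)) (normal_density 0 (sqrt v))"
      unfolding hU D_def by (rule grid_sum_normal[OF \<tau> v_def \<open>v > 0\<close>])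
    have h: "h \<in> borel_measurable N'"
      unfolding h_def[abs_def] N'_def
      by (intro borel_measurable_sum borel_measurable_times borel_measurable_const measurable_component_singleton) auto
    have k_le: "\<kappa> m \<le> sqrt v" using kv by (simp add: real_le_rsqrt)
    have inN: "V \<omega> \<in> space N" if "\<omega> \<in> space M" for \<omega>
      using that indep_var_rv1[OF indep] by (simp add: measurable_space)
    have VE: "V \<omega> \<in> E \<longleftrightarrow> (\<forall>i<m. step_integral W (\<phi> i) \<omega> \<in> {a<..<b})" if "\<omega> \<in> space M" for \<omega>
      using inN[OF that] expand[of _ m \<omega>] \<open>m < j\<close> by (simp add: E_def V_def)
    have split: "step_integral W (\<phi> m) \<omega> = g (V \<omega>) + h (U \<omega>)" for \<omega>
    proof -
      have "(\<Sum>l<k (Suc m). c m l * D l \<omega>)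
          = (\<Sum>l<k m. c m l * D l \<omega>) + (\<Sum>l\<in>{k m..<k (Suc m)}. c m l * D l \<omega>)"
        using sum.atLeastLessThan_concat[of 0 "k m" "k (Suc m)" "\<lambda>l. c m l * D l \<omega>"] klt
        by (simp add: atLeast0LessThan)
      then have "step_integral W (\<phi> m) \<omega> = (\<Sum>l<k m. c m l * D l \<omega>) + h (U \<omega>)"
        using expand[of m "Suc m" \<omega>] \<open>m < j\<close> hU by simp
      then show ?thesis by (simp add: g_def V_def)
    qed
    have "{\<omega> \<in> space M. \<forall>i<Suc m. step_integral W (\<phi> i) \<omega> \<in> {a<..<b}}
       = {\<omega> \<in> space M. V \<omega> \<in> E \<and> g (V \<omega>) + h (U \<omega>) \<in> {a<..<b}}"
      using VE split by (auto simp: less_Suc_eq)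
    also have "emeasure M \<dots> \<le> emeasure M {\<omega> \<in> space M. V \<omega> \<in> E} * ennreal ((b - a) / \<kappa> m)"
      using lin unfolding g_def[symmetric]
      by (intro emeasure_shifted_normal_le[OF indep h normal \<kappa>[OF \<open>m < j\<close>] k_le E _ ab]) (simp add: g_def[abs_def])
    also have "{\<omega> \<in> space M. V \<omega> \<in> E} = {\<omega> \<in> space M. \<forall>i<m. step_integral W (\<phi> i) \<omega> \<in> {a<..<b}}"
      using VE by auto
    also have "emeasure M \<dots> * ennreal ((b - a) / \<kappa> m) \<le> (\<Prod>i<m. ennreal ((b - a) / \<kappa> i)) * ennreal ((b - a) / \<kappa> m)"
      using Suc by (intro mult_right_mono) auto
    finally show ?case by simp
  qed
  then show ?thesis by simp
qed

text \<open>The bound for step integrals passes to the \<open>L\<^sup>2\<close> limit by Chebyshev's inequality: the target interval is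
  doubled and the lower bound on the standard deviation halved to absorb the approximation errors, which
  explains the factor \<open>4\<close>.\<close>

lemma (in two_sided_brownian_motion) wiener_integrals_small_ball:
  fixes t \<kappa> :: "nat \<Rightarrow> real"
  assumes Y: "\<And>i. i < j \<Longrightarrow> has_wiener_integral M W (f i) (Y i)"
    and past: "\<And>i u. i < j \<Longrightarrow> u > t (Suc i) \<Longrightarrow> f i u = 0"
    and t: "\<And>i. i < j \<Longrightarrow> t i < t (Suc i)"
    and \<kappa>: "\<And>i. i < j \<Longrightarrow> \<kappa> i > 0"
    and var: "\<And>i. i < j \<Longrightarrow>
      ennreal ((\<kappa> i)\<^sup>2) \<le> (\<integral>\<^sup>+u\<in>{t i<..t (Suc i)}. ennreal ((f i u)\<^sup>2) \<partial>lborel)"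
    and ab: "a < b"
  shows "emeasure M {\<omega> \<in> space M. \<forall>i<j. Y i \<omega> \<in> {a<..<b}}
    \<le> (\<Prod>i<j. ennreal (4 * (b - a) / \<kappa> i))"
proof -
  have "\<forall>i. i < j \<longrightarrow> (\<exists>\<phi>. (\<forall>n. step_rep (\<phi> n)) \<and> (\<forall>n. step_points (\<phi> n) \<subseteq> {..t (Suc i)}) \<and>
    (\<lambda>n. \<integral>\<^sup>+u. ennreal ((step_fun (\<phi> n) u - f i u)\<^sup>2) \<partial>lborel) \<longlonglongrightarrow> 0 \<and>
    (\<lambda>n. \<integral>\<^sup>+\<omega>. ennreal ((step_integral W (\<phi> n) \<omega> - Y i \<omega>)\<^sup>2) \<partial>M) \<longlonglongrightarrow> 0)"
  proof (intro allI impI)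
    fix i assume i: "i < j"
    show "\<exists>\<phi>. (\<forall>n. step_rep (\<phi> n)) \<and> (\<forall>n. step_points (\<phi> n) \<subseteq> {..t (Suc i)}) \<and>
      (\<lambda>n. \<integral>\<^sup>+u. ennreal ((step_fun (\<phi> n) u - f i u)\<^sup>2) \<partial>lborel) \<longlonglongrightarrow> 0 \<and>
      (\<lambda>n. \<integral>\<^sup>+\<omega>. ennreal ((step_integral W (\<phi> n) \<omega> - Y i \<omega>)\<^sup>2) \<partial>M) \<longlonglongrightarrow> 0"
      by (rule has_wiener_integral_clipped[OF Y[OF i] past[OF i]]) blast+
  qed
  then obtain \<phi> where rep: "\<And>i n. i < j \<Longrightarrow> step_rep (\<phi> i n)"
    and pts: "\<And>i n. i < j \<Longrightarrow> step_points (\<phi> i n) \<subseteq> {..t (Suc i)}"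
    and lim1: "\<And>i. i < j \<Longrightarrow> (\<lambda>n. \<integral>\<^sup>+u. ennreal ((step_fun (\<phi> i n) u - f i u)\<^sup>2) \<partial>lborel) \<longlonglongrightarrow> 0"
    and lim2: "\<And>i. i < j \<Longrightarrow> (\<lambda>n. \<integral>\<^sup>+\<omega>. ennreal ((step_integral W (\<phi> i n) \<omega> - Y i \<omega>)\<^sup>2) \<partial>M) \<longlonglongrightarrow> 0"
    unfolding choice_iff' by blast
  have meas: "Y i \<in> borel_measurable M" "f i \<in> borel_measurable borel" if "i < j" for i
    using Y[OF that] by (auto simp: has_wiener_integral_def)
  define d where "d = (b - a) / 2"
  have d: "d > 0" using ab by (simp add: d_def)
  let ?A = "{\<omega> \<in> space M. \<forall>i<j. Y i \<omega> \<in> {a<..<b}}"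
  define e where "e n = (\<Sum>i<j. ennreal (1 / d\<^sup>2) * (\<integral>\<^sup>+\<omega>. ennreal ((step_integral W (\<phi> i n) \<omega> - Y i \<omega>)\<^sup>2) \<partial>M))" for n
  have "e \<longlonglongrightarrow> (\<Sum>i<j. ennreal (1 / d\<^sup>2) * 0)"
    unfolding e_def using lim2 by (intro tendsto_sum ennreal_tendsto_cmult) auto
  then have e: "e \<longlonglongrightarrow> 0" by simp
  have var_ev: "\<forall>\<^sub>F n in sequentially. \<forall>i<j.
      ennreal ((\<kappa> i / 2)\<^sup>2) \<le> (\<integral>\<^sup>+u\<in>{t i<..t (Suc i)}. ennreal ((step_fun (\<phi> i n) u)\<^sup>2) \<partial>lborel)"
  proof -
    have "\<forall>\<^sub>F n in sequentially. ennreal ((\<kappa> i / 2)\<^sup>2) \<le> (\<integral>\<^sup>+u\<in>{t i<..t (Suc i)}. ennreal ((step_fun (\<phi> i n) u)\<^sup>2) \<partial>lborel)"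
      if "i < j" for i
    proof -
      have [measurable]: "f i \<in> borel_measurable borel" using meas that by auto
      have "\<forall>\<^sub>F n in sequentially. (\<integral>\<^sup>+u. ennreal ((step_fun (\<phi> i n) u - f i u)\<^sup>2) \<partial>lborel) < ennreal ((\<kappa> i)\<^sup>2 / 4)"
        using lim1[OF that] by (rule order_tendstoD) (use \<kappa>[OF that] in simp)
      then show ?thesis
      proof eventually_elim
        case (elim n)
        let ?I = "{t i<..t (Suc i)}"
        let ?r = "\<integral>\<^sup>+u\<in>?I. ennreal ((step_fun (\<phi> i n) u)\<^sup>2) \<partial>lborel"
        have "ennreal ((\<kappa> i)\<^sup>2) \<le> (\<integral>\<^sup>+u\<in>?I. ennreal ((f i u)\<^sup>2) \<partial>lborel)"
          by (rule var[OF that])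
        also have "\<dots> = (\<integral>\<^sup>+u. ennreal ((indicator ?I u * step_fun (\<phi> i n) u + indicator ?I u * (f i u - step_fun (\<phi> i n) u))\<^sup>2) \<partial>lborel)"
          by (intro nn_integral_cong) (auto simp: indicator_def)
        also have "\<dots> \<le> 2 * (\<integral>\<^sup>+u. ennreal ((indicator ?I u * step_fun (\<phi> i n) u)\<^sup>2) \<partial>lborel)
            + 2 * (\<integral>\<^sup>+u. ennreal ((indicator ?I u * (f i u - step_fun (\<phi> i n) u))\<^sup>2) \<partial>lborel)"
          by (rule nn_integral_square_add_le) measurable
        also have "\<dots> \<le> 2 * ?r + 2 * (\<integral>\<^sup>+u. ennreal ((step_fun (\<phi> i n) u - f i u)\<^sup>2) \<partial>lborel)"
          by (intro add_mono mult_left_mono nn_integral_mono)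
             (auto simp: indicator_def power2_commute)
        also have "\<dots> \<le> 2 * ?r + 2 * ennreal ((\<kappa> i)\<^sup>2 / 4)"
          using elim by (intro add_left_mono mult_left_mono) auto
        finally have *: "ennreal ((\<kappa> i)\<^sup>2) \<le> 2 * ?r + 2 * ennreal ((\<kappa> i)\<^sup>2 / 4)" .
        show ?case
        proof (cases ?r rule: ennreal_cases)
          case (real r)
          define q where "q = (\<kappa> i)\<^sup>2 / 4"
          have q: "q \<ge> 0" "(\<kappa> i)\<^sup>2 = 4 * q" by (simp_all add: q_def)
          have "ennreal (4 * q) \<le> 2 * ennreal r + 2 * ennreal q"
            using * by (simp add: real q_def)
          also have "\<dots> = ennreal (2 * r + 2 * q)"
            using real(1) q(1) by (simp add: ennreal_mult)
          finally have "4 * q \<le> 2 * r + 2 * q"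
            using real(1) q(1) by (subst (asm) ennreal_le_iff) auto
          then have "(\<kappa> i)\<^sup>2 \<le> 4 * r" using q by simp
          then have "(\<kappa> i / 2)\<^sup>2 \<le> r" by (simp add: power_divide)
          then show ?thesis unfolding real(2) by (rule ennreal_leI)
        qed (simp add: top_greatest)
      qed
    qed
    then have "\<forall>\<^sub>F n in sequentially. \<forall>i\<in>{..<j}.
      ennreal ((\<kappa> i / 2)\<^sup>2) \<le> (\<integral>\<^sup>+u\<in>{t i<..t (Suc i)}. ennreal ((step_fun (\<phi> i n) u)\<^sup>2) \<partial>lborel)"
      by (intro eventually_ball_finite) auto
    then show ?thesis by (rule eventually_mono) simp
  qed
  have "\<forall>\<^sub>F n in sequentially. emeasure M ?A \<le> (\<Prod>i<j. ennreal (4 * (b - a) / \<kappa> i)) + e n"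
    using var_ev
  proof eventually_elim
    case (elim n)
    let ?B = "{\<omega> \<in> space M. \<forall>i<j. step_integral W (\<phi> i n) \<omega> \<in> {a - d<..<b + d}}"
    let ?C = "\<lambda>i. {\<omega> \<in> space M. 1 \<le> ennreal (1 / d\<^sup>2) * ennreal ((step_integral W (\<phi> i n) \<omega> - Y i \<omega>)\<^sup>2)}"
    have C [measurable]: "?C i \<in> sets M" if "i < j" for i
      using meas(1)[OF that] by measurable
    have B: "?B \<in> sets M" by measurable
    have UC: "(\<Union>i<j. ?C i) \<in> sets M" using C by (intro sets.finite_UN) simp_all
    have "?A \<subseteq> ?B \<union> (\<Union>i<j. ?C i)"
    proof
      fix \<omega> assume \<omega>: "\<omega> \<in> ?A"
      have "step_integral W (\<phi> i n) \<omega> \<in> {a - d<..<b + d}" if i: "i < j" "\<omega> \<notin> ?C i" for i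
      proof -
        have "\<not> 1 \<le> 1 / d\<^sup>2 * (step_integral W (\<phi> i n) \<omega> - Y i \<omega>)\<^sup>2"
          using i \<omega> by (simp add: ennreal_mult'[symmetric])
        then have "\<bar>step_integral W (\<phi> i n) \<omega> - Y i \<omega>\<bar>\<^sup>2 < d\<^sup>2"
          using d by (simp add: field_simps)
        then have "\<bar>step_integral W (\<phi> i n) \<omega> - Y i \<omega>\<bar> < d"
          by (rule power2_less_imp_less) (use d in simp)
        moreover have "Y i \<omega> \<in> {a<..<b}" using \<omega> i by auto
        ultimately show ?thesis by auto
      qed
      then show "\<omega> \<in> ?B \<union> (\<Union>i<j. ?C i)" using \<omega> by blast
    qed
    then have "emeasure M ?A \<le> emeasure M (?B \<union> (\<Union>i<j. ?C i))"
      using B UC by (intro emeasure_mono sets.Un)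
    also have "\<dots> \<le> emeasure M ?B + emeasure M (\<Union>i<j. ?C i)"
      using B UC by (intro emeasure_subadditive)
    also have "\<dots> \<le> (\<Prod>i<j. ennreal (((b + d) - (a - d)) / (\<kappa> i / 2))) + (\<Sum>i<j. emeasure M (?C i))"
    proof (intro add_mono)
      show "emeasure M ?B \<le> (\<Prod>i<j. ennreal (((b + d) - (a - d)) / (\<kappa> i / 2)))"
        by (rule step_integrals_small_ball[where t=t, OF rep pts t]) (use elim \<kappa> ab d in auto)
      show "emeasure M (\<Union>i<j. ?C i) \<le> (\<Sum>i<j. emeasure M (?C i))"
        using C by (intro emeasure_subadditive_finite) (simp_all add: image_subset_iff)
    qed
    also have "\<dots> \<le> (\<Prod>i<j. ennreal (4 * (b - a) / \<kappa> i)) + e n"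
    proof (intro add_mono)
      have "(b + d) - (a - d) = 2 * (b - a)" by (simp add: d_def field_simps)
      then have "((b + d) - (a - d)) / (\<kappa> i / 2) = 4 * (b - a) / \<kappa> i" for i by simp
      then show "(\<Prod>i<j. ennreal (((b + d) - (a - d)) / (\<kappa> i / 2))) \<le> (\<Prod>i<j. ennreal (4 * (b - a) / \<kappa> i))"
        by (simp only: order_refl)
      show "(\<Sum>i<j. emeasure M (?C i)) \<le> e n"
        unfolding e_def
      proof (rule sum_mono)
        fix i assume "i \<in> {..<j}"
        then have [measurable]: "Y i \<in> borel_measurable M" using meas by auto
        have "emeasure M (?C i) = emeasure M ({\<omega> \<in> space M. 1 \<le> ennreal (1 / d\<^sup>2) * ennreal ((step_integral W (\<phi> i n) \<omega> - Y i \<omega>)\<^sup>2)} \<inter> space M)"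
          by (simp add: Int_absorb2)
        also have "\<dots> \<le> ennreal (1 / d\<^sup>2) * (\<integral>\<^sup>+\<omega>. ennreal ((step_integral W (\<phi> i n) \<omega> - Y i \<omega>)\<^sup>2) * indicator (space M) \<omega> \<partial>M)"
          by (rule order.trans[OF _ nn_integral_Markov_inequality]) (auto intro!: emeasure_mono)
        also have "\<dots> = ennreal (1 / d\<^sup>2) * (\<integral>\<^sup>+\<omega>. ennreal ((step_integral W (\<phi> i n) \<omega> - Y i \<omega>)\<^sup>2) \<partial>M)"
          by (intro arg_cong2[where f="(*)"] nn_integral_cong) auto
        finally show "emeasure M (?C i) \<le> ennreal (1 / d\<^sup>2) * (\<integral>\<^sup>+\<omega>. ennreal ((step_integral W (\<phi> i n) \<omega> - Y i \<omega>)\<^sup>2) \<partial>M)" .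
      qed
    qed
    finally show ?case .
  qed
  moreover have "(\<lambda>n. (\<Prod>i<j. ennreal (4 * (b - a) / \<kappa> i)) + e n) \<longlonglongrightarrow> (\<Prod>i<j. ennreal (4 * (b - a) / \<kappa> i)) + 0"
    by (intro tendsto_add tendsto_const e)
  ultimately show ?thesis
    by (subst (asm) add_0_right) (rule tendsto_lowerbound[OF _ _ trivial_limit_sequentially])
qed

section \<open>Local nondeterminism of multifractional Brownian motion\<close>

definition mbm_kernel :: "(real \<Rightarrow> real) \<Rightarrow> real \<Rightarrow> real \<Rightarrow> real" where
  "mbm_kernel H t u = 1 / Gamma (H t + 1 / 2) *
     (indicator {..<0} u * ((t - u) powr (H t - 1 / 2) - (- u) powr (H t - 1 / 2))
      + indicator {0..<t} u * (t - u) powr (H t - 1 / 2))"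

text \<open>The two integrals of the moving average representation combine into one over the whole line.\<close>

lemma (in two_sided_brownian_motion) has_wiener_integral_mbm:
  assumes X: "multifractional_brownian_motion M W H X" and t: "t \<in> {0..1}"
  shows "has_wiener_integral M W (mbm_kernel H t) (X t)"
proof -
  from X t obtain Y Z where Y: "has_wiener_integral_on M W {..<0}
          (\<lambda>u. (t - u) powr (H t - 1 / 2) - (- u) powr (H t - 1 / 2)) Y"
     and Z: "has_wiener_integral_on M W {0..<t} (\<lambda>u. (t - u) powr (H t - 1 / 2)) Z"
     and eq: "AE \<omega> in M. X t \<omega> = 1 / Gamma (H t + 1 / 2) * (Y \<omega> + Z \<omega>)"
    unfolding multifractional_brownian_motion_def by blast
  have "(\<lambda>\<omega>. (t, \<omega>)) \<in> measurable M (restrict_space borel {0..1} \<Otimes>\<^sub>M M)"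
    using t by (intro measurable_Pair1') (simp add: space_restrict_space)
  then have "(\<lambda>\<omega>. case (t, \<omega>) of (t, \<omega>) \<Rightarrow> X t \<omega>) \<in> borel_measurable M"
    using X unfolding multifractional_brownian_motion_def by (blast intro: measurable_compose)
  then have meas: "X t \<in> borel_measurable M" by simp
  show ?thesis
    unfolding mbm_kernel_def[abs_def]
    using Y Z eq meas unfolding has_wiener_integral_on_def
    by (intro has_wiener_integral_cong_AE[OF has_wiener_integral_scale[OF has_wiener_integral_add[OF Y[unfolded has_wiener_integral_on_def] Z[unfolded has_wiener_integral_on_def]]]]) auto
qed

lemma powr_ge_half_powr:
  fixes p x \<delta> :: real
  assumes "-1 \<le> p" "p \<le> 1" "\<delta> / 2 \<le> x" "x \<le> \<delta>" "0 < \<delta>"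
  shows "x powr p \<ge> \<delta> powr p / 2"
proof (cases "p \<ge> 0")
  case True
  have "2 powr p \<le> (2::real) powr 1" using assms by (intro powr_mono) auto
  then have "\<delta> powr p / 2 \<le> \<delta> powr p / 2 powr p" by (intro divide_left_mono) auto
  also have "\<dots> = (\<delta> / 2) powr p" using assms by (simp add: powr_divide)
  also have "\<dots> \<le> x powr p" using assms True by (intro powr_mono2) auto
  finally show ?thesis .
next
  case False
  have "\<delta> powr p / 2 \<le> \<delta> powr p" by simp
  also have "\<dots> \<le> x powr p" using assms False by (intro powr_mono2') auto
  finally show ?thesis .
qed

text \<open>The variance that the most recent noise over \<open>(s, t]\<close> contributes to the process at time \<open>t\<close>. It suffices to
  look at \<open>u\<close> in the first half of the interval, where \<open>t - u\<close> and \<open>t - s\<close> agree up to a factor \<open>2\<close>; this treats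
  exponents \<open>2 * H t - 1\<close> of both signs at once.\<close>

lemma mbm_kernel_variance_ge:
  fixes s t :: real
  assumes st: "0 \<le> s" "s < t" "t \<le> 1" and H: "0 < H t" "H t \<le> h" "h < 1"
    and G: "Gamma (H t + 1 / 2) \<le> G"
  shows "ennreal (((t - s) powr h / (2 * G))\<^sup>2)
    \<le> (\<integral>\<^sup>+u\<in>{s<..t}. ennreal ((mbm_kernel H t u)\<^sup>2) \<partial>lborel)"
proof -
  let ?g = "Gamma (H t + 1 / 2)" and ?\<delta> = "t - s"
  have g: "?g > 0" using H by (intro Gamma_real_pos) simp
  have pt: "?\<delta> powr (2 * H t - 1) / 2 / G\<^sup>2 \<le> (mbm_kernel H t u)\<^sup>2" if u: "s < u" "u < s + ?\<delta> / 2" for u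
  proof -
    have "?\<delta> powr (2 * H t - 1) / 2 / G\<^sup>2 \<le> (t - u) powr (2 * H t - 1) / ?g\<^sup>2"
    proof (rule frac_le)
      show "?\<delta> powr (2 * H t - 1) / 2 \<le> (t - u) powr (2 * H t - 1)"
        using u st H by (intro powr_ge_half_powr) (auto simp: field_simps)
      show "0 < ?g\<^sup>2" using g by simp
      show "?g\<^sup>2 \<le> G\<^sup>2" using G g by (intro power_mono) auto
    qed simp
    also have "\<dots> = (mbm_kernel H t u)\<^sup>2"
    proof -
      have "mbm_kernel H t u = (t - u) powr (H t - 1 / 2) / ?g"
        using u st by (simp add: mbm_kernel_def field_simps)
      then show ?thesis
        by (simp add: power_divide power2_eq_square powr_add[symmetric] flip: mult.assoc)
    qed
    finally show ?thesis .
  qed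
  have "(t - s) powr h \<le> ?\<delta> powr (H t)"
    using st H by (intro powr_mono') auto
  then have "((t - s) powr h)\<^sup>2 \<le> (?\<delta> powr (H t))\<^sup>2" by (intro power_mono) auto
  also have "\<dots> = ?\<delta> powr (2 * H t - 1) * ?\<delta>"
    using st powr_add[of "?\<delta>" "2 * H t - 1" 1]
    by (simp add: power2_eq_square powr_add[symmetric])
  finally have "((t - s) powr h / (2 * G))\<^sup>2 \<le> ?\<delta> powr (2 * H t - 1) * ?\<delta> / (4 * G\<^sup>2)"
    by (simp add: power_divide power_mult_distrib divide_right_mono)
  also have "\<dots> = ?\<delta> powr (2 * H t - 1) / 2 / G\<^sup>2 * (?\<delta> / 2)" by simp
  finally have "ennreal (((t - s) powr h / (2 * G))\<^sup>2)
     \<le> ennreal (?\<delta> powr (2 * H t - 1) / 2 / G\<^sup>2 * (?\<delta> / 2))" by (rule ennreal_leI)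
  also have "\<dots> = (\<integral>\<^sup>+u. ennreal (?\<delta> powr (2 * H t - 1) / 2 / G\<^sup>2) * indicator {s<..<s + ?\<delta> / 2} u \<partial>lborel)"
    using st by (simp add: nn_integral_cmult ennreal_mult' flip: ennreal_mult'')
  also have "\<dots> \<le> (\<integral>\<^sup>+u\<in>{s<..t}. ennreal ((mbm_kernel H t u)\<^sup>2) \<partial>lborel)"
  proof (rule nn_integral_mono)
    fix u
    show "ennreal (?\<delta> powr (2 * H t - 1) / 2 / G\<^sup>2) * indicator {s<..<s + ?\<delta> / 2} u
      \<le> ennreal ((mbm_kernel H t u)\<^sup>2) * indicator {s<..t} u"
    proof (cases "u \<in> {s<..<s + ?\<delta> / 2}")
      case True
      then have u: "s < u" "u < s + (t - s) / 2" by auto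
      have "(t - s) / 2 \<le> t - s" using st by simp
      then have "u \<le> t" using u by linarith
      then have "u \<in> {s<..t}" using u by simp
      then show ?thesis using True pt[of u] by (auto intro: ennreal_leI)
    qed simp
  qed
  finally show ?thesis .
qed

text \<open>Local nondeterminism: given the past up to \<open>t i\<close>, the value at \<open>t (Suc i)\<close> is still spread over a scale
  \<open>(t (Suc i) - t i) powr h\<close>. The constant comes from an upper bound for the Gamma function on the
  compact interval \<open>[\<mu> + 1 / 2, \<nu> + 1 / 2]\<close>.\<close>

lemma (in two_sided_brownian_motion) mbm_small_ball:
  assumes \<mu>: "0 < \<mu>" and \<nu>: "\<nu> < 1" and H: "\<forall>t\<ge>0. H t \<in> {\<mu>..\<nu>}"
    and X: "multifractional_brownian_motion M W H X"
    and h: "\<And>t. t \<in> {0..1} \<Longrightarrow> H t \<le> h" "h < 1"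
  shows "\<exists>C>0. \<forall>j t a b. (\<forall>i<j. t i < t (Suc i)) \<longrightarrow> 0 \<le> t 0 \<longrightarrow> t j \<le> 1 \<longrightarrow> a < b \<longrightarrow>
       emeasure M {\<omega> \<in> space M. \<forall>i<j. X (t (Suc i)) \<omega> \<in> {a<..<b}}
       \<le> (\<Prod>i<j. ennreal (C * (b - a) * (t (Suc i) - t i) powr (- h)))"
proof -
  have "compact (Gamma ` {\<mu> + 1 / 2..\<nu> + 1 / 2})"
    using \<mu> by (intro compact_continuous_image continuous_intros) (auto elim!: nonpos_Ints_cases)
  then have "bounded (Gamma ` {\<mu> + 1 / 2..\<nu> + 1 / 2})" by (rule compact_imp_bounded)
  then obtain G where G: "G > 0" "\<And>x. x \<in> {\<mu> + 1 / 2..\<nu> + 1 / 2} \<Longrightarrow> norm (Gamma x) \<le> G"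
    by (metis bounded_pos image_eqI)
  show ?thesis
  proof (intro exI[of _ "8 * G"] conjI allI impI)
    fix j and t :: "nat \<Rightarrow> real" and a b :: real
    assume "\<forall>i<j. t i < t (Suc i)" "0 \<le> t 0" "t j \<le> 1" and ab: "a < b"
    then have t: "\<And>i. i < j \<Longrightarrow> t i < t (Suc i)" "0 \<le> t 0" "t j \<le> 1" by auto
    have mono: "t i \<le> t m" if "i \<le> m" "m \<le> j" for i m
      using that
    proof (induction rule: dec_induct)
      case (step m)
      then show ?case using t(1)[of m] by simp
    qed simp
    have range: "t i \<in> {0..1}" if "i \<le> j" for i
      using mono[of 0 i] mono[of i j] that t by auto
    have "emeasure M {\<omega> \<in> space M. \<forall>i<j. X (t (Suc i)) \<omega> \<in> {a<..<b}}
       \<le> (\<Prod>i<j. ennreal (4 * (b - a) / ((t (Suc i) - t i) powr h / (2 * G))))"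
    proof (rule wiener_integrals_small_ball[where f="\<lambda>i. mbm_kernel H (t (Suc i))" and t=t])
      fix i assume i: "i < j"
      show "has_wiener_integral M W (mbm_kernel H (t (Suc i))) (X (t (Suc i)))"
        using range[of "Suc i"] i by (intro has_wiener_integral_mbm[OF X]) auto
      show "mbm_kernel H (t (Suc i)) u = 0" if "u > t (Suc i)" for u
        using that range[of "Suc i"] i by (simp add: mbm_kernel_def)
      show "t i < t (Suc i)" by (rule t(1)[OF i])
      show "0 < (t (Suc i) - t i) powr h / (2 * G)" using G t(1)[OF i] by simp
      have "H (t (Suc i)) \<in> {\<mu>..\<nu>}" using H range[of "Suc i"] i by auto
      then show "ennreal (((t (Suc i) - t i) powr h / (2 * G))\<^sup>2)
        \<le> (\<integral>\<^sup>+u\<in>{t i<..t (Suc i)}. ennreal ((mbm_kernel H (t (Suc i)) u)\<^sup>2) \<partial>lborel)"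
        using range[of i] range[of "Suc i"] i t(1)[OF i] \<mu> h G(2)[of "H (t (Suc i)) + 1 / 2"]
        by (intro mbm_kernel_variance_ge) auto
    qed (rule ab)
    also have "\<dots> = (\<Prod>i<j. ennreal (8 * G * (b - a) * (t (Suc i) - t i) powr (- h)))"
      using G by (intro prod.cong arg_cong[where f=ennreal]) (auto simp: powr_minus field_simps)
    finally show "emeasure M {\<omega> \<in> space M. \<forall>i<j. X (t (Suc i)) \<omega> \<in> {a<..<b}}
       \<le> (\<Prod>i<j. ennreal (8 * G * (b - a) * (t (Suc i) - t i) powr (- h)))" .
  qed (use G in simp)
qed

section \<open>Moments of additive functionals\<close>

text \<open>The power of the integral is an integral over \<open>k + 1\<close> time variables, any of which is equally likely to be
  the largest one; the right-hand side singles it out as \<open>s\<close>. For continuous \<open>f\<close> this is the chain rule.\<close>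

lemma nn_integral_power_Suc:
  fixes f :: "real \<Rightarrow> ennreal"
  assumes f [measurable]: "f \<in> borel_measurable borel"
  shows "(\<integral>\<^sup>+s\<in>{a<..<T}. f s \<partial>lborel) ^ Suc k
    = of_nat (Suc k) * (\<integral>\<^sup>+s\<in>{a<..<T}. f s * (\<integral>\<^sup>+r\<in>{a<..<s}. f r \<partial>lborel) ^ k \<partial>lborel)"
proof (induction k arbitrary: T)
  case 0
  show ?case by simp
next
  case (Suc k)
  let ?F = "\<lambda>s. \<integral>\<^sup>+r\<in>{a<..<s}. f r \<partial>lborel"
  have F_eq: "?F = (\<lambda>s. \<integral>\<^sup>+r. f r * (if a < r \<and> r < s then 1 else 0) \<partial>lborel)"
    by (auto intro!: nn_integral_cong ext simp: indicator_def)
  have F [measurable]: "?F \<in> borel_measurable borel"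
    unfolding F_eq by measurable
  have split: "?F T = ?F s + (\<integral>\<^sup>+r\<in>{s<..<T}. f r \<partial>lborel)" if "s \<in> {a<..<T}" for s
  proof -
    have "AE r in lborel. r \<noteq> s" by (rule AE_lborel_singleton)
    then have "?F T = (\<integral>\<^sup>+r. f r * indicator {a<..<s} r + f r * indicator {s<..<T} r \<partial>lborel)"
      using that by (intro nn_integral_cong_AE) (auto elim!: eventually_mono simp: indicator_def)
    then show ?thesis by (simp add: nn_integral_add)
  qed
  have swap: "(\<integral>\<^sup>+s\<in>{a<..<T}. f s * ?F s ^ k * (\<integral>\<^sup>+r\<in>{s<..<T}. f r \<partial>lborel) \<partial>lborel)
     = (\<integral>\<^sup>+r\<in>{a<..<T}. f r * (\<integral>\<^sup>+s\<in>{a<..<r}. f s * ?F s ^ k \<partial>lborel) \<partial>lborel)"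
  proof -
    have "(\<integral>\<^sup>+s\<in>{a<..<T}. f s * ?F s ^ k * (\<integral>\<^sup>+r\<in>{s<..<T}. f r \<partial>lborel) \<partial>lborel)
       = (\<integral>\<^sup>+s. (\<integral>\<^sup>+r. f s * ?F s ^ k * f r * (if a < s \<and> s < r \<and> r < T then 1 else 0) \<partial>lborel) \<partial>lborel)"
    proof (rule nn_integral_cong)
      fix s
      show "f s * ?F s ^ k * (\<integral>\<^sup>+r\<in>{s<..<T}. f r \<partial>lborel) * indicator {a<..<T} s
         = (\<integral>\<^sup>+r. f s * ?F s ^ k * f r * (if a < s \<and> s < r \<and> r < T then 1 else 0) \<partial>lborel)"
      proof (cases "s \<in> {a<..<T}")
        case True
        then show ?thesis
          by (subst mult.commute, subst nn_integral_cmult[symmetric])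
             (auto intro!: nn_integral_cong simp: indicator_def nn_integral_cmult[symmetric] mult_ac)
      next
        case False
        then have *: "(a < s \<and> s < r \<and> r < T) = False" for r by auto
        show ?thesis using False by (simp only: *) simp
      qed
    qed
    also have "\<dots> = (\<integral>\<^sup>+r. (\<integral>\<^sup>+s. f s * ?F s ^ k * f r * (if a < s \<and> s < r \<and> r < T then 1 else 0) \<partial>lborel) \<partial>lborel)"
      by (rule lborel_pair.Fubini') measurable
    also have "\<dots> = (\<integral>\<^sup>+r\<in>{a<..<T}. f r * (\<integral>\<^sup>+s\<in>{a<..<r}. f s * ?F s ^ k \<partial>lborel) \<partial>lborel)"
    proof (rule nn_integral_cong)
      fix r
      show "(\<integral>\<^sup>+s. f s * ?F s ^ k * f r * (if a < s \<and> s < r \<and> r < T then 1 else 0) \<partial>lborel)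
        = f r * (\<integral>\<^sup>+s\<in>{a<..<r}. f s * ?F s ^ k \<partial>lborel) * indicator {a<..<T} r"
      proof (cases "r \<in> {a<..<T}")
        case True
        then show ?thesis
          by (auto intro!: nn_integral_cong simp: indicator_def nn_integral_cmult[symmetric] mult_ac)
      next
        case False
        then have *: "(a < s \<and> s < r \<and> r < T) = False" for s by auto
        show ?thesis using False by (simp only: *) simp
      qed
    qed
    finally show ?thesis .
  qed
  have "?F T ^ Suc (Suc k) = ?F T * (of_nat (Suc k) * (\<integral>\<^sup>+s\<in>{a<..<T}. f s * ?F s ^ k \<partial>lborel))"
    using Suc.IH[of T] by simp
  also have "\<dots> = of_nat (Suc k) * (\<integral>\<^sup>+s\<in>{a<..<T}. f s * ?F s ^ k * ?F T \<partial>lborel)"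
    by (subst mult.left_commute, subst nn_integral_cmult[symmetric])
       (auto intro!: arg_cong2[where f="(*)"] nn_integral_cong simp: mult_ac)
  also have "(\<integral>\<^sup>+s\<in>{a<..<T}. f s * ?F s ^ k * ?F T \<partial>lborel)
     = (\<integral>\<^sup>+s. f s * ?F s ^ Suc k * indicator {a<..<T} s
          + f s * ?F s ^ k * (\<integral>\<^sup>+r\<in>{s<..<T}. f r \<partial>lborel) * indicator {a<..<T} s \<partial>lborel)"
  proof (rule nn_integral_cong)
    fix s
    show "f s * ?F s ^ k * ?F T * indicator {a<..<T} s
      = f s * ?F s ^ Suc k * indicator {a<..<T} s
          + f s * ?F s ^ k * (\<integral>\<^sup>+r\<in>{s<..<T}. f r \<partial>lborel) * indicator {a<..<T} s"
      using split[of s] by (cases "s \<in> {a<..<T}") (auto simp: distrib_left mult_ac)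
  qed
  also have "\<dots> = (\<integral>\<^sup>+s\<in>{a<..<T}. f s * ?F s ^ Suc k \<partial>lborel)
     + (\<integral>\<^sup>+s\<in>{a<..<T}. f s * ?F s ^ k * (\<integral>\<^sup>+r\<in>{s<..<T}. f r \<partial>lborel) \<partial>lborel)"
  proof (rule nn_integral_add)
    have "(\<lambda>s. \<integral>\<^sup>+r. f r * (if s < r \<and> r < T then 1 else 0) \<partial>lborel) \<in> borel_measurable borel"
      by measurable
    also have "(\<lambda>s. \<integral>\<^sup>+r. f r * (if s < r \<and> r < T then 1 else 0) \<partial>lborel) = (\<lambda>s. \<integral>\<^sup>+r\<in>{s<..<T}. f r \<partial>lborel)"
      by (auto intro!: nn_integral_cong ext simp: indicator_def)
    finally have [measurable]: "(\<lambda>s. \<integral>\<^sup>+r\<in>{s<..<T}. f r \<partial>lborel) \<in> borel_measurable borel" .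
    show "(\<lambda>s. f s * ?F s ^ k * (\<integral>\<^sup>+r\<in>{s<..<T}. f r \<partial>lborel) * indicator {a<..<T} s) \<in> borel_measurable lborel"
      by measurable
  qed measurable
  also have "of_nat (Suc k) * \<dots> = of_nat (Suc k) * (\<integral>\<^sup>+s\<in>{a<..<T}. f s * ?F s ^ Suc k \<partial>lborel)
     + (\<integral>\<^sup>+r\<in>{a<..<T}. f r * (of_nat (Suc k) * (\<integral>\<^sup>+s\<in>{a<..<r}. f s * ?F s ^ k \<partial>lborel)) \<partial>lborel)"
    unfolding swap distrib_left
  proof (intro arg_cong2[where f="(+)"] refl)
    have eq: "(\<lambda>r. \<integral>\<^sup>+s\<in>{a<..<r}. f s * ?F s ^ k \<partial>lborel) = (\<lambda>r. \<integral>\<^sup>+s. f s * ?F s ^ k * (if a < s \<and> s < r then 1 else 0) \<partial>lborel)"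
      by (auto intro!: nn_integral_cong ext simp: indicator_def)
    have [measurable]: "(\<lambda>r. \<integral>\<^sup>+s\<in>{a<..<r}. f s * ?F s ^ k \<partial>lborel) \<in> borel_measurable borel"
      unfolding eq by measurable
    have cmult: "c * (\<integral>\<^sup>+r\<in>{a<..<T}. f r * G r \<partial>lborel) = (\<integral>\<^sup>+r\<in>{a<..<T}. f r * (c * G r) \<partial>lborel)"
      if [measurable]: "G \<in> borel_measurable borel" for c :: ennreal and G
      by (subst nn_integral_cmult[symmetric]) (auto intro!: nn_integral_cong simp: mult_ac)
    show "of_nat (Suc k) * (\<integral>\<^sup>+r\<in>{a<..<T}. f r * (\<integral>\<^sup>+s\<in>{a<..<r}. f s * ?F s ^ k \<partial>lborel) \<partial>lborel)
      = (\<integral>\<^sup>+r\<in>{a<..<T}. f r * (of_nat (Suc k) * (\<integral>\<^sup>+s\<in>{a<..<r}. f s * ?F s ^ k \<partial>lborel)) \<partial>lborel)"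
      by (rule cmult[of "\<lambda>r. \<integral>\<^sup>+s\<in>{a<..<r}. f s * ?F s ^ k \<partial>lborel"]) measurable
  qed
  also have "\<dots> = of_nat (Suc k) * (\<integral>\<^sup>+s\<in>{a<..<T}. f s * ?F s ^ Suc k \<partial>lborel)
     + (\<integral>\<^sup>+r\<in>{a<..<T}. f r * ?F r ^ Suc k \<partial>lborel)"
    unfolding Suc.IH[symmetric] ..
  finally show ?case by (simp add: distrib_right add.commute)
qed

text \<open>The bound for the joint density of visits at the successive times of a list, started from time \<open>a\<close>.\<close>

fun chain_prod :: "(real \<Rightarrow> ennreal) \<Rightarrow> real \<Rightarrow> real list \<Rightarrow> ennreal" where
  "chain_prod q a [] = 1"
| "chain_prod q a (t # ts) = q (t - a) * chain_prod q t ts"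

text \<open>The integral of \<^const>\<open>chain_prod\<close> over all chains of \<open>k\<close> intermediate times from \<open>a\<close> to \<open>t\<close>.\<close>

fun iterated_kernel :: "(real \<Rightarrow> ennreal) \<Rightarrow> real \<Rightarrow> nat \<Rightarrow> real \<Rightarrow> ennreal" where
  "iterated_kernel q a 0 t = q (t - a)"
| "iterated_kernel q a (Suc k) t = (\<integral>\<^sup>+s\<in>{a<..<t}. q (t - s) * iterated_kernel q a k s \<partial>lborel)"

lemma borel_measurable_iterated_kernel [measurable]:
  assumes [measurable]: "q \<in> borel_measurable borel"
  shows "iterated_kernel q a k \<in> borel_measurable borel"
proof (induction k)
  case 0
  have "(\<lambda>t. q (t - a)) \<in> borel_measurable borel" by measurable
  then show ?case by (simp add: iterated_kernel.simps(1)[abs_def])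
next
  case (Suc k)
  note Suc[measurable]
  have "(\<lambda>t. \<integral>\<^sup>+s. q (t - s) * iterated_kernel q a k s * (if a < s \<and> s < t then 1 else 0) \<partial>lborel) \<in> borel_measurable borel"
    by measurable
  also have "(\<lambda>t. \<integral>\<^sup>+s. q (t - s) * iterated_kernel q a k s * (if a < s \<and> s < t then 1 else 0) \<partial>lborel)
    = iterated_kernel q a (Suc k)"
    by (auto intro!: ext nn_integral_cong simp: indicator_def)
  finally show ?case .
qed

text \<open>Iterated kernels are convolution powers of \<open>q\<close>, and the exponential weight is multiplicative along a chain,
  so the Laplace transform of the convolution power is a power of the Laplace transform.\<close>

lemma nn_integral_iterated_kernel_le:
  assumes [measurable]: "q \<in> borel_measurable borel"
  shows "(\<integral>\<^sup>+t\<in>{a<..}. iterated_kernel q a k t * ennreal (exp (- l * (t - a))) \<partial>lborel)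
    \<le> (\<integral>\<^sup>+u\<in>{0<..}. q u * ennreal (exp (- l * u)) \<partial>lborel) ^ Suc k"
proof -
  let ?\<kappa> = "\<integral>\<^sup>+u\<in>{0<..}. q u * ennreal (exp (- l * u)) \<partial>lborel"
  have shift: "(\<integral>\<^sup>+t\<in>{s<..}. q (t - s) * ennreal (exp (- l * (t - s))) \<partial>lborel) = ?\<kappa>" for s
    using nn_integral_real_affine[of "\<lambda>t. q (t - s) * ennreal (exp (- l * (t - s))) * indicator {s<..} t" 1 s]
    by (simp add: indicator_def)
  show ?thesis
  proof (induction k)
    case 0
    show ?case using shift[of a] by simp
  next
    case (Suc k)
    let ?R = "iterated_kernel q a k"
    have "(\<integral>\<^sup>+t\<in>{a<..}. iterated_kernel q a (Suc k) t * ennreal (exp (- l * (t - a))) \<partial>lborel)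
      = (\<integral>\<^sup>+t. (\<integral>\<^sup>+s. q (t - s) * ?R s * ennreal (exp (- l * (t - a))) * (if a < s \<and> s < t then 1 else 0) \<partial>lborel) \<partial>lborel)"
    proof (rule nn_integral_cong)
      fix t
      show "iterated_kernel q a (Suc k) t * ennreal (exp (- l * (t - a))) * indicator {a<..} t
        = (\<integral>\<^sup>+s. q (t - s) * ?R s * ennreal (exp (- l * (t - a))) * (if a < s \<and> s < t then 1 else 0) \<partial>lborel)"
      proof (cases "a < t")
        case True
        have "iterated_kernel q a (Suc k) t * ennreal (exp (- l * (t - a)))
          = (\<integral>\<^sup>+s. q (t - s) * ?R s * indicator {a<..<t} s * ennreal (exp (- l * (t - a))) \<partial>lborel)"
          unfolding iterated_kernel.simps by (rule nn_integral_multc[symmetric]) measurable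
        also have "\<dots> = (\<integral>\<^sup>+s. q (t - s) * ?R s * ennreal (exp (- l * (t - a))) * (if a < s \<and> s < t then 1 else 0) \<partial>lborel)"
          by (intro nn_integral_cong) (auto simp: indicator_def)
        finally have "iterated_kernel q a (Suc k) t * ennreal (exp (- l * (t - a)))
          = (\<integral>\<^sup>+s. q (t - s) * ?R s * ennreal (exp (- l * (t - a))) * (if a < s \<and> s < t then 1 else 0) \<partial>lborel)" .
        moreover have "indicator {a<..} t = (1 :: ennreal)" using True by simp
        ultimately show ?thesis by (simp only: mult_1_right)
      next
        case False
        then have *: "(a < s \<and> s < t) = False" for s by auto
        show ?thesis using False by (simp only: *) simp
      qed
    qed
    also have "\<dots> = (\<integral>\<^sup>+s. (\<integral>\<^sup>+t. q (t - s) * ?R s * ennreal (exp (- l * (t - a))) * (if a < s \<and> s < t then 1 else 0) \<partial>lborel) \<partial>lborel)"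
      by (rule lborel_pair.Fubini') measurable
    also have "\<dots> = (\<integral>\<^sup>+s\<in>{a<..}. ?R s * ennreal (exp (- l * (s - a))) * ?\<kappa> \<partial>lborel)"
    proof (rule nn_integral_cong)
      fix s
      have e: "exp (- l * (t - a)) = exp (- l * (s - a)) * exp (- l * (t - s))" for t
        by (simp add: exp_add[symmetric] algebra_simps)
      show "(\<integral>\<^sup>+t. q (t - s) * ?R s * ennreal (exp (- l * (t - a))) * (if a < s \<and> s < t then 1 else 0) \<partial>lborel)
        = ?R s * ennreal (exp (- l * (s - a))) * ?\<kappa> * indicator {a<..} s"
      proof (cases "a < s")
        case True
        have "(\<integral>\<^sup>+t. q (t - s) * ?R s * ennreal (exp (- l * (t - a))) * (if a < s \<and> s < t then 1 else 0) \<partial>lborel)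
          = (\<integral>\<^sup>+t. ?R s * ennreal (exp (- l * (s - a))) * (q (t - s) * ennreal (exp (- l * (t - s))) * indicator {s<..} t) \<partial>lborel)"
        proof (rule nn_integral_cong)
          fix t
          show "q (t - s) * ?R s * ennreal (exp (- l * (t - a))) * (if a < s \<and> s < t then 1 else 0)
            = ?R s * ennreal (exp (- l * (s - a))) * (q (t - s) * ennreal (exp (- l * (t - s))) * indicator {s<..} t)"
            unfolding e[of t] using True by (auto simp: indicator_def ennreal_mult mult_ac)
        qed
        also have "\<dots> = ?R s * ennreal (exp (- l * (s - a))) * ?\<kappa>"
          unfolding shift[of s, symmetric] by (rule nn_integral_cmult) measurable
        finally show ?thesis using True by simp
      qed simp
    qed
    also have "\<dots> = (\<integral>\<^sup>+s\<in>{a<..}. ?R s * ennreal (exp (- l * (s - a))) \<partial>lborel) * ?\<kappa>"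
      by (subst nn_integral_multc[symmetric]) (auto intro!: nn_integral_cong simp: mult_ac)
    also have "\<dots> \<le> ?\<kappa> ^ Suc k * ?\<kappa>"
      by (rule mult_right_mono[OF Suc]) simp
    finally show ?case by (simp add: mult_ac)
  qed
qed

lemma prod_list_measurable:
  assumes "\<And>s. (\<lambda>\<omega>. f s \<omega>) \<in> borel_measurable M"
  shows "(\<lambda>\<omega>. \<Prod>s\<leftarrow>ts. f s \<omega> :: ennreal) \<in> borel_measurable M"
  by (induction ts) (use assms in auto)

text \<open>The largest of the \<open>k\<close> times below \<open>T\<close> is moved to the front of the list until all times are explicit
  and the hypothesis on chains applies. The list of later times is carried along since the hypothesis is
  about the expectation of the whole product.\<close>

lemma (in sigma_finite_measure) moment_le_iterated_kernel:
  fixes f :: "real \<Rightarrow> 'a \<Rightarrow> ennreal"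
  assumes f [measurable]: "(\<lambda>(s, \<omega>). f s \<omega>) \<in> borel_measurable (borel \<Otimes>\<^sub>M M)"
    and q [measurable]: "q \<in> borel_measurable borel"
    and chain: "\<And>ts. \<lbrakk>sorted_wrt (<) (a # ts); set ts \<subseteq> {..b}\<rbrakk> \<Longrightarrow>
      (\<integral>\<^sup>+\<omega>. (\<Prod>s\<leftarrow>ts. f s \<omega>) \<partial>M) \<le> chain_prod q a ts"
  assumes T: "sorted_wrt (<) (a # T # ts)" "set (T # ts) \<subseteq> {..b}"
  shows "(\<integral>\<^sup>+\<omega>. (\<Prod>s\<leftarrow>T # ts. f s \<omega>) * (\<integral>\<^sup>+s\<in>{a<..<T}. f s \<omega> \<partial>lborel) ^ k \<partial>M)
    \<le> fact k * iterated_kernel q a k T * chain_prod q T ts"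
  using T
proof (induction k arbitrary: T ts)
  case 0
  then show ?case using chain[of "T # ts"] by simp
next
  case (Suc k)
  interpret pair_sigma_finite lborel M ..
  have f' [measurable]: "(\<lambda>\<omega>. f s \<omega>) \<in> borel_measurable M" for s
    using measurable_compose[OF measurable_Pair1'[of s borel M] f] by simp
  have fs [measurable]: "(\<lambda>s. f s \<omega>) \<in> borel_measurable borel" if "\<omega> \<in> space M" for \<omega>
    using measurable_compose[OF measurable_Pair2'[OF that] f] by simp
  let ?P = "\<lambda>\<omega>. \<Prod>s\<leftarrow>T # ts. f s \<omega>"
  let ?F = "\<lambda>s \<omega>. \<integral>\<^sup>+r\<in>{a<..<s}. f r \<omega> \<partial>lborel"
  have P [measurable]: "?P \<in> borel_measurable M" by (intro prod_list_measurable) measurable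
  have "(\<lambda>(s, \<omega>). \<integral>\<^sup>+r. f r \<omega> * (if a < r \<and> r < s then 1 else 0) \<partial>lborel) \<in> borel_measurable (borel \<Otimes>\<^sub>M M)"
    by measurable
  also have "(\<lambda>(s, \<omega>). \<integral>\<^sup>+r. f r \<omega> * (if a < r \<and> r < s then 1 else 0) \<partial>lborel) = (\<lambda>(s, \<omega>). ?F s \<omega>)"
    by (auto intro!: nn_integral_cong ext simp: indicator_def)
  finally have F [measurable]: "(\<lambda>(s, \<omega>). ?F s \<omega>) \<in> borel_measurable (borel \<Otimes>\<^sub>M M)" .
  have "(\<integral>\<^sup>+\<omega>. ?P \<omega> * ?F T \<omega> ^ Suc k \<partial>M)
    = (\<integral>\<^sup>+\<omega>. of_nat (Suc k) * (\<integral>\<^sup>+s. ?P \<omega> * (f s \<omega> * ?F s \<omega> ^ k) * indicator {a<..<T} s \<partial>lborel) \<partial>M)"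
  proof (rule nn_integral_cong)
    fix \<omega> assume \<omega>: "\<omega> \<in> space M"
    note [measurable] = fs[OF \<omega>]
    have [measurable]: "(\<lambda>s. ?F s \<omega>) \<in> borel_measurable borel"
      using measurable_compose[OF measurable_Pair2'[OF \<omega>] F] by simp
    have "?P \<omega> * ?F T \<omega> ^ Suc k = of_nat (Suc k) * (?P \<omega> * (\<integral>\<^sup>+s\<in>{a<..<T}. f s \<omega> * ?F s \<omega> ^ k \<partial>lborel))"
      unfolding nn_integral_power_Suc[OF fs[OF \<omega>]] by (simp only: mult_ac)
    also have "?P \<omega> * (\<integral>\<^sup>+s\<in>{a<..<T}. f s \<omega> * ?F s \<omega> ^ k \<partial>lborel)
      = (\<integral>\<^sup>+s. ?P \<omega> * (f s \<omega> * ?F s \<omega> ^ k) * indicator {a<..<T} s \<partial>lborel)"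
      by (subst nn_integral_cmult[symmetric]) (auto simp only: mult_ac intro!: nn_integral_cong, measurable)
    finally show "?P \<omega> * ?F T \<omega> ^ Suc k = of_nat (Suc k) * (\<integral>\<^sup>+s. ?P \<omega> * (f s \<omega> * ?F s \<omega> ^ k) * indicator {a<..<T} s \<partial>lborel)" .
  qed
  also have "\<dots> = of_nat (Suc k) * (\<integral>\<^sup>+\<omega>. (\<integral>\<^sup>+s. ?P \<omega> * (f s \<omega> * ?F s \<omega> ^ k) * indicator {a<..<T} s \<partial>lborel) \<partial>M)"
    by (rule nn_integral_cmult) measurable
  finally have E: "(\<integral>\<^sup>+\<omega>. ?P \<omega> * ?F T \<omega> ^ Suc k \<partial>M)
    = of_nat (Suc k) * (\<integral>\<^sup>+\<omega>. (\<integral>\<^sup>+s. ?P \<omega> * (f s \<omega> * ?F s \<omega> ^ k) * indicator {a<..<T} s \<partial>lborel) \<partial>M)" .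
  have "(\<integral>\<^sup>+\<omega>. (\<integral>\<^sup>+s. ?P \<omega> * (f s \<omega> * ?F s \<omega> ^ k) * indicator {a<..<T} s \<partial>lborel) \<partial>M)
     = (\<integral>\<^sup>+s. (\<integral>\<^sup>+\<omega>. ?P \<omega> * (f s \<omega> * ?F s \<omega> ^ k) * indicator {a<..<T} s \<partial>M) \<partial>lborel)"
    by (rule Fubini') measurable
  also have "\<dots> \<le> (\<integral>\<^sup>+s. fact k * chain_prod q T ts * (q (T - s) * iterated_kernel q a k s * indicator {a<..<T} s) \<partial>lborel)"
  proof (rule nn_integral_mono)
    fix s
    show "(\<integral>\<^sup>+\<omega>. ?P \<omega> * (f s \<omega> * ?F s \<omega> ^ k) * indicator {a<..<T} s \<partial>M)
      \<le> fact k * chain_prod q T ts * (q (T - s) * iterated_kernel q a k s * indicator {a<..<T} s)"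
    proof (cases "s \<in> {a<..<T}")
      case True
      then have "(\<integral>\<^sup>+\<omega>. (\<Prod>s\<leftarrow>s # T # ts. f s \<omega>) * ?F s \<omega> ^ k \<partial>M)
        \<le> fact k * iterated_kernel q a k s * chain_prod q s (T # ts)"
        using Suc.prems by (intro Suc.IH) auto
      moreover have "indicator {a<..<T} s = (1 :: ennreal)" using True by simp
      ultimately show ?thesis
        by (simp only: mult_1_left mult_1_right list.map prod_list.Cons chain_prod.simps mult_ac)
    qed simp
  qed
  also have "\<dots> = fact k * chain_prod q T ts * iterated_kernel q a (Suc k) T"
    unfolding iterated_kernel.simps by (rule nn_integral_cmult) measurable
  finally have "(\<integral>\<^sup>+\<omega>. ?P \<omega> * ?F T \<omega> ^ Suc k \<partial>M)
     \<le> of_nat (Suc k) * (fact k * chain_prod q T ts * iterated_kernel q a (Suc k) T)"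
    unfolding E by (rule mult_left_mono) simp
  also have "\<dots> = fact (Suc k) * iterated_kernel q a (Suc k) T * chain_prod q T ts"
    by (simp only: fact_Suc of_nat_mult mult_ac)
  finally show ?case .
qed

text \<open>On \<open>[a, b]\<close> the weight \<open>exp (- l * (t - a))\<close> is at least \<open>exp (- l * (b - a))\<close>, so the integral over the simplex
  is controlled by a Laplace transform at the price of one factor \<open>exp (l * (b - a))\<close>.\<close>

lemma (in sigma_finite_measure) moment_le_laplace:
  fixes f :: "real \<Rightarrow> 'a \<Rightarrow> ennreal"
  assumes f [measurable]: "(\<lambda>(s, \<omega>). f s \<omega>) \<in> borel_measurable (borel \<Otimes>\<^sub>M M)"
    and q [measurable]: "q \<in> borel_measurable borel"
    and chain: "\<And>ts. \<lbrakk>sorted_wrt (<) (a # ts); set ts \<subseteq> {..b}\<rbrakk> \<Longrightarrow>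
      (\<integral>\<^sup>+\<omega>. (\<Prod>s\<leftarrow>ts. f s \<omega>) \<partial>M) \<le> chain_prod q a ts"
    and l: "0 \<le> l"
  shows "(\<integral>\<^sup>+\<omega>. (\<integral>\<^sup>+s\<in>{a<..<b}. f s \<omega> \<partial>lborel) ^ Suc k \<partial>M)
    \<le> fact (Suc k) * ennreal (exp (l * (b - a)))
       * (\<integral>\<^sup>+u\<in>{0<..}. q u * ennreal (exp (- l * u)) \<partial>lborel) ^ Suc k"
proof -
  interpret P: pair_sigma_finite lborel M ..
  have fs: "(\<lambda>s. f s \<omega>) \<in> borel_measurable borel" if "\<omega> \<in> space M" for \<omega>
    using measurable_compose[OF measurable_Pair2'[OF that] f] by simp
  let ?F = "\<lambda>s \<omega>. \<integral>\<^sup>+r\<in>{a<..<s}. f r \<omega> \<partial>lborel"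
  have "(\<lambda>(s, \<omega>). \<integral>\<^sup>+r. f r \<omega> * (if a < r \<and> r < s then 1 else 0) \<partial>lborel) \<in> borel_measurable (borel \<Otimes>\<^sub>M M)"
    by measurable
  also have "(\<lambda>(s, \<omega>). \<integral>\<^sup>+r. f r \<omega> * (if a < r \<and> r < s then 1 else 0) \<partial>lborel) = (\<lambda>(s, \<omega>). ?F s \<omega>)"
    by (auto intro!: nn_integral_cong ext simp: indicator_def)
  finally have F [measurable]: "(\<lambda>(s, \<omega>). ?F s \<omega>) \<in> borel_measurable (borel \<Otimes>\<^sub>M M)" .
  have "(\<integral>\<^sup>+\<omega>. ?F b \<omega> ^ Suc k \<partial>M)
    = (\<integral>\<^sup>+\<omega>. of_nat (Suc k) * (\<integral>\<^sup>+s\<in>{a<..<b}. f s \<omega> * ?F s \<omega> ^ k \<partial>lborel) \<partial>M)"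
    by (intro nn_integral_cong nn_integral_power_Suc fs)
  also have "\<dots> = of_nat (Suc k) * (\<integral>\<^sup>+\<omega>. (\<integral>\<^sup>+s\<in>{a<..<b}. f s \<omega> * ?F s \<omega> ^ k \<partial>lborel) \<partial>M)"
    by (rule nn_integral_cmult) measurable
  finally have E: "(\<integral>\<^sup>+\<omega>. ?F b \<omega> ^ Suc k \<partial>M)
    = of_nat (Suc k) * (\<integral>\<^sup>+\<omega>. (\<integral>\<^sup>+s\<in>{a<..<b}. f s \<omega> * ?F s \<omega> ^ k \<partial>lborel) \<partial>M)" .
  have "(\<integral>\<^sup>+\<omega>. (\<integral>\<^sup>+s\<in>{a<..<b}. f s \<omega> * ?F s \<omega> ^ k \<partial>lborel) \<partial>M)
     = (\<integral>\<^sup>+s. (\<integral>\<^sup>+\<omega>. f s \<omega> * ?F s \<omega> ^ k * indicator {a<..<b} s \<partial>M) \<partial>lborel)"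
    by (rule P.Fubini') measurable
  also have "\<dots> \<le> (\<integral>\<^sup>+s. fact k * ennreal (exp (l * (b - a)))
       * (iterated_kernel q a k s * ennreal (exp (- l * (s - a))) * indicator {a<..} s) \<partial>lborel)"
  proof (rule nn_integral_mono)
    fix s
    show "(\<integral>\<^sup>+\<omega>. f s \<omega> * ?F s \<omega> ^ k * indicator {a<..<b} s \<partial>M)
      \<le> fact k * ennreal (exp (l * (b - a)))
       * (iterated_kernel q a k s * ennreal (exp (- l * (s - a))) * indicator {a<..} s)"
    proof (cases "s \<in> {a<..<b}")
      case True
      have "1 \<le> exp (l * (b - a)) * exp (- l * (s - a))"
      proof -
        have "exp (l * (b - a)) * exp (- l * (s - a)) = exp (l * (b - s))"
          by (simp add: exp_add[symmetric] algebra_simps)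
        moreover have "0 \<le> l * (b - s)" using True l by simp
        ultimately show ?thesis by simp
      qed
      then have e: "1 \<le> ennreal (exp (l * (b - a))) * ennreal (exp (- l * (s - a)))"
        by (simp add: ennreal_mult[symmetric])
      have "(\<integral>\<^sup>+\<omega>. (\<Prod>s\<leftarrow>s # []. f s \<omega>) * ?F s \<omega> ^ k \<partial>M)
        \<le> fact k * iterated_kernel q a k s * chain_prod q s []"
        using True by (intro moment_le_iterated_kernel[OF f q chain]) auto
      also have "\<dots> \<le> fact k * iterated_kernel q a k s * (ennreal (exp (l * (b - a))) * ennreal (exp (- l * (s - a))))"
        unfolding chain_prod.simps by (intro mult_left_mono e) simp
      finally show ?thesis using True by (simp add: mult_ac)
    qed simp
  qed
  also have "\<dots> = fact k * ennreal (exp (l * (b - a)))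
     * (\<integral>\<^sup>+s\<in>{a<..}. iterated_kernel q a k s * ennreal (exp (- l * (s - a))) \<partial>lborel)"
    by (rule nn_integral_cmult) measurable
  also have "\<dots> \<le> fact k * ennreal (exp (l * (b - a)))
     * (\<integral>\<^sup>+u\<in>{0<..}. q u * ennreal (exp (- l * u)) \<partial>lborel) ^ Suc k"
    by (intro mult_left_mono nn_integral_iterated_kernel_le q) simp
  finally have "(\<integral>\<^sup>+\<omega>. ?F b \<omega> ^ Suc k \<partial>M) \<le> of_nat (Suc k) * (fact k * ennreal (exp (l * (b - a)))
     * (\<integral>\<^sup>+u\<in>{0<..}. q u * ennreal (exp (- l * u)) \<partial>lborel) ^ Suc k)"
    unfolding E by (rule mult_left_mono) simp
  also have "\<dots> = fact (Suc k) * ennreal (exp (l * (b - a)))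
       * (\<integral>\<^sup>+u\<in>{0<..}. q u * ennreal (exp (- l * u)) \<partial>lborel) ^ Suc k"
    by (simp only: fact_Suc of_nat_mult mult_ac)
  finally show ?thesis .
qed

lemma nn_integral_powr_laplace:
  assumes h: "h < 1" and l: "l > 0" and C: "C \<ge> 0"
  shows "(\<integral>\<^sup>+u\<in>{0<..}. ennreal (C * u powr (- h)) * ennreal (exp (- l * u)) \<partial>lborel)
    = ennreal (C * Gamma (1 - h) * l powr (h - 1))"
proof -
  have G: "((\<lambda>t. t powr ((1 - h) - 1) / exp t) has_integral Gamma (1 - h)) {0..}"
    using h by (intro Gamma_integral_real) simp
  have "(\<integral>\<^sup>+v. ennreal (v powr (- h) / exp v * indicator {0..} v) \<partial>lborel) = ennreal (Gamma (1 - h))"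
    using nn_integral_has_integral_lebesgue[OF _ G] by (simp add: nn_integral_completion mult.commute)
  also have "(\<integral>\<^sup>+v. ennreal (v powr (- h) / exp v * indicator {0..} v) \<partial>lborel)
    = ennreal l * (\<integral>\<^sup>+u. ennreal ((l * u) powr (- h) / exp (l * u) * indicator {0..} (l * u)) \<partial>lborel)"
    using l by (subst nn_integral_real_affine[where c=l and t=0]) auto
  finally have *: "ennreal l * (\<integral>\<^sup>+u. ennreal ((l * u) powr (- h) / exp (l * u) * indicator {0..} (l * u)) \<partial>lborel)
     = ennreal (Gamma (1 - h))" .
  have "(\<integral>\<^sup>+u\<in>{0<..}. ennreal (C * u powr (- h)) * ennreal (exp (- l * u)) \<partial>lborel)
    = (\<integral>\<^sup>+u. ennreal (C * l powr (h - 1)) * (ennreal l * ennreal ((l * u) powr (- h) / exp (l * u) * indicator {0..} (l * u))) \<partial>lborel)"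
  proof (rule nn_integral_cong_AE)
    have "AE u in lborel. u \<noteq> (0::real)" by (rule AE_lborel_singleton)
    then show "AE u in lborel. ennreal (C * u powr (- h)) * ennreal (exp (- l * u)) * indicator {0<..} u
      = ennreal (C * l powr (h - 1)) * (ennreal l * ennreal ((l * u) powr (- h) / exp (l * u) * indicator {0..} (l * u)))"
    proof eventually_elim
      case (elim u)
      show ?case
      proof (cases "u > 0")
        case True
        have "l powr (h - 1) * l * l powr (- h) = 1"
          using l by (simp add: powr_diff powr_minus field_simps)
        then have "C * u powr (- h) * exp (- l * u)
          = C * l powr (h - 1) * (l * ((l * u) powr (- h) / exp (l * u)))"
          using True l by (simp add: powr_mult exp_minus field_simps)
        then show ?thesis
          using True l C by (simp add: ennreal_mult'[symmetric] ennreal_mult''[symmetric])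
      next
        case False
        then have "\<not> 0 \<le> l * u" using elim l by (simp add: zero_le_mult_iff)
        with False show ?thesis by simp
      qed
    qed
  qed
  also have "\<dots> = ennreal (C * l powr (h - 1)) * (ennreal l * (\<integral>\<^sup>+u. ennreal ((l * u) powr (- h) / exp (l * u) * indicator {0..} (l * u)) \<partial>lborel))"
    by (simp add: nn_integral_cmult)
  also have "\<dots> = ennreal (C * l powr (h - 1)) * ennreal (Gamma (1 - h))"
    unfolding * ..
  also have "\<dots> = ennreal (C * Gamma (1 - h) * l powr (h - 1))"
  proof (subst ennreal_mult[symmetric])
    show "0 \<le> Gamma (1 - h)" using h by (intro less_imp_le Gamma_real_pos) simp
  qed (use C in \<open>auto simp: mult_ac\<close>)
  finally show ?thesis .
qed

text \<open>The exact value of the simplex integral is a quotient of Gamma functions. The choice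
  \<open>l = m / (b - a)\<close> in the Laplace bound reproduces its growth in \<open>m\<close> up to a geometric factor: \<open>m!\<close> is cut down
  to \<open>m powr (h * m)\<close>. This growth is what produces the power \<open>h\<close> of the logarithm.\<close>

lemma (in sigma_finite_measure) moment_le_of_powr_chain:
  fixes f :: "real \<Rightarrow> 'a \<Rightarrow> ennreal"
  assumes f: "(\<lambda>(s, \<omega>). f s \<omega>) \<in> borel_measurable (borel \<Otimes>\<^sub>M M)"
    and h: "h < 1" and C: "C \<ge> 0"
    and chain: "\<And>ts. \<lbrakk>sorted_wrt (<) (a # ts); set ts \<subseteq> {..b}\<rbrakk> \<Longrightarrow>
      (\<integral>\<^sup>+\<omega>. (\<Prod>s\<leftarrow>ts. f s \<omega>) \<partial>M) \<le> chain_prod (\<lambda>u. ennreal (C * u powr (- h))) a ts"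
    and ab: "a < b" and m: "m > 0"
  shows "(\<integral>\<^sup>+\<omega>. (\<integral>\<^sup>+s\<in>{a<..<b}. f s \<omega> \<partial>lborel) ^ m \<partial>M)
    \<le> ennreal ((exp 1 * C * Gamma (1 - h) * real m powr h * (b - a) powr (1 - h)) ^ m)"
proof -
  define l where "l = real m / (b - a)"
  have l: "l > 0" using ab m by (simp add: l_def)
  have lm: "l * (b - a) = real m" using ab by (simp add: l_def)
  have g: "Gamma (1 - h) > 0" using h by (intro Gamma_real_pos) simp
  obtain k where k: "m = Suc k" using m by (cases m) auto
  have "(\<integral>\<^sup>+\<omega>. (\<integral>\<^sup>+s\<in>{a<..<b}. f s \<omega> \<partial>lborel) ^ m \<partial>M)
    \<le> fact m * ennreal (exp (l * (b - a)))
       * (\<integral>\<^sup>+u\<in>{0<..}. ennreal (C * u powr (- h)) * ennreal (exp (- l * u)) \<partial>lborel) ^ m"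
    unfolding k by (rule moment_le_laplace[OF f _ chain less_imp_le[OF l]]) auto
  also have "\<dots> = fact m * ennreal (exp (real m)) * ennreal (C * Gamma (1 - h) * l powr (h - 1)) ^ m"
    unfolding nn_integral_powr_laplace[OF h l C] lm ..
  also have "\<dots> = ennreal (fact m * exp 1 ^ m * (C * Gamma (1 - h) * l powr (h - 1)) ^ m)"
  proof -
    have "fact m = ennreal (fact m)" by (metis ennreal_of_nat_eq_real_of_nat of_nat_fact)
    moreover have "exp (real m) = exp 1 ^ m" by (simp flip: exp_of_nat_mult)
    moreover have "0 \<le> C * Gamma (1 - h) * l powr (h - 1)" using C g by simp
    ultimately show ?thesis by (simp only: ennreal_mult ennreal_power mult_nonneg_nonneg fact_ge_zero exp_ge_zero zero_le_power)
  qed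
  also have "\<dots> \<le> ennreal (real m ^ m * exp 1 ^ m * (C * Gamma (1 - h) * l powr (h - 1)) ^ m)"
    using C g fact_le_power[of m, where 'a=real]
    by (intro ennreal_leI mult_right_mono) auto
  also have "real m ^ m * exp 1 ^ m * (C * Gamma (1 - h) * l powr (h - 1)) ^ m
     = (exp 1 * C * Gamma (1 - h) * (real m * l powr (h - 1))) ^ m"
    by (simp add: power_mult_distrib mult_ac)
  also have "real m * l powr (h - 1) = real m powr h * (b - a) powr (1 - h)"
  proof -
    have "l powr (h - 1) = real m powr (h - 1) / (b - a) powr (h - 1)"
      using ab by (simp add: l_def powr_divide)
    also have "\<dots> = real m powr (h - 1) * (b - a) powr (1 - h)"
      using ab by (metis divide_inverse minus_diff_eq powr_minus)
    also have "real m * \<dots> = real m powr 1 * real m powr (h - 1) * (b - a) powr (1 - h)"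
      using m by simp
    also have "\<dots> = real m powr h * (b - a) powr (1 - h)"
      by (subst powr_add[symmetric]) simp
    finally show ?thesis .
  qed
  finally show ?thesis by (simp add: mult_ac)
qed

section \<open>Densities of measures on the line\<close>

text \<open>The windows are open and to the right of \<open>x\<close>, to match the form of Lebesgue's differentiation theorem in
  \<open>integrable_ccontinuous_explicit\<close>.\<close>

definition window_density :: "real measure \<Rightarrow> nat \<Rightarrow> real \<Rightarrow> ennreal" where
  "window_density \<nu> n x = ennreal (real (Suc n)) * emeasure \<nu> {x<..<x + 1 / real (Suc n)}"

lemma window_density_tendsto:
  fixes g :: "real \<Rightarrow> ennreal"
  assumes g [measurable]: "g \<in> borel_measurable borel"
    and fin: "(\<integral>\<^sup>+y. g y \<partial>lborel) < \<infinity>"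
  shows "AE x in lborel. (\<lambda>n. window_density (density lborel g) n x) \<longlonglongrightarrow> g x"
proof -
  define f where "f = (\<lambda>x. enn2real (g x))"
  have [measurable]: "f \<in> borel_measurable borel" unfolding f_def by simp
  have AEfin: "AE x in lborel. g x \<noteq> \<infinity>"
    using fin by (intro nn_integral_PInf_AE) auto
  have eqf: "AE x in lborel. ennreal (f x) = g x"
    using AEfin by eventually_elim (simp add: f_def less_top)
  have intf: "integrable lborel f"
  proof (rule integrableI_nonneg)
    show "AE x in lborel. 0 \<le> f x" by (simp add: f_def)
    show "(\<integral>\<^sup>+x. ennreal (f x) \<partial>lborel) < \<infinity>"
      using fin nn_integral_cong_AE[OF eqf] by simp
  qed simp
  have si: "set_integrable lborel S f" if "S \<in> sets borel" for S
    unfolding set_integrable_def by (rule integrable_mult_indicator) (use intf that in auto)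
  have hk: "f integrable_on cbox a b" for a b :: real
    using set_borel_integral_eq_integral(1)[OF si[of "{a..b}"]] by simp
  obtain N where N: "negligible N"
    and lim: "\<And>x e. \<lbrakk>x \<notin> N; 0 < e\<rbrakk> \<Longrightarrow> \<exists>d>0. \<forall>h. 0 < h \<and> h < d \<longrightarrow>
         norm (integral (cbox x (x + h *\<^sub>R One)) f /\<^sub>R h ^ DIM(real) - f x) < e"
    using integrable_ccontinuous_explicit[OF hk] by blast
  have "AE x in lebesgue. x \<notin> N"
    using N by (metis AE_not_in negligible_iff_null_sets)
  then have AEN: "AE x in lborel. x \<notin> N" by (simp add: AE_completion_iff)
  show ?thesis using AEfin AEN
  proof eventually_elim
    case (elim x)
    have val: "window_density (density lborel g) n x =
        ennreal (integral (cbox x (x + (1 / real (Suc n)) *\<^sub>R One)) f /\<^sub>R (1 / real (Suc n)) ^ DIM(real))" for n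
    proof -
      let ?h = "1 / real (Suc n)"
      have "emeasure (density lborel g) {x<..<x + ?h} = (\<integral>\<^sup>+y. g y * indicator {x<..<x + ?h} y \<partial>lborel)"
        by (simp add: emeasure_density)
      also have "\<dots> = (\<integral>\<^sup>+y. ennreal (indicator {x..x + ?h} y * f y) \<partial>lborel)"
      proof (rule nn_integral_cong_AE)
        have "AE y in lborel. y \<noteq> x \<and> y \<noteq> x + ?h"
          using AE_lborel_singleton[of x] AE_lborel_singleton[of "x + ?h"] by auto
        then show "AE y in lborel. g y * indicator {x<..<x + ?h} y = ennreal (indicator {x..x + ?h} y * f y)"
          using eqf by eventually_elim (auto simp: indicator_def)
      qed
      also have "\<dots> = ennreal (LINT y:{x..x + ?h}|lborel. f y)"
        using si[of "{x..x+?h}"] unfolding set_lebesgue_integral_def set_integrable_def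
        by (subst nn_integral_eq_integral) (auto simp: f_def)
      also have "(LINT y:{x..x + ?h}|lborel. f y) = integral (cbox x (x + ?h *\<^sub>R One)) f"
        using set_borel_integral_eq_integral(2)[OF si[of "{x..x+?h}"]] by simp
      finally show ?thesis
        unfolding window_density_def
        by (simp add: ennreal_mult'[symmetric] divide_inverse del: of_nat_Suc)
    qed
    have "(\<lambda>n. integral (cbox x (x + (1 / real (Suc n)) *\<^sub>R One)) f /\<^sub>R (1 / real (Suc n)) ^ DIM(real)) \<longlonglongrightarrow> f x"
    proof (rule LIMSEQ_I)
      fix e :: real assume "0 < e"
      with lim[OF elim(2)] obtain d where d: "d > 0"
        and *: "\<And>h. 0 < h \<and> h < d \<longrightarrow>
          norm (integral (cbox x (x + h *\<^sub>R One)) f /\<^sub>R h ^ DIM(real) - f x) < e" by blast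
      obtain m where m: "1 / real (Suc m) < d" using nat_approx_posE[OF d] by metis
      show "\<exists>no. \<forall>n\<ge>no. norm (integral (cbox x (x + (1 / real (Suc n)) *\<^sub>R One)) f /\<^sub>R (1 / real (Suc n)) ^ DIM(real) - f x) < e"
      proof (intro exI allI impI)
        fix n assume "m \<le> n"
        then have "1 / real (Suc n) \<le> 1 / real (Suc m)" by (simp add: frac_le)
        with m show "norm (integral (cbox x (x + (1 / real (Suc n)) *\<^sub>R One)) f /\<^sub>R (1 / real (Suc n)) ^ DIM(real) - f x) < e"
          by (intro *[rule_format]) auto
      qed
    qed
    then have "(\<lambda>n. window_density (density lborel g) n x) \<longlonglongrightarrow> ennreal (f x)"
      unfolding val by (rule tendsto_ennrealI)
    with elim(1) show ?case by (simp add: f_def less_top)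
  qed
qed

lemma window_density_measurable [measurable]:
  assumes "finite_measure \<nu>" "sets \<nu> = sets borel"
  shows "window_density \<nu> n \<in> borel_measurable borel"
proof -
  interpret finite_measure \<nu> by fact
  have [measurable_cong]: "sets \<nu> = sets borel" by fact
  have "(\<lambda>x. \<integral>\<^sup>+y. indicator {x<..<x + 1 / real (Suc n)} y \<partial>\<nu>) \<in> borel_measurable borel"
    unfolding indicator_def greaterThanLessThan_iff by measurable
  then show ?thesis
    using assms(2) by (simp add: window_density_def [abs_def])
qed

lemma nn_integral_window_density:
  assumes "finite_measure \<nu>" "sets \<nu> = sets borel" "U \<in> sets borel"
  shows "(\<integral>\<^sup>+x\<in>U. window_density \<nu> n x \<partial>lborel)
    = (\<integral>\<^sup>+y. ennreal (real (Suc n)) * emeasure lborel (U \<inter> {y - 1 / real (Suc n)<..<y}) \<partial>\<nu>)"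
proof -
  interpret finite_measure \<nu> by fact
  have [measurable_cong]: "sets \<nu> = sets borel" by fact
  have [measurable]: "U \<in> sets borel" by fact
  interpret pair_sigma_finite lborel \<nu> by standard
  let ?h = "1 / real (Suc n)" and ?c = "ennreal (real (Suc n))"
  have "(\<integral>\<^sup>+x\<in>U. window_density \<nu> n x \<partial>lborel)
     = (\<integral>\<^sup>+x. (\<integral>\<^sup>+y. ?c * indicator U x * (if x < y \<and> y < x + ?h then 1 else 0) \<partial>\<nu>) \<partial>lborel)"
  proof (rule nn_integral_cong)
    fix x :: real
    have "(\<integral>\<^sup>+y. ?c * indicator U x * (if x < y \<and> y < x + ?h then 1 else 0) \<partial>\<nu>)
        = ?c * indicator U x * (\<integral>\<^sup>+y. indicator {x<..<x + ?h} y \<partial>\<nu>)"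
      by (subst nn_integral_cmult[symmetric]) (auto intro!: nn_integral_cong simp: indicator_def assms)
    then show "window_density \<nu> n x * indicator U x
      = (\<integral>\<^sup>+y. ?c * indicator U x * (if x < y \<and> y < x + ?h then 1 else 0) \<partial>\<nu>)"
      by (simp add: window_density_def assms mult_ac)
  qed
  also have "\<dots> = (\<integral>\<^sup>+y. (\<integral>\<^sup>+x. ?c * indicator U x * (if x < y \<and> y < x + ?h then 1 else 0) \<partial>lborel) \<partial>\<nu>)"
    by (rule Fubini'[symmetric]) measurable
  also have "\<dots> = (\<integral>\<^sup>+y. ?c * emeasure lborel (U \<inter> {y - ?h<..<y}) \<partial>\<nu>)"
  proof (rule nn_integral_cong)
    fix y :: real
    have "?c * emeasure lborel (U \<inter> {y - ?h<..<y}) = ?c * (\<integral>\<^sup>+x. indicator (U \<inter> {y - ?h<..<y}) x \<partial>lborel)"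
      by simp
    also have "\<dots> = (\<integral>\<^sup>+x. ?c * indicator (U \<inter> {y - ?h<..<y}) x \<partial>lborel)"
      by (subst nn_integral_cmult) auto
    finally show "(\<integral>\<^sup>+x. ?c * indicator U x * (if x < y \<and> y < x + ?h then 1 else 0) \<partial>lborel)
       = ?c * emeasure lborel (U \<inter> {y - ?h<..<y})"
      by (auto intro!: nn_integral_cong simp: indicator_def)
  qed
  finally show ?thesis .
qed

text \<open>Every point \<open>y\<close> of an open set eventually sees a full window \<open>(y - 1 / (n + 1), y)\<close> inside the set, so this is Fatou's
  lemma after exchanging the two integrals.\<close>

lemma emeasure_open_le_liminf_window_density:
  assumes fin: "finite_measure \<nu>" and sets: "sets \<nu> = sets borel" and U: "open U"
  shows "emeasure \<nu> U \<le> liminf (\<lambda>n. \<integral>\<^sup>+x\<in>U. window_density \<nu> n x \<partial>lborel)"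
proof -
  interpret finite_measure \<nu> by fact
  have [measurable_cong]: "sets \<nu> = sets borel" by fact
  have [measurable]: "U \<in> sets borel" using U by auto
  let ?F = "\<lambda>n y. ennreal (real (Suc n)) * emeasure lborel (U \<inter> {y - 1 / real (Suc n)<..<y})"
  have meas: "?F n \<in> borel_measurable \<nu>" for n
  proof -
    have "(\<lambda>y. \<integral>\<^sup>+x. indicator U x * (if y - 1 / real (Suc n) < x \<and> x < y then 1 else 0) \<partial>lborel) \<in> borel_measurable \<nu>"
      by measurable
    also have "(\<lambda>y. \<integral>\<^sup>+x. indicator U x * (if y - 1 / real (Suc n) < x \<and> x < y then 1 else 0) \<partial>lborel)
      = (\<lambda>y. \<integral>\<^sup>+x. indicator (U \<inter> {y - 1 / real (Suc n)<..<y}) x \<partial>lborel)"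
      by (auto intro!: nn_integral_cong ext simp: indicator_def)
    finally show ?thesis by (simp add: borel_measurable_times_ennreal)
  qed
  have "emeasure \<nu> U = (\<integral>\<^sup>+y. indicator U y \<partial>\<nu>)" by simp
  also have "\<dots> \<le> (\<integral>\<^sup>+y. liminf (\<lambda>n. ?F n y) \<partial>\<nu>)"
  proof (rule nn_integral_mono)
    fix y
    show "indicator U y \<le> liminf (\<lambda>n. ?F n y)"
    proof (cases "y \<in> U")
      case True
      then obtain d where d: "d > 0" "\<And>x. \<bar>x - y\<bar> < d \<Longrightarrow> x \<in> U"
        using U by (metis open_real)
      obtain m where m: "1 / real (Suc m) < d" using nat_approx_posE[OF d(1)] by metis
      have "\<forall>\<^sub>F n in sequentially. 1 \<le> ?F n y"
        unfolding eventually_sequentially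
      proof (intro exI allI impI)
        fix n assume "m \<le> n"
        then have "1 / real (Suc n) \<le> 1 / real (Suc m)" by (simp add: frac_le)
        with m have *: "1 / real (Suc n) < d" by linarith
        have "U \<inter> {y - 1 / real (Suc n)<..<y} = {y - 1 / real (Suc n)<..<y}"
          using * by (auto intro!: d(2))
        then show "1 \<le> ?F n y"
          by (simp add: ennreal_mult'[symmetric] del: of_nat_Suc)
      qed
      then have "1 \<le> liminf (\<lambda>n. ?F n y)" by (rule Liminf_bounded)
      then show ?thesis using True by simp
    qed simp
  qed
  also have "\<dots> \<le> liminf (\<lambda>n. \<integral>\<^sup>+y. ?F n y \<partial>\<nu>)"
    by (rule nn_integral_liminf) (rule meas)
  finally show ?thesis
    using nn_integral_window_density[OF fin sets] by simp
qed

text \<open>If \<open>V\<close> is bounded and open with Lebesgue measure at most \<open>e\<^sup>2\<close>, the elementary inequality \<open>w \<le> e * w\<^sup>2 + 1 / e\<close> turns the bound on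
  the second moment of the window densities into \<open>\<nu> V \<le> e * K + e\<close>. Bounded null sets are covered by such \<open>V\<close>
  for every \<open>e\<close>, and a countable union of null sets is null.\<close>

lemma absolutely_continuous_of_window_density_square:
  assumes fin: "finite_measure \<nu>" and sets: "sets \<nu> = sets borel"
    and bd: "\<And>R::nat. liminf (\<lambda>n. \<integral>\<^sup>+x\<in>{-real R<..<real R}. (window_density \<nu> n x)\<^sup>2 \<partial>lborel) < \<infinity>"
  shows "absolutely_continuous lborel \<nu>"
  unfolding absolutely_continuous_def
proof
  fix N :: "real set" assume N: "N \<in> null_sets lborel"
  interpret finite_measure \<nu> by fact
  have [measurable_cong]: "sets \<nu> = sets borel" by fact
  have [measurable]: "N \<in> sets borel" using N by auto
  have zero: "emeasure \<nu> (N \<inter> {-real R<..<real R}) = 0" for R :: nat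
  proof -
    define I where "I = {-real R<..<real R}"
    have [measurable]: "I \<in> sets borel" by (simp add: I_def)
    obtain K where K: "liminf (\<lambda>n. \<integral>\<^sup>+x\<in>I. (window_density \<nu> n x)\<^sup>2 \<partial>lborel) = ennreal K" "K \<ge> 0"
      using bd[of R] unfolding I_def by (cases rule: ennreal_cases) auto
    have small: "emeasure \<nu> (N \<inter> I) \<le> ennreal (e * K + e)" if e: "e > 0" for e :: real
    proof -
      obtain V where V: "open V" "N \<subseteq> V" and "emeasure lborel (V - N) < ennreal (e^2)"
        using outer_regular_lborel[of N "e^2"] e by auto
      moreover have "emeasure lborel V = emeasure lborel (V - N)"
        using N V by (subst emeasure_Diff_null_set) auto
      ultimately have Vs: "emeasure lborel V < ennreal (e^2)" by simp
      define U where "U = V \<inter> I"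
      have U: "open U" "U \<subseteq> I" "N \<inter> I \<subseteq> U" using V by (auto simp: U_def I_def)
      have [measurable]: "U \<in> sets borel" using U by auto
      have Us: "emeasure lborel U \<le> ennreal (e^2)"
        using Vs V(1) by (intro order.trans[OF emeasure_mono order.strict_implies_order[OF Vs]]) (auto simp: U_def)
      have pt: "window_density \<nu> n x * indicator U x
         \<le> ennreal e * ((window_density \<nu> n x)\<^sup>2 * indicator I x) + ennreal (1/e) * indicator U x" for n x
      proof (cases "x \<in> U")
        case True
        then have "x \<in> I" using U by auto
        have "window_density \<nu> n x \<noteq> \<infinity>"
          by (simp add: window_density_def ennreal_mult_eq_top_iff)
        then obtain w where w: "window_density \<nu> n x = ennreal w" "w \<ge> 0"
          by (cases rule: ennreal_cases[of "window_density \<nu> n x"]) auto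
        have "w \<le> e * w^2 + 1/e"
        proof -
          have "0 \<le> (e * w - 1)^2 + e * w" using e w by simp
          then have "e * w \<le> (e*w)^2 + 1" by (simp add: power2_eq_square algebra_simps)
          then show ?thesis using e by (simp add: field_simps power2_eq_square)
        qed
        then have "ennreal w \<le> ennreal (e * w^2 + 1/e)" by (rule ennreal_leI)
        then show ?thesis using True \<open>x \<in> I\<close> w e
          by (simp add: ennreal_mult ennreal_power)
      qed simp
      have "emeasure \<nu> (N \<inter> I) \<le> emeasure \<nu> U"
        using U by (intro emeasure_mono) (auto simp: sets)
      also have "\<dots> \<le> liminf (\<lambda>n. \<integral>\<^sup>+x\<in>U. window_density \<nu> n x \<partial>lborel)"
        by (rule emeasure_open_le_liminf_window_density[OF fin sets U(1)])
      also have "\<dots> \<le> liminf (\<lambda>n. ennreal e * (\<integral>\<^sup>+x\<in>I. (window_density \<nu> n x)\<^sup>2 \<partial>lborel) + ennreal (1/e) * emeasure lborel U)"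
      proof (intro Liminf_mono always_eventually allI)
        fix n
        have [measurable]: "window_density \<nu> n \<in> borel_measurable borel"
          by (rule window_density_measurable[OF fin sets])
        have "(\<integral>\<^sup>+x\<in>U. window_density \<nu> n x \<partial>lborel) \<le>
          (\<integral>\<^sup>+x. ennreal e * ((window_density \<nu> n x)\<^sup>2 * indicator I x) + ennreal (1/e) * indicator U x \<partial>lborel)"
          by (rule nn_integral_mono) (rule pt)
        also have "\<dots> = ennreal e * (\<integral>\<^sup>+x\<in>I. (window_density \<nu> n x)\<^sup>2 \<partial>lborel) + ennreal (1/e) * emeasure lborel U"
          by (subst nn_integral_add) (auto simp: nn_integral_cmult)
        finally show "(\<integral>\<^sup>+x\<in>U. window_density \<nu> n x \<partial>lborel) \<le>
          ennreal e * (\<integral>\<^sup>+x\<in>I. (window_density \<nu> n x)\<^sup>2 \<partial>lborel) + ennreal (1/e) * emeasure lborel U" .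
      qed
      also have "\<dots> \<le> liminf (\<lambda>n. ennreal e * (\<integral>\<^sup>+x\<in>I. (window_density \<nu> n x)\<^sup>2 \<partial>lborel) + ennreal e)"
      proof (intro Liminf_mono always_eventually allI add_left_mono)
        have "ennreal (1/e) * emeasure lborel U \<le> ennreal (1/e) * ennreal (e^2)"
          by (rule mult_left_mono[OF Us]) simp
        also have "\<dots> = ennreal e" using e by (simp add: ennreal_mult'[symmetric] power2_eq_square)
        finally show "ennreal (1/e) * emeasure lborel U \<le> ennreal e" .
      qed
      also have "\<dots> = ennreal e * liminf (\<lambda>n. \<integral>\<^sup>+x\<in>I. (window_density \<nu> n x)\<^sup>2 \<partial>lborel) + ennreal e"
        by (subst Liminf_add_const)
           (auto intro!: arg_cong2[where f="(+)"] Liminf_compose_continuous_mono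
             ennreal_continuous_on_cmult continuous_on_id monoI mult_left_mono)
      finally show ?thesis using K e by (simp add: ennreal_mult ennreal_plus)
    qed
    have "emeasure \<nu> (N \<inter> I) \<le> 0"
    proof (rule ennreal_le_epsilon)
      fix d :: real assume "0 < d"
      then have "emeasure \<nu> (N \<inter> I) \<le> ennreal (d / (K+1) * K + d / (K+1))"
        using K(2) by (intro small) auto
      also have "d / (K+1) * K + d / (K+1) = d / (K+1) * (K+1)" by (simp add: distrib_left)
      also have "\<dots> = d" using K(2) by simp
      finally show "emeasure \<nu> (N \<inter> I) \<le> 0 + ennreal d" by simp
    qed
    then show ?thesis by (simp add: I_def)
  qed
  have "N = (\<Union>R::nat. N \<inter> {-real R<..<real R})"
  proof -
    have "\<exists>R::nat. x \<in> {-real R<..<real R}" for x :: real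
    proof -
      obtain R :: nat where "\<bar>x\<bar> < real R" using reals_Archimedean2 by blast
      then show ?thesis by (intro exI[of _ R]) auto
    qed
    then show ?thesis by blast
  qed
  moreover have "(\<Union>R::nat. N \<inter> {-real R<..<real R}) \<in> null_sets \<nu>"
    using zero by (intro null_sets_UN) (auto simp: sets)
  ultimately show "N \<in> null_sets \<nu>" by metis
qed

section \<open>Local times of processes with small ball bounds\<close>

lemma chain_prod_nth:
  "chain_prod q a ts = (\<Prod>i<length ts. q ((a # ts) ! Suc i - (a # ts) ! i))"
  by (induction ts arbitrary: a) (simp_all add: prod.lessThan_Suc_shift del: prod.lessThan_Suc)

text \<open>What is used of multifractional Brownian motion in the study of its local time.\<close>

locale small_ball_process = prob_space M for M :: "'w measure" +
  fixes X :: "real \<Rightarrow> 'w \<Rightarrow> real" and h C :: real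
  assumes X [measurable]: "(\<lambda>(t, \<omega>). X t \<omega>) \<in> borel_measurable (borel \<Otimes>\<^sub>M M)"
    and h: "0 < h" "h < 1" and C: "0 < C"
    and small_ball: "\<And>j t a b. \<lbrakk>\<And>i. i < j \<Longrightarrow> t i < t (Suc i); 0 \<le> t 0; t j \<le> 1; a < b\<rbrakk> \<Longrightarrow>
       emeasure M {\<omega> \<in> space M. \<forall>i<j. X (t (Suc i)) \<omega> \<in> {a<..<b}}
       \<le> (\<Prod>i<j. ennreal (C * (b - a) * (t (Suc i) - t i) powr (- h)))"
begin

lemma X_time [measurable]: "X t \<in> borel_measurable M"
  using measurable_compose[OF measurable_Pair1'[of t borel M] X] by simp

lemma X_path: "\<omega> \<in> space M \<Longrightarrow> (\<lambda>t. X t \<omega>) \<in> borel_measurable borel"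
  using measurable_compose[OF measurable_Pair2' X] by simp

text \<open>Its integral over times in \<open>A\<close> is the window density at \<open>x\<close> of the occupation measure of \<open>A\<close>.\<close>

definition visit :: "nat \<Rightarrow> real \<Rightarrow> real \<Rightarrow> 'w \<Rightarrow> ennreal" where
  "visit n x s \<omega> = ennreal (real (Suc n)) * indicator {x<..<x + 1 / real (Suc n)} (X s \<omega>)"

definition occ :: "real set \<Rightarrow> 'w \<Rightarrow> real measure" where
  "occ A \<omega> = occupation_measure (\<lambda>t. X t \<omega>) A"

lemma sets_occ [simp, measurable_cong]: "sets (occ A \<omega>) = sets borel"
  by (simp add: occ_def occupation_measure_def)

lemma nn_integral_occ:
  assumes A: "A \<in> sets borel" and \<omega>: "\<omega> \<in> space M" and f: "f \<in> borel_measurable borel"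
  shows "(\<integral>\<^sup>+y. f y \<partial>occ A \<omega>) = (\<integral>\<^sup>+s\<in>A. f (X s \<omega>) \<partial>lborel)"
proof -
  have "(\<lambda>t. X t \<omega>) \<in> borel_measurable (restrict_space lborel A)"
    using X_path[OF \<omega>] by (intro measurable_restrict_space1) simp
  then show ?thesis
    using A f unfolding occ_def occupation_measure_def
    by (simp add: nn_integral_distr nn_integral_restrict_space)
qed

lemma emeasure_occ:
  assumes "A \<in> sets borel" "\<omega> \<in> space M" "S \<in> sets borel"
  shows "emeasure (occ A \<omega>) S = (\<integral>\<^sup>+s\<in>A. indicator S (X s \<omega>) \<partial>lborel)"
  using nn_integral_occ[OF assms(1,2), of "indicator S"] assms(3) by simp

lemma emeasure_occ_mono:
  assumes "A \<in> sets borel" "B \<in> sets borel" "A \<subseteq> B" "\<omega> \<in> space M"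
  shows "emeasure (occ A \<omega>) S \<le> emeasure (occ B \<omega>) S"
proof (cases "S \<in> sets borel")
  case True
  then show ?thesis
    using assms by (auto simp: emeasure_occ indicator_def intro!: nn_integral_mono)
next
  case False
  then show ?thesis by (simp add: emeasure_notin_sets)
qed

lemma finite_measure_occ:
  assumes "A \<in> sets borel" "A \<subseteq> {0..1}" "\<omega> \<in> space M"
  shows "finite_measure (occ A \<omega>)"
proof (rule finite_measureI)
  have "emeasure (occ A \<omega>) UNIV \<le> (\<integral>\<^sup>+s. indicator {0..1::real} s \<partial>lborel)"
    using assms by (auto simp: emeasure_occ indicator_def intro!: nn_integral_mono)
  also have "\<dots> < \<infinity>" by simp
  finally show "emeasure (occ A \<omega>) (space (occ A \<omega>)) \<noteq> \<infinity>"
    using sets_eq_imp_space_eq[OF sets_occ, of A \<omega>] by simp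
qed

lemma window_density_occ:
  assumes A: "A \<in> sets borel" and \<omega>: "\<omega> \<in> space M"
  shows "window_density (occ A \<omega>) n x = (\<integral>\<^sup>+s\<in>A. visit n x s \<omega> \<partial>lborel)"
proof -
  have [measurable]: "(\<lambda>t. X t \<omega>) \<in> borel_measurable borel" by (rule X_path[OF \<omega>])
  have [measurable]: "A \<in> sets borel" by (rule A)
  have "window_density (occ A \<omega>) n x
    = ennreal (real (Suc n)) * (\<integral>\<^sup>+s\<in>A. indicator {x<..<x + 1 / real (Suc n)} (X s \<omega>) \<partial>lborel)"
    using A \<omega> by (simp add: window_density_def emeasure_occ)
  also have "\<dots> = (\<integral>\<^sup>+s. ennreal (real (Suc n)) * (indicator {x<..<x + 1 / real (Suc n)} (X s \<omega>) * indicator A s) \<partial>lborel)"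
    by (rule nn_integral_cmult[symmetric]) measurable
  finally show ?thesis by (simp add: visit_def mult.assoc del: of_nat_Suc)
qed

lemma visit_measurable [measurable]:
  "(\<lambda>(s, \<omega>). visit n x s \<omega>) \<in> borel_measurable (borel \<Otimes>\<^sub>M M)"
  unfolding visit_def by measurable

lemma window_density_occ_measurable:
  assumes A: "A \<in> sets borel"
  shows "(\<lambda>(x, \<omega>). window_density (occ A \<omega>) n x) \<in> borel_measurable (borel \<Otimes>\<^sub>M M)"
proof -
  have [measurable]: "A \<in> sets lborel" "A \<in> sets borel" using A by auto
  have "(\<lambda>(x, \<omega>). \<integral>\<^sup>+s. ennreal (real (Suc n)) * (if x < X s \<omega> \<and> X s \<omega> < x + 1 / real (Suc n) then 1 else 0)
      * indicator A s \<partial>lborel) \<in> borel_measurable (borel \<Otimes>\<^sub>M M)"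
    by measurable
  also have "(\<lambda>(x, \<omega>). \<integral>\<^sup>+s. ennreal (real (Suc n)) * (if x < X s \<omega> \<and> X s \<omega> < x + 1 / real (Suc n) then 1 else 0)
      * indicator A s \<partial>lborel) = (\<lambda>(x, \<omega>). \<integral>\<^sup>+s\<in>A. visit n x s \<omega> \<partial>lborel)"
    by (auto intro!: ext nn_integral_cong simp: visit_def indicator_def)
  finally show ?thesis
    by (rule measurable_cong[THEN iffD1, rotated])
       (auto simp: space_pair_measure window_density_occ[OF A])
qed

definition moment_const :: real where
  "moment_const = exp 1 * C * Gamma (1 - h)"

lemma moment_const_pos: "moment_const > 0"
  unfolding moment_const_def using C h by (intro mult_pos_pos Gamma_real_pos) auto

text \<open>The height \<open>n + 1\<close> of the window indicator cancels its width \<open>1 / (n + 1)\<close>, which makes the bound uniform in \<open>n\<close>.\<close>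

lemma visit_chain_le:
  assumes ts: "sorted_wrt (<) (a # ts)" "set ts \<subseteq> {..b}" and ab: "0 \<le> a" "a \<le> b" "b \<le> 1"
  shows "(\<integral>\<^sup>+\<omega>. (\<Prod>s\<leftarrow>ts. visit n x s \<omega>) \<partial>M) \<le> chain_prod (\<lambda>u. ennreal (C * u powr (- h))) a ts"
proof -
  let ?t = "\<lambda>i. (a # ts) ! i" and ?j = "length ts"
  let ?I = "{x<..<x + 1 / real (Suc n)}" and ?N = "ennreal (real (Suc n))"
  have "(\<Prod>s\<leftarrow>ts. visit n x s \<omega>) = ?N ^ ?j * indicator {\<omega> \<in> space M. \<forall>i<?j. X (?t (Suc i)) \<omega> \<in> ?I} \<omega>"
    if "\<omega> \<in> space M" for \<omega>
  proof -
    have "(\<Prod>s\<leftarrow>ts. visit n x s \<omega>) = (\<Prod>i<?j. ?N * indicator ?I (X (?t (Suc i)) \<omega>))"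
      by (simp add: prod.list_conv_set_nth atLeast0LessThan visit_def)
    also have "\<dots> = ?N ^ ?j * (\<Prod>i<?j. indicator ?I (X (?t (Suc i)) \<omega>))"
      by (simp add: prod.distrib)
    also have "(\<Prod>i<?j. indicator ?I (X (?t (Suc i)) \<omega>)) = (indicator {\<omega> \<in> space M. \<forall>i<?j. X (?t (Suc i)) \<omega> \<in> ?I} \<omega> :: ennreal)"
    proof (cases "\<forall>i<?j. X (?t (Suc i)) \<omega> \<in> ?I")
      case True
      then show ?thesis using that by (simp add: indicator_def)
    next
      case False
      then obtain i where i: "i < ?j" "X (?t (Suc i)) \<omega> \<notin> ?I" by blast
      then have "\<exists>i\<in>{..<?j}. indicator ?I (X (?t (Suc i)) \<omega>) = (0 :: ennreal)"
        by (intro bexI[of _ i]) (simp_all only: indicator_simps lessThan_iff not_False_eq_True)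
      then have "(\<Prod>i<?j. indicator ?I (X (?t (Suc i)) \<omega>)) = (0 :: ennreal)" by (simp add: prod_zero)
      then show ?thesis using False by (simp only: indicator_simps mem_Collect_eq simp_thms)
    qed
    finally show ?thesis .
  qed
  then have "(\<integral>\<^sup>+\<omega>. (\<Prod>s\<leftarrow>ts. visit n x s \<omega>) \<partial>M)
     = (\<integral>\<^sup>+\<omega>. ?N ^ ?j * indicator {\<omega> \<in> space M. \<forall>i<?j. X (?t (Suc i)) \<omega> \<in> ?I} \<omega> \<partial>M)"
    by (intro nn_integral_cong)
  also have "\<dots> = ?N ^ ?j * emeasure M {\<omega> \<in> space M. \<forall>i<?j. X (?t (Suc i)) \<omega> \<in> ?I}"
    by (rule nn_integral_cmult_indicator) measurable
  also have "\<dots> \<le> ?N ^ ?j * (\<Prod>i<?j. ennreal (C * ((x + 1 / real (Suc n)) - x) * (?t (Suc i) - ?t i) powr (- h)))"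
  proof (intro mult_left_mono small_ball)
    show "?t i < ?t (Suc i)" if "i < ?j" for i
      using sorted_wrt_nth_less[OF ts(1), of i "Suc i"] that by simp
    show "?t ?j \<le> 1" using ts(2) ab nth_mem[of "?j - 1" ts] by (cases ts) (auto simp: subset_iff)
  qed (use ab in auto)
  also have "\<dots> = (\<Prod>i<?j. ?N * ennreal (C * ((x + 1 / real (Suc n)) - x) * (?t (Suc i) - ?t i) powr (- h)))"
    by (simp add: prod.distrib)
  also have "\<dots> = (\<Prod>i<?j. ennreal (C * (?t (Suc i) - ?t i) powr (- h)))"
  proof (intro prod.cong refl)
    fix i
    let ?y = "(?t (Suc i) - ?t i) powr (- h)"
    have "real (Suc n) * (C * ((x + 1 / real (Suc n)) - x) * ?y) = C * ?y"
      by (simp add: field_simps del: of_nat_Suc)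
    then show "?N * ennreal (C * ((x + 1 / real (Suc n)) - x) * ?y) = ennreal (C * ?y)"
      by (simp only: ennreal_mult'[OF of_nat_0_le_iff, symmetric])
  qed
  also have "\<dots> = chain_prod (\<lambda>u. ennreal (C * u powr (- h))) a ts"
    by (simp add: chain_prod_nth)
  finally show ?thesis .
qed

lemma window_density_moment_le:
  assumes a: "0 \<le> a" "a < b" "b \<le> 1" and m: "m > 0"
  shows "(\<integral>\<^sup>+\<omega>. (window_density (occ {a..b} \<omega>) n x) ^ m \<partial>M)
    \<le> ennreal ((moment_const * real m powr h * (b - a) powr (1 - h)) ^ m)"
proof -
  have "window_density (occ {a..b} \<omega>) n x = (\<integral>\<^sup>+s\<in>{a<..<b}. visit n x s \<omega> \<partial>lborel)"
    if "\<omega> \<in> space M" for \<omega>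
  proof -
    have "AE s in lborel. s \<noteq> a \<and> s \<noteq> b"
      using AE_lborel_singleton[of a] AE_lborel_singleton[of b] by auto
    then have "(\<integral>\<^sup>+s\<in>{a..b}. visit n x s \<omega> \<partial>lborel) = (\<integral>\<^sup>+s\<in>{a<..<b}. visit n x s \<omega> \<partial>lborel)"
      by (intro nn_integral_cong_AE, elim eventually_mono) (auto simp: indicator_def)
    then show ?thesis using that by (simp add: window_density_occ)
  qed
  then have "(\<integral>\<^sup>+\<omega>. (window_density (occ {a..b} \<omega>) n x) ^ m \<partial>M)
     = (\<integral>\<^sup>+\<omega>. (\<integral>\<^sup>+s\<in>{a<..<b}. visit n x s \<omega> \<partial>lborel) ^ m \<partial>M)"
    by (intro nn_integral_cong) simp
  also have "\<dots> \<le> ennreal ((moment_const * real m powr h * (b - a) powr (1 - h)) ^ m)"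
    unfolding moment_const_def
    by (rule moment_le_of_powr_chain[OF visit_measurable h(2) less_imp_le[OF C] visit_chain_le a(2) m])
       (use a in auto)
  finally show ?thesis .
qed

text \<open>The second moments of the window densities are bounded uniformly in \<open>n\<close> and in the level. Integrated over a
  bounded range of levels, Fatou's lemma makes the lower limit of their square integrals almost surely finite.\<close>

lemma absolutely_continuous_occ:
  "AE \<omega> in M. absolutely_continuous lborel (occ {0..1} \<omega>)"
proof -
  let ?w = "\<lambda>n x \<omega>. window_density (occ {0..1} \<omega>) n x"
  note [measurable] = window_density_occ_measurable[of "{0..1}"]
  interpret P: pair_sigma_finite lborel M ..
  define K where "K = (moment_const * real 2 powr h * (1 - 0) powr (1 - h)) ^ 2"
  have "AE \<omega> in M. \<forall>R::nat. liminf (\<lambda>n. \<integral>\<^sup>+x\<in>{-real R<..<real R}. (?w n x \<omega>)\<^sup>2 \<partial>lborel) \<noteq> \<infinity>"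
    unfolding AE_all_countable
  proof
    fix R :: nat
    let ?I = "{-real R<..<real R}"
    have meas [measurable]: "(\<lambda>\<omega>. \<integral>\<^sup>+x\<in>?I. (?w n x \<omega>)\<^sup>2 \<partial>lborel) \<in> borel_measurable M" for n
      by measurable
    have "(\<integral>\<^sup>+\<omega>. liminf (\<lambda>n. \<integral>\<^sup>+x\<in>?I. (?w n x \<omega>)\<^sup>2 \<partial>lborel) \<partial>M)
      \<le> liminf (\<lambda>n. \<integral>\<^sup>+\<omega>. (\<integral>\<^sup>+x\<in>?I. (?w n x \<omega>)\<^sup>2 \<partial>lborel) \<partial>M)"
      by (rule nn_integral_liminf) (rule meas)
    also have "\<dots> \<le> liminf (\<lambda>n::nat. ennreal K * emeasure lborel ?I)"
    proof (intro Liminf_mono always_eventually allI)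
      fix n
      have "(\<integral>\<^sup>+\<omega>. (\<integral>\<^sup>+x\<in>?I. (?w n x \<omega>)\<^sup>2 \<partial>lborel) \<partial>M) = (\<integral>\<^sup>+x. (\<integral>\<^sup>+\<omega>. (?w n x \<omega>)\<^sup>2 * indicator ?I x \<partial>M) \<partial>lborel)"
        by (rule P.Fubini') measurable
      also have "\<dots> \<le> (\<integral>\<^sup>+x. ennreal K * indicator ?I x \<partial>lborel)"
      proof (rule nn_integral_mono)
        fix x
        have [measurable]: "(\<lambda>\<omega>. ?w n x \<omega>) \<in> borel_measurable M"
          using measurable_compose[OF measurable_Pair1'[of x borel M] window_density_occ_measurable[of "{0..1}" n]] by simp
        have "(\<integral>\<^sup>+\<omega>. (?w n x \<omega>)\<^sup>2 * indicator ?I x \<partial>M) = (\<integral>\<^sup>+\<omega>. (?w n x \<omega>)\<^sup>2 \<partial>M) * indicator ?I x"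
          by (rule nn_integral_multc) measurable
        also have "\<dots> \<le> ennreal K * indicator ?I x"
          unfolding K_def by (intro mult_right_mono window_density_moment_le) auto
        finally show "(\<integral>\<^sup>+\<omega>. (?w n x \<omega>)\<^sup>2 * indicator ?I x \<partial>M) \<le> ennreal K * indicator ?I x" .
      qed
      also have "\<dots> = ennreal K * emeasure lborel ?I" by (rule nn_integral_cmult_indicator) simp
      finally show "(\<integral>\<^sup>+\<omega>. (\<integral>\<^sup>+x\<in>?I. (?w n x \<omega>)\<^sup>2 \<partial>lborel) \<partial>M) \<le> ennreal K * emeasure lborel ?I" .
    qed
    also have "\<dots> < \<infinity>"
      by (simp add: Liminf_const ennreal_mult_less_top)
    finally have "(\<integral>\<^sup>+\<omega>. liminf (\<lambda>n. \<integral>\<^sup>+x\<in>?I. (?w n x \<omega>)\<^sup>2 \<partial>lborel) \<partial>M) \<noteq> \<infinity>" by simp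
    then show "AE \<omega> in M. liminf (\<lambda>n. \<integral>\<^sup>+x\<in>?I. (?w n x \<omega>)\<^sup>2 \<partial>lborel) \<noteq> \<infinity>"
      by (intro nn_integral_PInf_AE) measurable
  qed
  then show ?thesis
    using AE_space
  proof eventually_elim
    case (elim \<omega>)
    then show ?case
      by (intro absolutely_continuous_of_window_density_square finite_measure_occ sets_occ)
         (auto simp: less_top)
  qed
qed

definition dyadic_interval :: "nat \<Rightarrow> nat \<Rightarrow> real set" where
  "dyadic_interval p k = {real k / 2 ^ p..real (Suc k) / 2 ^ p}"

lemma dyadic_interval_sets [simp]: "dyadic_interval p k \<in> sets borel"
  by (simp add: dyadic_interval_def)

lemma dyadic_interval_subset: "k < 2 ^ p \<Longrightarrow> dyadic_interval p k \<subseteq> {0..1}"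
proof -
  assume "k < 2 ^ p"
  then have "real (Suc k) \<le> 2 ^ p"
    by (metis Suc_leI of_nat_le_iff of_nat_numeral of_nat_power)
  then have "real (Suc k) / 2 ^ p \<le> 1" by (simp add: divide_le_eq)
  then show ?thesis by (auto simp: dyadic_interval_def intro: order.trans[rotated])
qed

text \<open>The levels at which the densities of all dyadic time intervals exist as finite limits. Countably many
  conditions keep this measurable and almost everywhere true, and dyadic intervals are fine enough to
  control all increments of the local time.\<close>

definition regular_level :: "real \<Rightarrow> 'w \<Rightarrow> bool" where
  "regular_level x \<omega> \<longleftrightarrow> (\<forall>p. \<forall>k<2 ^ p.
     liminf (\<lambda>n. window_density (occ (dyadic_interval p k) \<omega>) n x)
       = limsup (\<lambda>n. window_density (occ (dyadic_interval p k) \<omega>) n x) \<and>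
     limsup (\<lambda>n. window_density (occ (dyadic_interval p k) \<omega>) n x) < \<infinity>)"

text \<open>A version defined at every single level. Without the restriction to regular levels, lower limits would not be
  additive in the time set, and an increment need not be bounded by the local time of an interval
  that contains it.\<close>

definition level_local_time :: "real set \<Rightarrow> real \<Rightarrow> 'w \<Rightarrow> real" where
  "level_local_time A x \<omega> =
    (if regular_level x \<omega> then enn2real (liminf (\<lambda>n. window_density (occ A \<omega>) n x)) else 0)"

lemma level_local_time_nonneg [simp]: "0 \<le> level_local_time A x \<omega>"
  by (simp add: level_local_time_def)

lemma level_local_time_measurable:
  assumes A: "A \<in> sets borel"
  shows "(\<lambda>(x, \<omega>). level_local_time A x \<omega>) \<in> borel_measurable (borel \<Otimes>\<^sub>M M)"
proof -
  note [measurable] = window_density_occ_measurable[OF A] window_density_occ_measurable[OF dyadic_interval_sets]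
  have [measurable]: "Measurable.pred (borel \<Otimes>\<^sub>M M) (\<lambda>z. regular_level (fst z) (snd z))"
    unfolding regular_level_def by measurable
  have "(\<lambda>z. if regular_level (fst z) (snd z) then enn2real (liminf (\<lambda>n. window_density (occ A (snd z)) n (fst z))) else 0)
    \<in> borel_measurable (borel \<Otimes>\<^sub>M M)"
    by measurable
  then show ?thesis
    by (simp add: level_local_time_def split_beta')
qed

lemma level_local_time_measurable_at [measurable]:
  assumes A: "A \<in> sets borel"
  shows "level_local_time A x \<in> borel_measurable M"
  using measurable_compose[OF measurable_Pair1'[of x borel M] level_local_time_measurable[OF A]] by simp

lemma occ_eq_density:
  assumes ac: "absolutely_continuous lborel (occ {0..1} \<omega>)" and \<omega>: "\<omega> \<in> space M"
    and A: "A \<in> sets borel" "A \<subseteq> {0..1}"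
  obtains g where "g \<in> borel_measurable borel" "occ A \<omega> = density lborel g"
    "(\<integral>\<^sup>+x. g x \<partial>lborel) < \<infinity>"
    "AE x in lborel. (\<lambda>n. window_density (occ A \<omega>) n x) \<longlonglongrightarrow> g x"
proof -
  have acA: "absolutely_continuous lborel (occ A \<omega>)"
    unfolding absolutely_continuous_def
  proof
    fix N :: "real set" assume N: "N \<in> null_sets lborel"
    then have "emeasure (occ {0..1} \<omega>) N = 0"
      using ac by (auto simp: absolutely_continuous_def)
    then have "emeasure (occ A \<omega>) N = 0"
      using emeasure_occ_mono[of A "{0..1}" \<omega> N] A \<omega> by simp
    then show "N \<in> null_sets (occ A \<omega>)" using N by (auto simp: null_sets_def)
  qed
  have "\<exists>g\<in>borel_measurable lborel. density lborel g = occ A \<omega>"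
    by (rule sigma_finite_measure.Radon_Nikodym[OF lborel.sigma_finite_measure_axioms acA]) simp
  then obtain g where g: "g \<in> borel_measurable borel" "density lborel g = occ A \<omega>"
    by auto
  have "(\<integral>\<^sup>+x. g x \<partial>lborel) = emeasure (density lborel g) UNIV"
    using g(1) by (simp add: emeasure_density)
  also have "\<dots> = emeasure (occ A \<omega>) (space (occ A \<omega>))"
    using g(2) sets_eq_imp_space_eq[OF sets_occ, of A \<omega>] by simp
  also have "\<dots> < \<infinity>"
    using finite_measure.emeasure_finite[OF finite_measure_occ[OF A \<omega>]] by (simp add: less_top)
  finally have fin: "(\<integral>\<^sup>+x. g x \<partial>lborel) < \<infinity>" .
  show ?thesis
    using that[OF g(1) g(2)[symmetric] fin] window_density_tendsto[OF g(1) fin] g(2) by simp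
qed

text \<open>By Lebesgue's differentiation theorem almost every level is regular, and the window densities of \<open>A\<close> converge to
  the Radon-Nikodym derivative almost everywhere. The exceptional set of levels may depend on \<open>A\<close>, but the condition
  on \<open>\<omega>\<close> does not.\<close>

lemma occ_eq_density_level_local_time:
  assumes ac: "absolutely_continuous lborel (occ {0..1} \<omega>)" and \<omega>: "\<omega> \<in> space M"
    and A: "A \<in> sets borel" "A \<subseteq> {0..1}"
  shows "occ A \<omega> = density lborel (\<lambda>x. ennreal (level_local_time A x \<omega>))"
proof -
  have "AE x in lborel. \<forall>p k. k < 2 ^ p \<longrightarrow>
    liminf (\<lambda>n. window_density (occ (dyadic_interval p k) \<omega>) n x)
       = limsup (\<lambda>n. window_density (occ (dyadic_interval p k) \<omega>) n x) \<and>
     limsup (\<lambda>n. window_density (occ (dyadic_interval p k) \<omega>) n x) < \<infinity>"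
    unfolding AE_all_countable
  proof (intro allI)
    fix p k :: nat
    show "AE x in lborel. k < 2 ^ p \<longrightarrow>
      liminf (\<lambda>n. window_density (occ (dyadic_interval p k) \<omega>) n x)
       = limsup (\<lambda>n. window_density (occ (dyadic_interval p k) \<omega>) n x) \<and>
       limsup (\<lambda>n. window_density (occ (dyadic_interval p k) \<omega>) n x) < \<infinity>"
    proof (cases "k < 2 ^ p")
      case True
      obtain g where g: "g \<in> borel_measurable borel" "(\<integral>\<^sup>+x. g x \<partial>lborel) < \<infinity>"
        and lim: "AE x in lborel. (\<lambda>n. window_density (occ (dyadic_interval p k) \<omega>) n x) \<longlonglongrightarrow> g x"
        using occ_eq_density[OF ac \<omega> dyadic_interval_sets dyadic_interval_subset[OF True]] by metis
      have "AE x in lborel. g x \<noteq> \<infinity>"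
        using g by (intro nn_integral_PInf_AE) auto
      then show ?thesis using lim
      proof eventually_elim
        case (elim x)
        then show ?case
          using lim_imp_Liminf[OF sequentially_bot elim(2)] lim_imp_Limsup[OF sequentially_bot elim(2)]
          by (simp add: less_top)
      qed
    qed simp
  qed
  then have reg: "AE x in lborel. regular_level x \<omega>"
    by eventually_elim (auto simp: regular_level_def)
  obtain g where g: "g \<in> borel_measurable borel" "occ A \<omega> = density lborel g" "(\<integral>\<^sup>+x. g x \<partial>lborel) < \<infinity>"
    and lim: "AE x in lborel. (\<lambda>n. window_density (occ A \<omega>) n x) \<longlonglongrightarrow> g x"
    using occ_eq_density[OF ac \<omega> A] by metis
  have "AE x in lborel. g x \<noteq> \<infinity>"
    using g by (intro nn_integral_PInf_AE) auto
  then have eq: "AE x in lborel. g x = ennreal (level_local_time A x \<omega>)"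
    using reg lim
  proof eventually_elim
    case (elim x)
    then show ?case
      using lim_imp_Liminf[OF sequentially_bot elim(3)] by (simp add: level_local_time_def less_top)
  qed
  have meas: "(\<lambda>x. ennreal (level_local_time A x \<omega>)) \<in> borel_measurable lborel"
    using measurable_compose[OF measurable_Pair2'[OF \<omega>] level_local_time_measurable[OF A(1)]] by simp
  show ?thesis unfolding g(2)
    using eq g(1) meas by (intro density_cong) auto
qed

theorem local_time_level_local_time: "local_time M X level_local_time"
  unfolding local_time_def
proof (intro conjI ballI impI allI)
  show "AE \<omega> in M. \<forall>A\<in>sets borel. A \<subseteq> {0..1} \<longrightarrow>
        absolutely_continuous lborel (occupation_measure (\<lambda>t. X t \<omega>) A) \<and>
        occupation_measure (\<lambda>t. X t \<omega>) A = density lborel (\<lambda>x. ennreal (level_local_time A x \<omega>)) \<and>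
        (\<forall>f :: real \<Rightarrow> ennreal. f \<in> borel_measurable borel \<longrightarrow>
           (\<integral>\<^sup>+t\<in>A. f (X t \<omega>) \<partial>lborel) = (\<integral>\<^sup>+x. f x * ennreal (level_local_time A x \<omega>) \<partial>lborel))"
    using absolutely_continuous_occ AE_space
  proof eventually_elim
    case (elim \<omega>)
    show ?case
    proof (intro ballI impI)
      fix A :: "real set" assume A: "A \<in> sets borel" "A \<subseteq> {0..1}"
      have dens: "occ A \<omega> = density lborel (\<lambda>x. ennreal (level_local_time A x \<omega>))"
        by (rule occ_eq_density_level_local_time[OF elim A])
      have meas: "(\<lambda>x. ennreal (level_local_time A x \<omega>)) \<in> borel_measurable lborel"
        using measurable_compose[OF measurable_Pair2'[OF elim(2)] level_local_time_measurable[OF A(1)]] by simp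
      have "absolutely_continuous lborel (occ A \<omega>)"
        unfolding dens by (rule absolutely_continuousI_density[OF meas])
      moreover have "(\<integral>\<^sup>+t\<in>A. f (X t \<omega>) \<partial>lborel) = (\<integral>\<^sup>+x. f x * ennreal (level_local_time A x \<omega>) \<partial>lborel)"
        if f: "f \<in> borel_measurable borel" for f :: "real \<Rightarrow> ennreal"
      proof -
        have "(\<integral>\<^sup>+t\<in>A. f (X t \<omega>) \<partial>lborel) = (\<integral>\<^sup>+y. f y \<partial>occ A \<omega>)"
          by (rule nn_integral_occ[OF A(1) elim(2) f, symmetric])
        also have "\<dots> = (\<integral>\<^sup>+x. ennreal (level_local_time A x \<omega>) * f x \<partial>lborel)"
          unfolding dens using meas f by (intro nn_integral_density) auto
        finally show ?thesis by (simp add: mult.commute)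
      qed
      ultimately show "absolutely_continuous lborel (occupation_measure (\<lambda>t. X t \<omega>) A) \<and>
        occupation_measure (\<lambda>t. X t \<omega>) A = density lborel (\<lambda>x. ennreal (level_local_time A x \<omega>)) \<and>
        (\<forall>f :: real \<Rightarrow> ennreal. f \<in> borel_measurable borel \<longrightarrow>
           (\<integral>\<^sup>+t\<in>A. f (X t \<omega>) \<partial>lborel) = (\<integral>\<^sup>+x. f x * ennreal (level_local_time A x \<omega>) \<partial>lborel))"
        using dens by (simp add: occ_def)
    qed
  qed
qed (simp_all add: level_local_time_measurable)

end

lemma liminf_add_le_ennreal:
  fixes u v :: "nat \<Rightarrow> ennreal"
  assumes v: "limsup v < \<infinity>"
  shows "liminf (\<lambda>n. u n + v n) \<le> liminf u + limsup v"
proof (rule ennreal_le_epsilon)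
  fix e :: real assume e: "0 < e"
  obtain a where a: "limsup v = ennreal a" "a \<ge> 0"
    using v by (cases "limsup v" rule: ennreal_cases) auto
  have "limsup v < limsup v + ennreal e"
    using a e by (simp add: ennreal_plus[symmetric] ennreal_lessI del: ennreal_plus)
  then have "\<forall>\<^sub>F n in sequentially. v n < limsup v + ennreal e"
    by (rule Limsup_lessD)
  then have "liminf (\<lambda>n. u n + v n) \<le> liminf (\<lambda>n. u n + (limsup v + ennreal e))"
    by (intro Liminf_mono) (auto elim!: eventually_mono intro!: add_left_mono)
  also have "\<dots> = liminf u + (limsup v + ennreal e)"
    by (rule Liminf_add_const) simp
  finally show "liminf (\<lambda>n. u n + v n) \<le> liminf u + limsup v + ennreal e"
    by (simp add: add.assoc)
qed

lemma tendsto_power_ennreal: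
  fixes u :: "'a \<Rightarrow> ennreal"
  assumes "(u \<longlongrightarrow> a) F" "a < \<infinity>"
  shows "((\<lambda>n. u n ^ p) \<longlongrightarrow> a ^ p) F"
proof (induction p)
  case (Suc p)
  then show ?case
    using assms unfolding power_Suc by (intro tendsto_mult_ennreal) (auto simp: power_eq_top_ennreal)
qed simp

text \<open>The supremum decreases with \<open>\<eta>\<close>, so the limit in the definition exists and is the infimum.\<close>

lemma increment_limsup_le:
  assumes "0 < \<eta>" and bd: "\<And>s t. \<lbrakk>s \<in> {0..1}; t \<in> {0..1}; 0 < \<bar>t - s\<bar>; \<bar>t - s\<bar> \<le> \<eta>\<rbrakk> \<Longrightarrow> q s t \<le> c"
  shows "increment_limsup q \<le> ereal c"
proof -
  let ?S = "\<lambda>\<eta>::real. {(s, t). s \<in> {0..1::real} \<and> t \<in> {0..1} \<and> 0 < \<bar>t - s\<bar> \<and> \<bar>t - s\<bar> \<le> \<eta>}"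
  let ?F = "\<lambda>\<eta>. SUP (s, t)\<in>?S \<eta>. ereal (q s t)"
  have mono: "?F x \<le> ?F y" if "x \<le> y" for x y
    using that by (intro SUP_subset_mono) auto
  have "(?F \<longlongrightarrow> (INF x\<in>{0<..}. ?F x)) (at_right 0)"
  proof (rule order_tendstoI)
    fix y assume "y < (INF x\<in>{0<..}. ?F x)"
    then have "y < ?F x" if "x > 0" for x
      using that by (meson INF_lower greaterThan_iff less_le_trans)
    then show "\<forall>\<^sub>F x in at_right 0. y < ?F x"
      by (auto simp: eventually_at_right_field intro!: exI[of _ 1])
  next
    fix y assume "(INF x\<in>{0<..}. ?F x) < y"
    then obtain x0 where x0: "x0 > 0" "?F x0 < y" by (auto simp: INF_less_iff)
    have "?F x < y" if "x < x0" for x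
      using mono[of x x0] x0 that by (meson le_less_trans less_imp_le)
    then show "\<forall>\<^sub>F x in at_right 0. ?F x < y"
      using x0(1) by (auto simp: eventually_at_right_field intro!: exI[of _ x0])
  qed
  then have "increment_limsup q = (INF x\<in>{0<..}. ?F x)"
    unfolding increment_limsup_def by (intro tendsto_Lim) simp
  also have "\<dots> \<le> ?F \<eta>" using assms(1) by (intro INF_lower) simp
  also have "\<dots> \<le> ereal c" using bd by (intro SUP_least) auto
  finally show ?thesis .
qed

context small_ball_process
begin

text \<open>At a regular level the window densities of both dyadic intervals converge, so they may be pulled out of the
  lower limit for \<open>[0, t]\<close>.\<close>

lemma level_local_time_increment_le:
  assumes st: "0 \<le> s" "s < t" "t \<le> 1" and J: "k < 2 ^ p" "k' < 2 ^ p"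
    and cover: "{s..t} \<subseteq> dyadic_interval p k \<union> dyadic_interval p k'" and \<omega>: "\<omega> \<in> space M"
  shows "\<bar>level_local_time {0..t} x \<omega> - level_local_time {0..s} x \<omega>\<bar>
    \<le> level_local_time (dyadic_interval p k) x \<omega> + level_local_time (dyadic_interval p k') x \<omega>"
proof (cases "regular_level x \<omega>")
  case reg: True
  let ?w = "\<lambda>A n. window_density (occ A \<omega>) n x"
  have J_reg: "liminf (?w (dyadic_interval p k)) = limsup (?w (dyadic_interval p k))"
     "limsup (?w (dyadic_interval p k)) < \<infinity>" if "k < 2 ^ p" for p k
    using reg that by (auto simp: regular_level_def)
  have mono: "?w A n \<le> ?w B n" if "A \<subseteq> B" "A \<in> sets borel" "B \<in> sets borel" for A B n
    unfolding window_density_def using that \<omega> by (intro mult_left_mono emeasure_occ_mono) auto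
  have unit: "dyadic_interval 0 0 = {0..1}" by (simp add: dyadic_interval_def)
  have fin: "liminf (?w {0..r}) < \<infinity>" if "r \<le> 1" for r
  proof -
    have "liminf (?w {0..r}) \<le> liminf (?w {0..1})"
      using that by (intro Liminf_mono always_eventually allI mono) auto
    also have "\<dots> < \<infinity>" using J_reg[of 0 0] by (simp add: unit)
    finally show ?thesis .
  qed
  have le: "liminf (?w {0..s}) \<le> liminf (?w {0..t})"
    using st by (intro Liminf_mono always_eventually allI mono) auto
  let ?a = "limsup (?w (dyadic_interval p k))" and ?b = "limsup (?w (dyadic_interval p k'))"
  have split: "?w {0..t} n \<le> (?w {0..s} n + ?w (dyadic_interval p k) n) + ?w (dyadic_interval p k') n" for n
  proof -
    have [measurable]: "(\<lambda>s. visit n x s \<omega>) \<in> borel_measurable borel"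
      using measurable_compose[OF measurable_Pair2'[OF \<omega>] visit_measurable[of n x]] by simp
    have [measurable]: "dyadic_interval p k \<in> sets lborel" "dyadic_interval p k' \<in> sets lborel" by auto
    have "{0..t} \<subseteq> {0..s} \<union> {s..t}" by auto
    then have "{0..t} \<subseteq> {0..s} \<union> dyadic_interval p k \<union> dyadic_interval p k'" using cover by blast
    then have "?w {0..t} n \<le> (\<integral>\<^sup>+r. visit n x r \<omega> * indicator {0..s} r + visit n x r \<omega> * indicator (dyadic_interval p k) r
       + visit n x r \<omega> * indicator (dyadic_interval p k') r \<partial>lborel)"
      using \<omega> by (subst window_density_occ) (auto simp: indicator_def subset_iff intro!: nn_integral_mono)
    also have "\<dots> = (?w {0..s} n + ?w (dyadic_interval p k) n) + ?w (dyadic_interval p k') n"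
      using \<omega> by (simp add: nn_integral_add window_density_occ)
    finally show ?thesis .
  qed
  have "liminf (?w {0..t}) \<le> liminf (\<lambda>n. (?w {0..s} n + ?w (dyadic_interval p k) n) + ?w (dyadic_interval p k') n)"
    by (intro Liminf_mono always_eventually allI split)
  also have "\<dots> \<le> liminf (\<lambda>n. ?w {0..s} n + ?w (dyadic_interval p k) n) + ?b"
    by (intro liminf_add_le_ennreal J_reg J)
  also have "\<dots> \<le> (liminf (?w {0..s}) + ?a) + ?b"
    by (intro add_right_mono liminf_add_le_ennreal J_reg J)
  finally have "liminf (?w {0..t}) \<le> liminf (?w {0..s}) + ?a + ?b" .
  then have "enn2real (liminf (?w {0..t})) \<le> enn2real (liminf (?w {0..s}) + ?a + ?b)"
    using fin[of s] J_reg(2)[OF J(1)] J_reg(2)[OF J(2)] st by (intro enn2real_mono) auto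
  also have "\<dots> = enn2real (liminf (?w {0..s})) + enn2real ?a + enn2real ?b"
    using fin[of s] J_reg(2)[OF J(1)] J_reg(2)[OF J(2)] st by (simp add: enn2real_plus)
  finally have "enn2real (liminf (?w {0..t})) \<le> enn2real (liminf (?w {0..s})) + enn2real ?a + enn2real ?b" .
  moreover have "enn2real (liminf (?w {0..s})) \<le> enn2real (liminf (?w {0..t}))"
    using le fin[of t] st by (intro enn2real_mono) auto
  ultimately show ?thesis
    using reg J_reg(1)[OF J(1)] J_reg(1)[OF J(2)] by (simp add: level_local_time_def)
qed (simp add: level_local_time_def)

text \<open>Fatou's lemma transfers the moment bound to a fixed level. The order of the moment is the dyadic level \<open>p\<close>
  of the interval.\<close>

lemma level_local_time_moment_le:
  assumes k: "k < 2 ^ p" and p: "p > 0"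
  shows "(\<integral>\<^sup>+\<omega>. ennreal (level_local_time (dyadic_interval p k) x \<omega>) ^ p \<partial>M)
    \<le> ennreal ((moment_const * real p powr h * (1 / 2 ^ p) powr (1 - h)) ^ p)"
proof -
  let ?J = "dyadic_interval p k"
  let ?w = "\<lambda>n \<omega>. window_density (occ ?J \<omega>) n x"
  have meas: "?w n \<in> borel_measurable M" for n
    using measurable_compose[OF measurable_Pair1'[of x borel M] window_density_occ_measurable[of ?J n]] by simp
  have "(\<integral>\<^sup>+\<omega>. ennreal (level_local_time ?J x \<omega>) ^ p \<partial>M) \<le> (\<integral>\<^sup>+\<omega>. liminf (\<lambda>n. ?w n \<omega> ^ p) \<partial>M)"
  proof (rule nn_integral_mono)
    fix \<omega>
    show "ennreal (level_local_time ?J x \<omega>) ^ p \<le> liminf (\<lambda>n. ?w n \<omega> ^ p)"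
    proof (cases "regular_level x \<omega>")
      case True
      then have eq: "liminf (\<lambda>n. ?w n \<omega>) = limsup (\<lambda>n. ?w n \<omega>)" and fin: "limsup (\<lambda>n. ?w n \<omega>) < \<infinity>"
        using k by (auto simp: regular_level_def)
      have "(\<lambda>n. ?w n \<omega>) \<longlonglongrightarrow> liminf (\<lambda>n. ?w n \<omega>)"
        using eq by (intro Liminf_eq_Limsup) auto
      then have "(\<lambda>n. ?w n \<omega> ^ p) \<longlonglongrightarrow> liminf (\<lambda>n. ?w n \<omega>) ^ p"
        using fin eq by (intro tendsto_power_ennreal) auto
      then have "liminf (\<lambda>n. ?w n \<omega> ^ p) = liminf (\<lambda>n. ?w n \<omega>) ^ p"
        by (rule lim_imp_Liminf[OF sequentially_bot])
      moreover have "ennreal (level_local_time ?J x \<omega>) = liminf (\<lambda>n. ?w n \<omega>)"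
        using True eq fin by (simp add: level_local_time_def)
      ultimately show ?thesis by simp
    next
      case False
      then show ?thesis using p by (simp add: level_local_time_def power_0_left)
    qed
  qed
  also have "\<dots> \<le> liminf (\<lambda>n. \<integral>\<^sup>+\<omega>. ?w n \<omega> ^ p \<partial>M)"
  proof (rule nn_integral_liminf)
    fix n
    note meas[of n, measurable]
    show "(\<lambda>\<omega>. ?w n \<omega> ^ p) \<in> borel_measurable M" by measurable
  qed
  also have "\<dots> \<le> liminf (\<lambda>n::nat. ennreal ((moment_const * real p powr h * (1 / 2 ^ p) powr (1 - h)) ^ p))"
  proof (intro Liminf_mono always_eventually allI)
    fix n
    have "real (Suc k) / 2 ^ p \<le> 1"
      using dyadic_interval_subset[OF k] by (auto simp: dyadic_interval_def divide_right_mono)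
    moreover have len: "real (Suc k) / 2 ^ p - real k / 2 ^ p = 1 / 2 ^ p"
      by (simp add: diff_divide_distrib[symmetric])
    moreover have "real k / 2 ^ p < real (Suc k) / 2 ^ p" by (simp add: divide_strict_right_mono)
    ultimately show "(\<integral>\<^sup>+\<omega>. ?w n \<omega> ^ p \<partial>M) \<le> ennreal ((moment_const * real p powr h * (1 / 2 ^ p) powr (1 - h)) ^ p)"
      using window_density_moment_le[of "real k / 2 ^ p" "real (Suc k) / 2 ^ p" p n x] p
      unfolding dyadic_interval_def len by simp
  qed
  also have "\<dots> = ennreal ((moment_const * real p powr h * (1 / 2 ^ p) powr (1 - h)) ^ p)"
    by (simp add: Liminf_const)
  finally show ?thesis .
qed

definition dyadic_bound :: "nat \<Rightarrow> real" where
  "dyadic_bound p = 4 * moment_const * real p powr h * (1 / 2 ^ p) powr (1 - h)"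

text \<open>The factor \<open>4\<close> in \<^const>\<open>dyadic_bound\<close> beats the number \<open>2 ^ p\<close> of dyadic intervals of level \<open>p\<close>.\<close>

lemma prob_level_local_time_large:
  assumes k: "k < 2 ^ p" and p: "p > 0"
  shows "emeasure M {\<omega> \<in> space M. dyadic_bound p \<le> level_local_time (dyadic_interval p k) x \<omega>}
    \<le> ennreal (1 / 4 ^ p)"
proof -
  let ?l = "level_local_time (dyadic_interval p k) x"
  let ?c = "moment_const * real p powr h * (1 / 2 ^ p) powr (1 - h)"
  have [measurable]: "?l \<in> borel_measurable M"
    by (rule level_local_time_measurable_at[OF dyadic_interval_sets])
  have c: "?c > 0" using moment_const_pos p by (intro mult_pos_pos) auto
  have b: "dyadic_bound p = 4 * ?c" by (simp add: dyadic_bound_def)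
  have "{\<omega> \<in> space M. dyadic_bound p \<le> ?l \<omega>} \<subseteq> {\<omega> \<in> space M. 1 \<le> ennreal (1 / (4 * ?c) ^ p) * ennreal (?l \<omega>) ^ p}"
  proof (rule Collect_mono, safe)
    fix \<omega> assume "dyadic_bound p \<le> ?l \<omega>"
    then have "(4 * ?c) ^ p \<le> ?l \<omega> ^ p" unfolding b using c by (intro power_mono) auto
    then have "1 \<le> 1 / (4 * ?c) ^ p * ?l \<omega> ^ p"
      using c by (simp add: le_divide_eq)
    then have "ennreal 1 \<le> ennreal (1 / (4 * ?c) ^ p * ?l \<omega> ^ p)" by (rule ennreal_leI)
    also have "\<dots> = ennreal (1 / (4 * ?c) ^ p) * ennreal (?l \<omega>) ^ p"
      using c by (subst ennreal_mult) (auto simp: ennreal_power)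
    finally show "1 \<le> ennreal (1 / (4 * ?c) ^ p) * ennreal (?l \<omega>) ^ p" by simp
  qed
  then have "emeasure M {\<omega> \<in> space M. dyadic_bound p \<le> ?l \<omega>}
    \<le> emeasure M {\<omega> \<in> space M. 1 \<le> ennreal (1 / (4 * ?c) ^ p) * ennreal (?l \<omega>) ^ p}"
    by (intro emeasure_mono) auto
  also have "\<dots> \<le> ennreal (1 / (4 * ?c) ^ p) * (\<integral>\<^sup>+\<omega>. ennreal (?l \<omega>) ^ p * indicator (space M) \<omega> \<partial>M)"
    by (rule order.trans[OF _ nn_integral_Markov_inequality]) (auto intro!: emeasure_mono)
  also have "\<dots> = ennreal (1 / (4 * ?c) ^ p) * (\<integral>\<^sup>+\<omega>. ennreal (?l \<omega>) ^ p \<partial>M)"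
    by (intro arg_cong2[where f="(*)"] nn_integral_cong) auto
  also have "\<dots> \<le> ennreal (1 / (4 * ?c) ^ p) * ennreal (?c ^ p)"
    by (intro mult_left_mono level_local_time_moment_le[OF k p]) simp
  also have "\<dots> = ennreal (1 / (4 * ?c) ^ p * ?c ^ p)"
    using c by (subst ennreal_mult) auto
  also have "1 / (4 * ?c) ^ p * ?c ^ p = 1 / 4 ^ p"
  proof -
    have "1 / (4 * c) ^ p * c ^ p = 1 / 4 ^ p" if "c > 0" for c :: real
      using that by (simp add: power_mult_distrib)
    then show ?thesis using c by blast
  qed
  finally show ?thesis .
qed

lemma eventually_dyadic_bound:
  "AE \<omega> in M. \<forall>\<^sub>F p in sequentially. \<forall>k<2 ^ p.
     level_local_time (dyadic_interval p k) x \<omega> \<le> dyadic_bound p"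
proof -
  let ?B = "\<lambda>p k. {\<omega> \<in> space M. dyadic_bound p \<le> level_local_time (dyadic_interval p k) x \<omega>}"
  define A where "A p = (\<Union>k<2 ^ Suc p. ?B (Suc p) k)" for p
  have B [measurable]: "?B p k \<in> sets M" for p k
    using level_local_time_measurable_at[OF dyadic_interval_sets, of p k x] by measurable
  have A [measurable]: "A p \<in> sets M" for p unfolding A_def by measurable
  have le: "emeasure M (A p) \<le> ennreal ((1 / 2) ^ Suc p)" for p
  proof -
    have "emeasure M (A p) \<le> (\<Sum>k<2 ^ Suc p. emeasure M (?B (Suc p) k))"
      unfolding A_def by (intro emeasure_subadditive_finite) auto
    also have "\<dots> \<le> (\<Sum>k<(2::nat) ^ Suc p. ennreal (1 / 4 ^ Suc p))"
      by (intro sum_mono prob_level_local_time_large) auto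
    also have "\<dots> = ennreal (\<Sum>k<(2::nat) ^ Suc p. 1 / 4 ^ Suc p)"
      by (rule sum_ennreal) simp
    also have "(\<Sum>k<(2::nat) ^ Suc p. 1 / 4 ^ Suc p) = (1 / 2 :: real) ^ Suc p"
    proof -
      have "(4 :: real) ^ Suc p = 2 ^ Suc p * 2 ^ Suc p"
        by (simp add: power_mult_distrib[symmetric] del: power_Suc)
      then show ?thesis by (simp add: power_one_over del: power_Suc)
    qed
    finally show ?thesis .
  qed
  have "AE \<omega> in M. \<forall>\<^sub>F p in sequentially. \<omega> \<in> space M - A p"
  proof (rule borel_cantelli_AE1)
    show "emeasure M (A p) < \<infinity>" for p
      by (metis emeasure_finite infinity_ennreal_def top.not_eq_extremum)
    show "summable (\<lambda>p. measure M (A p))"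
    proof (rule summable_comparison_test')
      show "summable (\<lambda>p. (1 / 2 :: real) ^ Suc p)" by (simp add: summable_geometric)
      show "norm (measure M (A p)) \<le> (1 / 2) ^ Suc p" if "p \<ge> 0" for p
        using le[of p] by (simp add: emeasure_eq_measure)
    qed
  qed (rule A)
  then show ?thesis
  proof eventually_elim
    case (elim \<omega>)
    have "\<forall>\<^sub>F p in sequentially. \<forall>k<2 ^ Suc p. level_local_time (dyadic_interval (Suc p) k) x \<omega> \<le> dyadic_bound (Suc p)"
      using elim by eventually_elim (auto simp: A_def not_le intro: less_imp_le)
    then show ?case by (subst eventually_sequentially_Suc[symmetric])
  qed
qed

text \<open>An interval \<open>[s, t]\<close> with \<open>1 / 2 ^ Suc p < t - s \<le> 1 / 2 ^ p\<close> is covered by two neighbouring dyadic intervals of level \<open>p\<close>,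
  and \<open>p\<close> is comparable to \<open>ln (1 / (t - s))\<close>. The constant is the factor \<open>4\<close> of \<^const>\<open>dyadic_bound\<close> times three factors
  \<open>2\<close>: for the number of intervals, for the comparison of their length with \<open>t - s\<close>, and for the base of the logarithm.\<close>

theorem level_local_time_modulus:
  "AE \<omega> in M. increment_limsup (\<lambda>s t.
     \<bar>level_local_time {0..t} x \<omega> - level_local_time {0..s} x \<omega>\<bar> /
       (\<bar>t - s\<bar> powr (1 - h) * ln (1 / \<bar>t - s\<bar>) powr h)) \<le> ereal (32 * moment_const)"
  using eventually_dyadic_bound[of x] AE_space
proof eventually_elim
  case (elim \<omega>)
  let ?l = "\<lambda>A. level_local_time A x \<omega>"
  from elim(1) obtain P where P: "\<And>p k. \<lbrakk>P \<le> p; k < 2 ^ p\<rbrakk> \<Longrightarrow> ?l (dyadic_interval p k) \<le> dyadic_bound p"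
    unfolding eventually_sequentially by blast
  have main: "\<bar>?l {0..t} - ?l {0..s}\<bar> / ((t - s) powr (1 - h) * ln (1 / (t - s)) powr h) \<le> 32 * moment_const"
    if st: "0 \<le> s" "s < t" "t \<le> 1" and close: "t - s \<le> 1 / 2 ^ Suc P" for s t
  proof -
    define \<delta> where "\<delta> = t - s"
    have \<delta>: "0 < \<delta>" "\<delta> \<le> 1 / 2 ^ Suc P" using st close by (auto simp: \<delta>_def)
    define p where "p = nat \<lfloor>log 2 (1 / \<delta>)\<rfloor>"
    have "2 ^ Suc P \<le> 1 / \<delta>" using \<delta> by (simp add: field_simps)
    then have "real (Suc P) \<le> log 2 (1 / \<delta>)"
      using \<delta> powr_realpow[of 2 "Suc P"] by (simp add: le_log_iff del: of_nat_Suc power_Suc)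
    then have pP: "Suc P \<le> p" unfolding p_def by (simp add: le_nat_floor)
    have p1: "real p \<le> log 2 (1 / \<delta>)" and p2: "log 2 (1 / \<delta>) < real p + 1"
      using \<open>real (Suc P) \<le> log 2 (1 / \<delta>)\<close> unfolding p_def by (simp_all add: of_nat_nat)
    have "2 ^ p \<le> 1 / \<delta>" using p1 \<delta> by (simp add: le_log_iff powr_realpow)
    then have up: "\<delta> \<le> 1 / 2 ^ p" using \<delta> by (simp add: field_simps)
    have "1 / \<delta> < 2 ^ Suc p"
      using p2 \<delta> powr_realpow[of 2 "Suc p"] by (simp add: log_less_iff add.commute)
    then have low: "1 / 2 ^ p < 2 * \<delta>" using \<delta> by (simp add: field_simps)
    define k where "k = nat \<lfloor>s * 2 ^ p\<rfloor>"
    \<comment> \<open>The minimum keeps the second interval inside \<open>[0, 1]\<close> when \<open>s\<close> lies in the last dyadic interval.\<close>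
    define k' where "k' = min (Suc k) (2 ^ p - 1)"
    have k1: "real k \<le> s * 2 ^ p" and k2: "s * 2 ^ p < real k + 1"
      using st unfolding k_def by (simp_all add: of_nat_nat)
    have "s * 2 ^ p < 2 ^ p" using st by simp
    with k1 have "real k < 2 ^ p" by linarith
    then have kp: "k < 2 ^ p" by (metis of_nat_less_iff of_nat_numeral of_nat_power)
    have kp': "k' < 2 ^ p" unfolding k'_def by (simp add: min_less_iff_disj)
    have cover: "{s..t} \<subseteq> dyadic_interval p k \<union> dyadic_interval p k'"
    proof
      fix r assume r: "r \<in> {s..t}"
      have "real k / 2 ^ p \<le> s" using k1 by (simp add: divide_le_eq)
      then have r1: "real k / 2 ^ p \<le> r" using r by simp
      show "r \<in> dyadic_interval p k \<union> dyadic_interval p k'"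
      proof (cases "r \<le> real (Suc k) / 2 ^ p")
        case True
        then show ?thesis using r1 by (simp add: dyadic_interval_def)
      next
        case False
        moreover have "r \<le> 1" using r st by simp
        ultimately have "real (Suc k) / 2 ^ p < 1" by (meson less_le_trans not_le)
        then have "real (Suc k) < 2 ^ p" by (simp add: divide_less_eq)
        then have "Suc k < 2 ^ p" by (metis of_nat_less_iff of_nat_numeral of_nat_power)
        then have "k' = Suc k" by (simp add: k'_def)
        moreover have "r \<le> real (Suc (Suc k)) / 2 ^ p"
        proof -
          have "r \<le> s + \<delta>" using r by (simp add: \<delta>_def)
          also have "\<dots> \<le> (real k + 1) / 2 ^ p + 1 / 2 ^ p"
            using k2 up by (intro add_mono) (simp_all add: le_divide_eq)
          finally show ?thesis by (simp add: add_divide_distrib)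
        qed
        ultimately show ?thesis using False by (simp add: dyadic_interval_def)
      qed
    qed
    have "\<bar>?l {0..t} - ?l {0..s}\<bar> \<le> ?l (dyadic_interval p k) + ?l (dyadic_interval p k')"
      by (rule level_local_time_increment_le[OF st kp kp' cover elim(2)])
    also have "\<dots> \<le> dyadic_bound p + dyadic_bound p"
      using pP by (intro add_mono P kp kp') auto
    also have "\<dots> = 8 * moment_const * (real p powr h * (1 / 2 ^ p) powr (1 - h))"
      by (simp add: dyadic_bound_def)
    also have "\<dots> \<le> 8 * moment_const * ((2 * ln (1 / \<delta>) powr h) * (2 * \<delta> powr (1 - h)))"
    proof (intro mult_left_mono mult_mono)
      have "1 / 2 ^ Suc P < (1 :: real)" using one_less_power[of "2 :: real" "Suc P"] by (simp add: divide_less_eq)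
      then have "\<delta> < 1" using \<delta>(2) by linarith
      then have ln_pos: "ln (1 / \<delta>) > 0" using \<delta> by simp
      have "real p \<le> ln (1 / \<delta>) / ln 2" using p1 by (simp add: log_def)
      also have "\<dots> \<le> ln (1 / \<delta>) / (1 / 2)"
        using ln_pos ln2_ge_two_thirds by (intro divide_left_mono) auto
      finally have "real p \<le> 2 * ln (1 / \<delta>)" by simp
      then have "real p powr h \<le> (2 * ln (1 / \<delta>)) powr h" using h by (intro powr_mono2) auto
      also have "\<dots> = 2 powr h * ln (1 / \<delta>) powr h" using ln_pos by (simp add: powr_mult)
      also have "\<dots> \<le> 2 * ln (1 / \<delta>) powr h"
        using h powr_mono[of h 1 2] by (intro mult_right_mono) auto
      finally show "real p powr h \<le> 2 * ln (1 / \<delta>) powr h" .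
      have "(1 / 2 ^ p) powr (1 - h) \<le> (2 * \<delta>) powr (1 - h)"
        using low h by (intro powr_mono2) auto
      also have "\<dots> = 2 powr (1 - h) * \<delta> powr (1 - h)" using \<delta> by (simp add: powr_mult)
      also have "\<dots> \<le> 2 * \<delta> powr (1 - h)"
        using h powr_mono[of "1 - h" 1 2] by (intro mult_right_mono) auto
      finally show "(1 / 2 ^ p) powr (1 - h) \<le> 2 * \<delta> powr (1 - h)" .
    qed (use moment_const_pos in auto)
    finally have "\<bar>?l {0..t} - ?l {0..s}\<bar> \<le> 32 * moment_const * (\<delta> powr (1 - h) * ln (1 / \<delta>) powr h)"
      by (simp add: mult_ac)
    moreover have "\<delta> powr (1 - h) * ln (1 / \<delta>) powr h \<ge> 0" by simp
    ultimately show ?thesis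
      using moment_const_pos unfolding \<delta>_def[symmetric]
      by (cases "\<delta> powr (1 - h) * ln (1 / \<delta>) powr h = 0") (auto simp: divide_le_eq)
  qed
  show ?case
  proof (rule increment_limsup_le)
    show "0 < 1 / (2::real) ^ Suc P" by simp
    fix s t :: real
    assume *: "s \<in> {0..1}" "t \<in> {0..1}" "0 < \<bar>t - s\<bar>" "\<bar>t - s\<bar> \<le> 1 / 2 ^ Suc P"
    show "\<bar>?l {0..t} - ?l {0..s}\<bar> / (\<bar>t - s\<bar> powr (1 - h) * ln (1 / \<bar>t - s\<bar>) powr h) \<le> 32 * moment_const"
    proof (cases "s < t")
      case True
      then show ?thesis using main[of s t] * by simp
    next
      case False
      then have "t < s" "\<bar>t - s\<bar> = s - t" using * by auto
      then show ?thesis using main[of t s] * by (simp add: abs_minus_commute[of "?l {0..t}"])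
    qed
  qed
qed

end

section \<open>Multifractional Brownian motion\<close>

lemma measurable_extend_unit_interval:
  fixes X :: "real \<Rightarrow> 'w \<Rightarrow> real"
  assumes X: "(\<lambda>(t, \<omega>). X t \<omega>) \<in> borel_measurable (restrict_space borel {0..1} \<Otimes>\<^sub>M M)"
  shows "(\<lambda>(t, \<omega>). if t \<in> {0..1} then X t \<omega> else 0) \<in> borel_measurable (borel \<Otimes>\<^sub>M M)"
proof -
  let ?N = "borel \<Otimes>\<^sub>M M :: (real \<times> 'w) measure" and ?P = "\<lambda>z :: real \<times> 'w. fst z \<in> {0..1}"
  have P: "{z \<in> space ?N. ?P z} \<in> sets ?N" by measurable
  have "(\<lambda>z. (fst z, snd z)) \<in> measurable (restrict_space ?N {z. ?P z}) (restrict_space borel {0..1} \<Otimes>\<^sub>M M)"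
    by (intro measurable_Pair measurable_restrict_space2 measurable_restrict_space1 measurable_fst measurable_snd)
       (auto simp: space_restrict_space)
  from measurable_compose[OF this X]
  have "(\<lambda>z. X (fst z) (snd z)) \<in> borel_measurable (restrict_space ?N {z. ?P z})"
    unfolding prod.case .
  then have "(\<lambda>z. if ?P z then X (fst z) (snd z) else 0) \<in> borel_measurable ?N"
    using P by (subst measurable_If_restrict_space_iff) auto
  then show ?thesis by (simp add: split_beta')
qed

lemma local_time_cong:
  assumes eq: "\<And>t \<omega>. t \<in> {0..1} \<Longrightarrow> X t \<omega> = Y t \<omega>" and X: "local_time M X L"
  shows "local_time M Y L"
proof -
  have occ: "occupation_measure (\<lambda>t. X t \<omega>) A = occupation_measure (\<lambda>t. Y t \<omega>) A" if "A \<subseteq> {0..1}" for A \<omega>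
    unfolding occupation_measure_def
    by (rule distr_cong) (use that eq in \<open>auto simp: space_restrict_space\<close>)
  have int: "(\<integral>\<^sup>+t\<in>A. f (X t \<omega>) \<partial>lborel) = (\<integral>\<^sup>+t\<in>A. f (Y t \<omega>) \<partial>lborel)" if "A \<subseteq> {0..1}" for A \<omega> and f :: "real \<Rightarrow> ennreal"
    using that eq by (intro nn_integral_cong) (auto simp: indicator_def)
  show ?thesis
    using X unfolding local_time_def by (simp add: occ int cong: conj_cong imp_cong)
qed

theorem theorem3p4:
  fixes M :: "'w measure" and W X :: "real \<Rightarrow> 'w \<Rightarrow> real"
    and H :: "real \<Rightarrow> real" and \<mu> \<nu> H01 :: real
  assumes "two_sided_brownian_motion M W"
    and "0 < \<mu>" and "\<nu> < 1"
    and "H \<in> borel_measurable (restrict_space borel {0..})"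
    and "\<forall>t\<ge>0. H t \<in> {\<mu>..\<nu>}"
    and "multifractional_brownian_motion M W H X"
    and "H01 = (SUP s\<in>{0..1}. H s)"
  shows "\<exists>L. local_time M X L \<and>
    (\<forall>x. \<exists>C3>0. AE \<omega> in M.
       increment_limsup (\<lambda>s t.
         \<bar>L {0..t} x \<omega> - L {0..s} x \<omega>\<bar> /
           (\<bar>t - s\<bar> powr (1 - H01) * ln (1 / \<bar>t - s\<bar>) powr H01)) \<le> ereal C3)"
proof -
  interpret two_sided_brownian_motion M W by fact
  have bdd: "bdd_above (H ` {0..1})"
    using assms(5) by (intro bdd_aboveI[of _ \<nu>]) auto
  have H_le: "H t \<le> H01" if "t \<in> {0..1}" for t
    unfolding assms(7) using bdd that by (rule cSUP_upper2) simp
  have "H01 \<le> \<nu>"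
    unfolding assms(7) using assms(5) by (intro cSUP_least) auto
  then have "H01 < 1" using assms(3) by simp
  have "\<mu> \<le> H 0" using assms(5) by simp
  then have "0 < H01" using assms(2) H_le[of 0] by simp
  note H01 = \<open>0 < H01\<close> \<open>H01 < 1\<close>
  have "\<exists>C>0. \<forall>j t a b. (\<forall>i<j. t i < t (Suc i)) \<longrightarrow> 0 \<le> t 0 \<longrightarrow> t j \<le> 1 \<longrightarrow> a < b \<longrightarrow>
       emeasure M {\<omega> \<in> space M. \<forall>i<j. X (t (Suc i)) \<omega> \<in> {a<..<b}}
       \<le> (\<Prod>i<j. ennreal (C * (b - a) * (t (Suc i) - t i) powr (- H01)))"
    by (rule mbm_small_ball[OF assms(2,3,5,6) H_le H01(2)])
  then obtain C where C: "C > 0" and small: "\<forall>j t a b. (\<forall>i<j. t i < t (Suc i)) \<longrightarrow> 0 \<le> t 0 \<longrightarrow> t j \<le> 1 \<longrightarrow> a < b \<longrightarrow>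
       emeasure M {\<omega> \<in> space M. \<forall>i<j. X (t (Suc i)) \<omega> \<in> {a<..<b}}
       \<le> (\<Prod>i<j. ennreal (C * (b - a) * (t (Suc i) - t i) powr (- H01)))"
    by (elim exE conjE)
  \<comment> \<open>Local times only see times in \<open>[0, 1]\<close>. Extending by zero gives a process that is jointly measurable on
    the whole line, so that Tonelli applies without restricted spaces.\<close>
  define Y where "Y t \<omega> = (if t \<in> {0..1} then X t \<omega> else 0)" for t \<omega>
  interpret Y: small_ball_process M Y H01 C
  proof
    show "(\<lambda>(t, \<omega>). Y t \<omega>) \<in> borel_measurable (borel \<Otimes>\<^sub>M M)"
      unfolding Y_def using assms(6) unfolding multifractional_brownian_motion_def
      by (intro measurable_extend_unit_interval) blast
    fix j and t :: "nat \<Rightarrow> real" and a b :: real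
    assume t: "\<And>i. i < j \<Longrightarrow> t i < t (Suc i)" "0 \<le> t 0" "t j \<le> 1" and ab: "a < b"
    have mono: "t i \<le> t m" if "i \<le> m" "m \<le> j" for i m
      using that
    proof (induction rule: dec_induct)
      case (step m)
      then show ?case using t(1)[of m] by simp
    qed simp
    have "Y (t (Suc i)) \<omega> = X (t (Suc i)) \<omega>" if "i < j" for i \<omega>
      using mono[of 0 "Suc i"] mono[of "Suc i" j] t that by (simp add: Y_def)
    then have "{\<omega> \<in> space M. \<forall>i<j. Y (t (Suc i)) \<omega> \<in> {a<..<b}} = {\<omega> \<in> space M. \<forall>i<j. X (t (Suc i)) \<omega> \<in> {a<..<b}}"
      by auto
    then show "emeasure M {\<omega> \<in> space M. \<forall>i<j. Y (t (Suc i)) \<omega> \<in> {a<..<b}}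
       \<le> (\<Prod>i<j. ennreal (C * (b - a) * (t (Suc i) - t i) powr (- H01)))"
      using small[rule_format, of j t a b, OF t ab] by simp
  qed (use H01 C in auto)
  have "local_time M X Y.level_local_time"
    by (rule local_time_cong[OF _ Y.local_time_level_local_time]) (simp add: Y_def)
  moreover have "32 * Y.moment_const > 0" using Y.moment_const_pos by simp
  ultimately show ?thesis
    using Y.level_local_time_modulus by blast
qed

end
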